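(* Let $f(x)=x^2+c$ for some integer $c$. If $c\neq -2$ and $-c$ is not a square, then all of the following statements hold: 1. The Hall-Lang conjecture implies that $|\mathrm{Aut}(\mathbb{T}_\infty):G_\infty(f)|$ is finite. 2. If the weak form of Hall's conjecture for the Mordell curves holds with $C=100$ and $\epsilon=4$, then when $f(x)=x^2+3$ we have $|\mathrm{Aut}(\mathbb{T}_\infty):G_\infty(f)|=2$.
   Context: $f^n$ denotes the $n$-th iterate of $f$, and $G_n(f)$ is the Galois group over $\mathbb{Q}$ of the splitting field of $f^n$. $\mathbb{T}_\infty=\bigcup_{n\ge 0} f^{-n}(0)$ (preimages in $\overline{\mathbb{Q}}$), regarded as a binary rooted tree with root $0$ in which $\alpha,\beta$ share an edge iff $f(\alpha)=\beta$; $G_\infty(f)=\varprojlim G_n(f)$, which embeds in the group $\mathrm{Aut}(\mathbb{T}_\infty)$ of rooted tree automorphisms. Hall-Lang conjecture: there are absolute constants $C$ and $\kappa$ such that for every elliptic curve $E/\mathbb{Q}$ given by a Weierstrass equation $y^2=x^3+Ax+B$ with $A,B\in\mathbb{Z}$ and every integral point $P\in E(\mathbb{Q})$, one has $|x(P)|\le C\cdot\max\{|A|,|B|\}^{\kappa}$. Weak form of Hall's conjecture with constants $C$ and $\epsilon$: for all nonzero $D\in\mathbb{Z}$ and all $x,y\in\mathbb{Z}$ with $y^2=x^3+D$, one has $|x|\le C\cdot |D|^{2+\epsilon}$. (With $C=100$ and $\epsilon=4$ this reads $|x|\le 100\,|D|^{6}$.) *)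

theory Defs
  imports
    "HOL-Algebra.Algebraic_Closure_Type"
    "HOL-Algebra.Generated_Fields"
    "HOL-Algebra.QuotRing"
    "HOL-Algebra.Product_Groups"
    "HOL-Algebra.Bij"
    Complex_Main
begin

text \<open>
  The algebraic closure of the rationals is \<^typ>\<open>rat alg_closure\<close>, with the embedding
  \<^const>\<open>to_ac\<close> of the rationals.
\<close>

definition root_set :: "rat poly \<Rightarrow> rat alg_closure set" where
  "root_set p = {\<alpha>. poly (map_poly to_ac p) \<alpha> = 0}"

definition splitting_field :: "rat poly \<Rightarrow> rat alg_closure set" where
  "splitting_field p = generate_field ring_of_type_algebra (range to_ac \<union> root_set p)"

text \<open>
  Automorphisms over the rationals of a subfield \<open>K\<close>. As in \<^const>\<open>BijGroup\<close>, they are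
  extensional functions (undefined outside \<open>K\<close>), so that each automorphism is counted once.
\<close>

definition galois_group :: "rat alg_closure set \<Rightarrow> (rat alg_closure \<Rightarrow> rat alg_closure) monoid" where
  "galois_group K = BijGroup K \<lparr>carrier := {\<sigma> \<in> Bij K.
      \<sigma> \<in> ring_iso (ring_of_type_algebra\<lparr>carrier := K\<rparr>) (ring_of_type_algebra\<lparr>carrier := K\<rparr>) \<and>
      (\<forall>q. \<sigma> (to_ac q) = to_ac q)}\<rparr>"

definition poly_iterate :: "rat poly \<Rightarrow> nat \<Rightarrow> rat poly" where
  "poly_iterate f n = (pcompose f ^^ n) [:0, 1:]"

definition preimage_tree :: "rat poly \<Rightarrow> rat alg_closure set" where
  "preimage_tree f = (\<Union>n. root_set (poly_iterate f n))"

definition tree_edge :: "rat poly \<Rightarrow> rat alg_closure \<Rightarrow> rat alg_closure \<Rightarrow> bool" where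
  "tree_edge f \<alpha> \<beta> \<longleftrightarrow> poly (map_poly to_ac f) \<alpha> = \<beta> \<or> poly (map_poly to_ac f) \<beta> = \<alpha>"

definition tree_aut :: "rat poly \<Rightarrow> (rat alg_closure \<Rightarrow> rat alg_closure) monoid" where
  "tree_aut f = BijGroup (preimage_tree f) \<lparr>carrier := {\<sigma> \<in> Bij (preimage_tree f).
      \<sigma> 0 = 0 \<and>
      (\<forall>\<alpha>\<in>preimage_tree f. \<forall>\<beta>\<in>preimage_tree f.
         tree_edge f (\<sigma> \<alpha>) (\<sigma> \<beta>) \<longleftrightarrow> tree_edge f \<alpha> \<beta>)}\<rparr>"

definition G_fin :: "rat poly \<Rightarrow> nat \<Rightarrow> (rat alg_closure \<Rightarrow> rat alg_closure) monoid" where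
  "G_fin f n = galois_group (splitting_field (poly_iterate f n))"

text \<open>The inverse limit of the groups \<^term>\<open>G_fin f n\<close> along the restriction maps.\<close>

definition G_inf :: "rat poly \<Rightarrow> (nat \<Rightarrow> rat alg_closure \<Rightarrow> rat alg_closure) monoid" where
  "G_inf f = product_group UNIV (G_fin f) \<lparr>carrier := {s \<in> carrier (product_group UNIV (G_fin f)).
      \<forall>m n. m \<le> n \<longrightarrow> restrict (s n) (splitting_field (poly_iterate f m)) = s m}\<rparr>"

text \<open>
  The embedding of \<^term>\<open>G_inf f\<close> into \<^term>\<open>tree_aut f\<close>: the \<open>n\<close>-th component acts on the
  roots of the \<open>n\<close>-th iterate. The level of a vertex is unique unless 0 is periodic under \<open>f\<close>.
\<close>

definition tree_action ::
  "rat poly \<Rightarrow> (nat \<Rightarrow> rat alg_closure \<Rightarrow> rat alg_closure) \<Rightarrow> rat alg_closure \<Rightarrow> rat alg_closure" where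
  "tree_action f s =
     (\<lambda>\<alpha>\<in>preimage_tree f. s (LEAST n. \<alpha> \<in> root_set (poly_iterate f n)) \<alpha>)"

definition G_inf_cosets :: "rat poly \<Rightarrow> (rat alg_closure \<Rightarrow> rat alg_closure) set set" where
  "G_inf_cosets f = rcosets\<^bsub>tree_aut f\<^esub> (tree_action f ` carrier (G_inf f))"

text \<open>The condition \<open>4 * A ^ 3 + 27 * B ^ 2 \<noteq> 0\<close> says that the Weierstrass cubic is nonsingular.\<close>

definition hall_lang_conjecture :: bool where
  "hall_lang_conjecture \<longleftrightarrow> (\<exists>C \<kappa> :: real. \<forall>A B :: int. 4 * A ^ 3 + 27 * B ^ 2 \<noteq> 0 \<longrightarrow>
     (\<forall>x y :: int. y ^ 2 = x ^ 3 + A * x + B \<longrightarrow>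
        real_of_int \<bar>x\<bar> \<le> C * real_of_int (max \<bar>A\<bar> \<bar>B\<bar>) powr \<kappa>))"

definition weak_hall_conjecture :: "real \<Rightarrow> real \<Rightarrow> bool" where
  "weak_hall_conjecture C \<epsilon> \<longleftrightarrow> (\<forall>D x y :: int. D \<noteq> 0 \<longrightarrow> y ^ 2 = x ^ 3 + D \<longrightarrow>
     real_of_int \<bar>x\<bar> \<le> C * real_of_int \<bar>D\<bar> powr (2 + \<epsilon>))"

end

theory Submission
  imports Defs
begin

text \<open>
  Let \<open>F\<close> be the map \<open>z \<mapsto> z\<^sup>2 + c\<close>, let \<open>K n\<close> be the splitting field of \<open>f\<^sup>n\<close> and \<open>crit n\<close> the
  integer \<open>F\<^sup>n(0)\<close>. The field \<open>K (n + 1)\<close> arises from \<open>K n\<close> by adjoining the square roots of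
  \<open>\<rho> - c\<close>, one for each \<open>\<rho>\<close> in level \<open>n\<close> of the tree. By Kummer theory, an automorphism of \<open>K n\<close>
  extends with arbitrarily prescribed signs of these roots unless some product of the \<open>\<rho> - c\<close> over
  a nonempty subset of the level is a square in \<open>K n\<close>. The subsets with this property form a vector
  space over the field with two elements on which a 2-group acts, so if it is nonzero it contains a
  nonzero invariant subset (\<open>fixed_subset_exists\<close>); the Galois group is transitive on the level
  (\<open>galois_transitive\<close>), so this subset is the whole level. Its product is, up to sign,
  \<open>crit (n + 1)\<close>. Hence the step from \<open>K n\<close> to \<open>K (n + 1)\<close> is maximal unless \<open>crit (n + 1)\<close> is a square
  in \<open>K n\<close> (\<open>maximal_step_relations\<close>; for the first step the number is \<open>- c\<close>).

  Suppose that it is a square there, and write \<open>crit (n + 1) = d y\<^sup>2\<close> with \<open>d\<close> squarefree. The field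
  \<open>K n\<close> is unramified at every odd prime that divides none of \<open>crit 1, \<dots>, crit n\<close>, so every odd prime
  divisor of \<open>d\<close> divides one of these numbers (\<open>ramified_prime_divides_orbit\<close>), and then even \<open>crit m\<close>
  for a proper divisor \<open>m\<close> of \<open>n + 1\<close>, because the orbit of 0 is periodic modulo such a prime. Thus
  \<open>|d|\<close> is at most \<open>2 |crit 1 \<cdots> crit k|\<close> with \<open>k = (n + 1) div 2\<close> (\<open>imprimitive_class_bound\<close>). On the
  other hand, with \<open>u = crit n\<close> one has \<open>u - c = (crit (n - 1))\<^sup>2\<close>, so that
  \<open>d (y crit (n - 1))\<^sup>2 = (u\<^sup>2 + c)(u - c)\<close> is an integral point on a quadratic twist of a fixed elliptic curve.
  The Hall-Lang conjecture bounds \<open>|u|\<close> by a power of \<open>|d|\<close>. But \<open>log |u|\<close> grows like \<open>2\<^sup>n\<close> and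
  \<open>log |d|\<close> at most like \<open>2\<close> to the power \<open>n / 2\<close>; so all but finitely many steps are maximal
  (\<open>hall_lang_eventually_maximal\<close>), and the index is finite since the coset of a tree automorphism
  depends only on its action on finitely many levels (\<open>finite_cosets_if_eventually_maximal\<close>).

  For \<open>c = 3\<close> the curve is a Mordell curve, because \<open>(u\<^sup>2 + 3)(u - 3) = (u - 1)\<^sup>3 - 8\<close>. Here
  \<open>crit 2 = 12\<close> and \<open>crit 3 = 147\<close> are both 3 times a square. This gives one relation at the
  third step and no other (\<open>relations_2\<close>): on the image of Galois the sign of the permutation of the
  square roots at the second level equals the one at the third level, and the tree automorphisms with this
  property form a subgroup of index 2. All other steps are maximal: the first two by direct computation,
  the fourth to eighth, the tenth and the twelfth because of small prime divisors or residues of the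
  \<open>crit n\<close>, and the remaining ones by the weak Hall conjecture.
\<close>

section \<open>Adjoining square roots\<close>

definition is_subfield :: "'a::field set \<Rightarrow> bool" where
  "is_subfield K \<longleftrightarrow> 1 \<in> K \<and> (\<forall>x\<in>K. \<forall>y\<in>K. x - y \<in> K \<and> x * y \<in> K) \<and> (\<forall>x\<in>K. inverse x \<in> K)"

lemma is_subfield_one: "is_subfield K \<Longrightarrow> 1 \<in> K"
  and is_subfield_diff: "is_subfield K \<Longrightarrow> x \<in> K \<Longrightarrow> y \<in> K \<Longrightarrow> x - y \<in> K"
  and is_subfield_mult: "is_subfield K \<Longrightarrow> x \<in> K \<Longrightarrow> y \<in> K \<Longrightarrow> x * y \<in> K"
  and is_subfield_inverse: "is_subfield K \<Longrightarrow> x \<in> K \<Longrightarrow> inverse x \<in> K"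
  by (auto simp: is_subfield_def)

lemma is_subfield_zero: "is_subfield K \<Longrightarrow> 0 \<in> K"
  using is_subfield_diff[of K 1 1] is_subfield_one by auto

lemma is_subfield_uminus: "is_subfield K \<Longrightarrow> x \<in> K \<Longrightarrow> - x \<in> K"
  using is_subfield_diff[of K 0 x] is_subfield_zero by auto

lemma is_subfield_add: "is_subfield K \<Longrightarrow> x \<in> K \<Longrightarrow> y \<in> K \<Longrightarrow> x + y \<in> K"
  using is_subfield_diff[of K x "- y"] is_subfield_uminus by auto

lemma is_subfield_divide: "is_subfield K \<Longrightarrow> x \<in> K \<Longrightarrow> y \<in> K \<Longrightarrow> x / y \<in> K"
  by (simp add: divide_inverse is_subfield_mult is_subfield_inverse)

lemma is_subfield_power: "is_subfield K \<Longrightarrow> x \<in> K \<Longrightarrow> x ^ n \<in> K"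
  by (induction n) (auto intro: is_subfield_mult is_subfield_one)

lemma is_subfield_of_nat: "is_subfield K \<Longrightarrow> of_nat n \<in> K"
  by (induction n) (auto intro: is_subfield_add is_subfield_one is_subfield_zero)

lemma is_subfield_of_int: "is_subfield K \<Longrightarrow> of_int n \<in> K"
  by (cases n) (auto intro: is_subfield_of_nat is_subfield_diff is_subfield_uminus is_subfield_one)

lemma is_subfield_numeral: "is_subfield K \<Longrightarrow> numeral n \<in> K"
  using is_subfield_of_nat[of K "numeral n"] by simp

lemma is_subfield_prod: "is_subfield K \<Longrightarrow> (\<And>x. x \<in> S \<Longrightarrow> g x \<in> K) \<Longrightarrow> prod g S \<in> K"
  by (induction S rule: infinite_finite_induct) (auto intro: is_subfield_mult is_subfield_one)

lemmas is_subfield_intros = is_subfield_one is_subfield_zero is_subfield_diff is_subfield_add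
  is_subfield_uminus is_subfield_mult is_subfield_divide is_subfield_power is_subfield_of_int
  is_subfield_numeral is_subfield_prod is_subfield_inverse

lemma is_subfield_cancel:
  assumes "is_subfield K" "x * y \<in> K" "y \<in> K" "y \<noteq> 0"
  shows "x \<in> K"
proof -
  have "x = x * y / y" using assms by simp
  thus ?thesis using is_subfield_divide[OF assms(1-3)] by metis
qed

text \<open>
  Values outside of \<open>K\<close> are arbitrary, so that extending a homomorphism means to find one on the
  larger field that agrees with it on \<open>K\<close>.
\<close>

definition field_hom :: "'a::field set \<Rightarrow> ('a \<Rightarrow> 'a) \<Rightarrow> bool" where
  "field_hom K \<sigma> \<longleftrightarrow> \<sigma> 1 = 1 \<and> (\<forall>x\<in>K. \<forall>y\<in>K. \<sigma> (x + y) = \<sigma> x + \<sigma> y \<and> \<sigma> (x * y) = \<sigma> x * \<sigma> y)"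

lemma field_hom_one: "field_hom K \<sigma> \<Longrightarrow> \<sigma> 1 = 1"
  and field_hom_add: "field_hom K \<sigma> \<Longrightarrow> x \<in> K \<Longrightarrow> y \<in> K \<Longrightarrow> \<sigma> (x + y) = \<sigma> x + \<sigma> y"
  and field_hom_mult: "field_hom K \<sigma> \<Longrightarrow> x \<in> K \<Longrightarrow> y \<in> K \<Longrightarrow> \<sigma> (x * y) = \<sigma> x * \<sigma> y"
  by (auto simp: field_hom_def)

lemma field_hom_subset: "field_hom K \<sigma> \<Longrightarrow> K' \<subseteq> K \<Longrightarrow> field_hom K' \<sigma>"
  by (auto simp: field_hom_def)

lemma field_hom_id: "field_hom K (\<lambda>x. x)"
  by (simp add: field_hom_def)

context
  fixes K :: "'a::field set" and \<sigma>
  assumes K: "is_subfield K" and \<sigma>: "field_hom K \<sigma>"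
begin

lemma field_hom_zero: "\<sigma> 0 = 0"
  using field_hom_add[OF \<sigma>, of 0 0] is_subfield_zero[OF K] by (metis add_0 add_cancel_right_right)

lemma field_hom_uminus: "x \<in> K \<Longrightarrow> \<sigma> (- x) = - \<sigma> x"
  using field_hom_add[OF \<sigma>, of x "- x"] is_subfield_uminus[OF K] field_hom_zero
  by (simp add: add_eq_0_iff)

lemma field_hom_diff: "x \<in> K \<Longrightarrow> y \<in> K \<Longrightarrow> \<sigma> (x - y) = \<sigma> x - \<sigma> y"
  using field_hom_add[OF \<sigma>, of x "- y"] is_subfield_uminus[OF K] field_hom_uminus by simp

lemma field_hom_inverse: "x \<in> K \<Longrightarrow> \<sigma> (inverse x) = inverse (\<sigma> x)"
proof (cases "x = 0")
  case False
  assume x: "x \<in> K"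
  have "\<sigma> x * \<sigma> (inverse x) = 1"
    using field_hom_mult[OF \<sigma> x is_subfield_inverse[OF K x]] False field_hom_one[OF \<sigma>] by simp
  thus ?thesis by (metis inverse_unique)
qed (simp add: field_hom_zero)

lemma field_hom_eq_0_iff: "x \<in> K \<Longrightarrow> \<sigma> x = 0 \<longleftrightarrow> x = 0"
proof
  assume x: "x \<in> K" "\<sigma> x = 0"
  have "\<sigma> x * \<sigma> (inverse x) = 1" if "x \<noteq> 0"
    using field_hom_mult[OF \<sigma> x(1) is_subfield_inverse[OF K x(1)]] that field_hom_one[OF \<sigma>] by simp
  thus "x = 0" using x by auto
qed (simp add: field_hom_zero)

lemma field_hom_inj_on: "inj_on \<sigma> K"
proof (rule inj_onI)
  fix x y assume xy: "x \<in> K" "y \<in> K" "\<sigma> x = \<sigma> y"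
  hence "\<sigma> (x - y) = 0" by (simp add: field_hom_diff)
  thus "x = y" using field_hom_eq_0_iff[of "x - y"] is_subfield_diff[OF K] xy by simp
qed

lemma field_hom_of_nat: "\<sigma> (of_nat n) = of_nat n"
  by (induction n)
    (auto simp: field_hom_zero field_hom_one[OF \<sigma>]
      field_hom_add[OF \<sigma> is_subfield_one[OF K] is_subfield_of_nat[OF K]])

lemma field_hom_of_int: "\<sigma> (of_int n) = of_int n"
proof (cases n)
  case (neg k)
  have "\<sigma> (- of_nat (Suc k)) = - of_nat (Suc k)"
    using field_hom_uminus[OF is_subfield_of_nat[OF K]] field_hom_of_nat[of "Suc k"] by metis
  thus ?thesis using neg by simp
qed (simp add: field_hom_of_nat)

lemma field_hom_power2: "x \<in> K \<Longrightarrow> \<sigma> (x ^ 2) = (\<sigma> x) ^ 2"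
  by (simp add: power2_eq_square field_hom_mult[OF \<sigma>])

lemma field_hom_prod: "(\<And>x. x \<in> S \<Longrightarrow> g x \<in> K) \<Longrightarrow> \<sigma> (prod g S) = (\<Prod>x\<in>S. \<sigma> (g x))"
proof (induction S rule: infinite_finite_induct)
  case (insert x S)
  have "prod g S \<in> K" using insert by (auto intro: is_subfield_prod K)
  thus ?case using insert by (simp add: field_hom_mult[OF \<sigma>])
qed (simp_all add: field_hom_one[OF \<sigma>])

lemma is_subfield_field_hom_image: "is_subfield (\<sigma> ` K)"
  unfolding is_subfield_def
proof (intro conjI ballI)
  show "1 \<in> \<sigma> ` K" using field_hom_one[OF \<sigma>] is_subfield_one[OF K] by (metis imageI)
next
  fix x y assume "x \<in> \<sigma> ` K" "y \<in> \<sigma> ` K"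
  then obtain u v where "u \<in> K" "v \<in> K" "x = \<sigma> u" "y = \<sigma> v" by auto
  thus "x - y \<in> \<sigma> ` K" "x * y \<in> \<sigma> ` K"
    using field_hom_diff[of u v] field_hom_mult[OF \<sigma>, of u v] K
    by (metis imageI is_subfield_diff, metis imageI is_subfield_mult)
next
  fix x assume "x \<in> \<sigma> ` K"
  thus "inverse x \<in> \<sigma> ` K"
    using field_hom_inverse is_subfield_inverse[OF K] by (metis (no_types, lifting) image_iff)
qed

end

lemma field_hom_compose:
  assumes "field_hom K \<sigma>" "field_hom K' \<tau>" "\<sigma> ` K \<subseteq> K'"
  shows "field_hom K (\<lambda>x. \<tau> (\<sigma> x))"
  using assms unfolding field_hom_def by (auto simp: image_subset_iff)

lemma field_hom_id_prime:
  assumes K: "is_subfield K" and \<sigma>: "field_hom K \<sigma>" and x: "x = of_int a / of_int b"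
  shows "\<sigma> x = x"
proof -
  have "\<sigma> x = \<sigma> (of_int a * inverse (of_int b))" using x by (simp add: divide_inverse)
  also have "\<dots> = of_int a * inverse (of_int b)"
    using field_hom_mult[OF \<sigma> is_subfield_of_int[OF K] is_subfield_inverse[OF K is_subfield_of_int[OF K]]]
      field_hom_inverse[OF K \<sigma> is_subfield_of_int[OF K]] field_hom_of_int[OF K \<sigma>] by metis
  finally show ?thesis using x by (simp add: divide_inverse)
qed

definition adjoin :: "'a::field set \<Rightarrow> 'a \<Rightarrow> 'a set" where
  "adjoin K b = {x + y * b |x y. x \<in> K \<and> y \<in> K}"

lemma adjoin_superset: "is_subfield K \<Longrightarrow> K \<subseteq> adjoin K b"
  unfolding adjoin_def by (force intro: is_subfield_zero)

lemma adjoin_generator: "is_subfield K \<Longrightarrow> b \<in> adjoin K b"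
  unfolding adjoin_def by (force intro: is_subfield_zero is_subfield_one)

lemma adjoin_least: "is_subfield M \<Longrightarrow> K \<subseteq> M \<Longrightarrow> b \<in> M \<Longrightarrow> adjoin K b \<subseteq> M"
  unfolding adjoin_def by (auto intro!: is_subfield_add is_subfield_mult)

lemma adjoin_trivial: "is_subfield K \<Longrightarrow> b \<in> K \<Longrightarrow> adjoin K b = K"
  using adjoin_superset[of K b] adjoin_least[of K K b] by auto

lemma adjoin_coords_unique:
  assumes K: "is_subfield K" and b: "b \<notin> K" and xy: "x \<in> K" "y \<in> K" "x' \<in> K" "y' \<in> K"
    and eq: "x + y * b = x' + y' * b"
  shows "x = x' \<and> y = y'"
proof -
  have "b * (y - y') = x' - x" using eq by (simp add: algebra_simps)
  hence "b * (y - y') \<in> K" using K xy by (simp add: is_subfield_diff)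
  hence "y - y' = 0" using is_subfield_cancel[OF K, of b "y - y'"] b K xy is_subfield_diff by blast
  thus ?thesis using eq by simp
qed

lemma is_subfield_adjoin:
  assumes K: "is_subfield K" and b: "b ^ 2 \<in> K"
  shows "is_subfield (adjoin K b)"
proof (cases "b \<in> K")
  case True thus ?thesis using adjoin_trivial[OF K] K by simp
next
  case False
  have bb: "b * b \<in> K" using b by (simp add: power2_eq_square)
  show ?thesis unfolding is_subfield_def
  proof (intro conjI ballI)
    show "1 \<in> adjoin K b" using adjoin_superset[OF K] is_subfield_one[OF K] by auto
  next
    fix u v assume "u \<in> adjoin K b" "v \<in> adjoin K b"
    then obtain x y x' y' where xy: "x \<in> K" "y \<in> K" "x' \<in> K" "y' \<in> K"
      and u: "u = x + y * b" and v: "v = x' + y' * b" unfolding adjoin_def by auto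
    have "u - v = (x - x') + (y - y') * b" by (simp add: u v algebra_simps)
    moreover have "x - x' \<in> K" "y - y' \<in> K" using K xy by (auto intro: is_subfield_intros)
    ultimately show "u - v \<in> adjoin K b" unfolding adjoin_def by blast
    have "u * v = (x * x' + y * y' * (b * b)) + (x * y' + x' * y) * b" by (simp add: u v algebra_simps)
    moreover have "x * x' + y * y' * (b * b) \<in> K" "x * y' + x' * y \<in> K"
      using K xy bb by (auto intro!: is_subfield_add is_subfield_mult)
    ultimately show "u * v \<in> adjoin K b" unfolding adjoin_def by blast
  next
    fix u assume "u \<in> adjoin K b"
    then obtain x y where xy: "x \<in> K" "y \<in> K" and u: "u = x + y * b" unfolding adjoin_def by auto
    show "inverse u \<in> adjoin K b"
    proof (cases "u = 0")
      case True thus ?thesis using adjoin_superset[OF K] is_subfield_zero[OF K] by auto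
    next
      case nz: False
      define N where "N = x * x - y * y * (b * b)"
      have N: "N \<in> K" unfolding N_def using K xy bb by (auto intro!: is_subfield_diff is_subfield_mult)
      have eqN: "u * (x - y * b) = N" by (simp add: u N_def algebra_simps)
      have "x - y * b \<noteq> 0"
      proof
        assume "x - y * b = 0"
        hence "x + (- y) * b = 0 + 0 * b" by simp
        hence "x = 0 \<and> y = 0"
          using adjoin_coords_unique[OF K False xy(1) is_subfield_uminus[OF K xy(2)]
            is_subfield_zero[OF K] is_subfield_zero[OF K]] by fastforce
        thus False using nz u by simp
      qed
      hence N0: "N \<noteq> 0" using eqN nz by auto
      have "inverse u = (x - y * b) / N" using eqN nz N0 by (simp add: field_simps)
      also have "\<dots> = x / N + (- y / N) * b" by (simp add: diff_divide_distrib)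
      finally have "inverse u = x / N + (- y / N) * b" .
      moreover have "x / N \<in> K" "- y / N \<in> K" using K xy N by (auto intro: is_subfield_intros)
      ultimately show ?thesis unfolding adjoin_def by blast
    qed
  qed
qed

text \<open>
  The value on \<open>x + y b\<close> is forced to be \<open>\<sigma> x + \<sigma> y g\<close>; since \<open>b\<close> lies outside of \<open>K\<close>, the coordinates
  \<open>x\<close> and \<open>y\<close> are unique and this is a definition.
\<close>

lemma field_hom_adjoin_extension:
  assumes K: "is_subfield K" and \<sigma>: "field_hom K \<sigma>" and b: "b ^ 2 \<in> K" "b \<notin> K"
    and g: "g ^ 2 = \<sigma> (b ^ 2)"
  obtains \<sigma>' where "field_hom (adjoin K b) \<sigma>'" "\<And>x. x \<in> K \<Longrightarrow> \<sigma>' x = \<sigma> x" "\<sigma>' b = g"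
proof -
  define \<sigma>' where "\<sigma>' u = (THE w. \<exists>x\<in>K. \<exists>y\<in>K. u = x + y * b \<and> w = \<sigma> x + \<sigma> y * g)" for u
  have \<sigma>': "\<sigma>' (x + y * b) = \<sigma> x + \<sigma> y * g" if "x \<in> K" "y \<in> K" for x y
    unfolding \<sigma>'_def using that adjoin_coords_unique[OF K b(2)] by (intro the_equality) blast+
  have z: "0 \<in> K" "1 \<in> K" using K by (auto intro: is_subfield_intros)
  have bb: "b * b \<in> K" using b by (simp add: power2_eq_square)
  have gg: "\<sigma> (b * b) = g * g" using g by (simp add: power2_eq_square)
  have s: "\<sigma>' x = \<sigma> x" if "x \<in> K" for x
    using \<sigma>'[OF that z(1)] field_hom_zero[OF K \<sigma>] by simp
  have "\<sigma>' b = g" using \<sigma>'[OF z] field_hom_zero[OF K \<sigma>] field_hom_one[OF \<sigma>] by simp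
  moreover have "field_hom (adjoin K b) \<sigma>'" unfolding field_hom_def
  proof (intro conjI ballI)
    show "\<sigma>' 1 = 1" using s[OF z(2)] field_hom_one[OF \<sigma>] by simp
  next
    fix u v assume "u \<in> adjoin K b" "v \<in> adjoin K b"
    then obtain x y x' y' where xy: "x \<in> K" "y \<in> K" "x' \<in> K" "y' \<in> K"
      and u: "u = x + y * b" and v: "v = x' + y' * b" unfolding adjoin_def by auto
    have eu: "\<sigma>' u = \<sigma> x + \<sigma> y * g" and ev: "\<sigma>' v = \<sigma> x' + \<sigma> y' * g"
      using \<sigma>' xy u v by auto
    have "u + v = (x + x') + (y + y') * b" by (simp add: u v algebra_simps)
    hence "\<sigma>' (u + v) = \<sigma> (x + x') + \<sigma> (y + y') * g"
      using \<sigma>' xy is_subfield_add[OF K] by metis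
    thus "\<sigma>' (u + v) = \<sigma>' u + \<sigma>' v"
      using xy by (simp add: eu ev field_hom_add[OF \<sigma>] algebra_simps)
    have "u * v = (x * x' + y * y' * (b * b)) + (x * y' + x' * y) * b" by (simp add: u v algebra_simps)
    moreover have "x * x' + y * y' * (b * b) \<in> K" "x * y' + x' * y \<in> K"
      using K xy bb by (auto intro!: is_subfield_add is_subfield_mult)
    ultimately have "\<sigma>' (u * v) = \<sigma> (x * x' + y * y' * (b * b)) + \<sigma> (x * y' + x' * y) * g"
      using \<sigma>' by simp
    also have "\<dots> = \<sigma> x * \<sigma> x' + \<sigma> y * \<sigma> y' * (g * g) + (\<sigma> x * \<sigma> y' + \<sigma> x' * \<sigma> y) * g"
      using xy bb K by (simp add: field_hom_add[OF \<sigma>] field_hom_mult[OF \<sigma>] gg is_subfield_mult)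
    finally show "\<sigma>' (u * v) = \<sigma>' u * \<sigma>' v"
      by (simp add: eu ev algebra_simps)
  qed
  ultimately show ?thesis using s that by blast
qed

text \<open>
  The last element of the list is adjoined first.
\<close>

primrec adjoin_list :: "'a::field set \<Rightarrow> 'a list \<Rightarrow> 'a set" where
  "adjoin_list K [] = K"
| "adjoin_list K (b # bs) = adjoin (adjoin_list K bs) b"

lemma adjoin_list_subfield:
  assumes K: "is_subfield K" and "\<And>b. b \<in> set bs \<Longrightarrow> b ^ 2 \<in> K"
  shows "is_subfield (adjoin_list K bs)" "K \<subseteq> adjoin_list K bs" "set bs \<subseteq> adjoin_list K bs"
proof -
  have "is_subfield (adjoin_list K bs) \<and> K \<subseteq> adjoin_list K bs \<and> set bs \<subseteq> adjoin_list K bs"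
    using assms(2)
  proof (induction bs)
    case (Cons b bs)
    hence IH: "is_subfield (adjoin_list K bs)" "K \<subseteq> adjoin_list K bs" "set bs \<subseteq> adjoin_list K bs"
      by auto
    have "b ^ 2 \<in> adjoin_list K bs" using Cons.prems IH by auto
    thus ?case
      using is_subfield_adjoin[OF IH(1), of b] adjoin_superset[OF IH(1), of b]
        adjoin_generator[OF IH(1), of b] IH by auto
  qed (simp add: K)
  thus "is_subfield (adjoin_list K bs)" "K \<subseteq> adjoin_list K bs" "set bs \<subseteq> adjoin_list K bs" by auto
qed

lemma adjoin_list_least:
  assumes "is_subfield M" "K \<subseteq> M" "set bs \<subseteq> M"
  shows "adjoin_list K bs \<subseteq> M"
  using assms(3)
proof (induction bs)
  case (Cons b bs)
  thus ?case using adjoin_least[OF assms(1), of "adjoin_list K bs" b] by simp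
qed (simp add: assms(2))

text \<open>
  Let \<open>\<beta> = x + y b\<close> with \<open>b\<close> the root adjoined last. If \<open>\<beta>\<close> is new, then \<open>2 x y b = \<beta>\<^sup>2 - x\<^sup>2 - y\<^sup>2 b\<^sup>2\<close>
  forces \<open>x = 0\<close>, and \<open>\<beta> b = y b\<^sup>2\<close> lies in the smaller field and again has its square in \<open>K\<close>.
\<close>

lemma kummer_square_roots:
  fixes \<beta> :: "'a::field_char_0"
  assumes K: "is_subfield K" and "\<And>b. b \<in> set bs \<Longrightarrow> b ^ 2 \<in> K" and "distinct bs"
    and "\<beta> \<in> adjoin_list K bs" "\<beta> ^ 2 \<in> K"
  shows "\<exists>S\<subseteq>set bs. \<beta> * \<Prod>S \<in> K"
  using assms(2-)
proof (induction bs arbitrary: \<beta>)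
  case (Cons b bs)
  let ?M = "adjoin_list K bs"
  have M: "is_subfield ?M" "K \<subseteq> ?M" using adjoin_list_subfield[OF K, of bs] Cons.prems by auto
  have IH: "\<exists>S\<subseteq>set bs. \<gamma> * \<Prod>S \<in> K" if "\<gamma> \<in> ?M" "\<gamma> ^ 2 \<in> K" for \<gamma>
    using Cons.IH[OF _ _ that] Cons.prems by auto
  show ?case
  proof (cases "\<beta> \<in> ?M")
    case True thus ?thesis using IH[OF True] Cons.prems by auto
  next
    case False
    have b: "b ^ 2 \<in> K" using Cons.prems by simp
    have bM: "b \<notin> ?M" using False Cons.prems adjoin_trivial[OF M(1), of b] by auto
    obtain x y where xy: "x \<in> ?M" "y \<in> ?M" "\<beta> = x + y * b"
      using Cons.prems unfolding adjoin_list.simps adjoin_def by blast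
    have "2 * x * y * b = \<beta> ^ 2 - x ^ 2 - y ^ 2 * b ^ 2"
      by (simp add: xy power2_eq_square algebra_simps)
    moreover have "\<beta> ^ 2 \<in> ?M" "b ^ 2 \<in> ?M" using Cons.prems b M by auto
    hence "\<beta> ^ 2 - x ^ 2 - y ^ 2 * b ^ 2 \<in> ?M"
      using M(1) xy by (intro is_subfield_diff is_subfield_mult is_subfield_power[of _ x] is_subfield_power[of _ y])
    ultimately have "b * (2 * x * y) \<in> ?M" by (simp add: mult_ac)
    hence "2 * x * y = 0"
      using is_subfield_cancel[OF M(1), of b "2 * x * y"] bM M xy
      by (metis is_subfield_mult is_subfield_numeral)
    hence "x = 0" using False xy by auto
    hence "\<beta> * b = y * b ^ 2" using xy by (simp add: power2_eq_square)
    moreover have "(\<beta> * b) ^ 2 \<in> K" using Cons.prems b K by (simp add: power_mult_distrib is_subfield_mult)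
    ultimately obtain S where S: "S \<subseteq> set bs" "\<beta> * b * \<Prod>S \<in> K"
      using IH[of "\<beta> * b"] M xy b is_subfield_mult by (metis subsetD)
    have "b \<notin> S" "finite S" using S Cons.prems finite_subset[OF S(1)] by auto
    hence "\<beta> * \<Prod>(insert b S) = \<beta> * b * \<Prod>S" by (simp add: mult_ac)
    hence "\<beta> * \<Prod>(insert b S) \<in> K" using S by metis
    thus ?thesis using S(1) by (intro exI[of _ "insert b S"]) auto
  qed
qed (auto intro: exI[of _ "{}"])

text \<open>
  The image of a root \<open>b\<close> may be chosen freely unless \<open>b\<close> already lies in the field generated so
  far. In that case \<open>b\<close> is, by Kummer theory, an element of \<open>K\<close> divided by a product of earlier roots, and the
  compatibility with products over subsets makes the prescribed image the right one.
\<close>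

lemma field_hom_adjoin_list_extension:
  fixes \<sigma> :: "'a::field_char_0 \<Rightarrow> 'a"
  assumes K: "is_subfield K" and \<sigma>: "field_hom K \<sigma>"
    and "\<And>b. b \<in> set bs \<Longrightarrow> b ^ 2 \<in> K" "\<And>b. b \<in> set bs \<Longrightarrow> b \<noteq> 0" "distinct bs"
    and "\<And>b. b \<in> set bs \<Longrightarrow> g b ^ 2 = \<sigma> (b ^ 2)"
    and "\<And>S. S \<subseteq> set bs \<Longrightarrow> \<Prod>S \<in> K \<Longrightarrow> \<sigma> (\<Prod>S) = prod g S"
  shows "\<exists>\<sigma>'. field_hom (adjoin_list K bs) \<sigma>' \<and> (\<forall>x\<in>K. \<sigma>' x = \<sigma> x) \<and> (\<forall>b\<in>set bs. \<sigma>' b = g b)"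
  using assms(3-)
proof (induction bs)
  case Nil thus ?case using \<sigma> by auto
next
  case (Cons b bs)
  let ?M = "adjoin_list K bs"
  have M: "is_subfield ?M" "K \<subseteq> ?M" "set bs \<subseteq> ?M"
    using adjoin_list_subfield[OF K, of bs] Cons.prems by auto
  obtain \<tau> where \<tau>: "field_hom ?M \<tau>" "\<forall>x\<in>K. \<tau> x = \<sigma> x" "\<forall>b\<in>set bs. \<tau> b = g b"
    using Cons.IH Cons.prems by (auto simp: subset_insertI2)
  show ?case
  proof (cases "b \<in> ?M")
    case False
    have "b ^ 2 \<in> ?M" "g b ^ 2 = \<tau> (b ^ 2)" using Cons.prems M \<tau> by auto
    then obtain \<sigma>' where "field_hom (adjoin ?M b) \<sigma>'" "\<And>x. x \<in> ?M \<Longrightarrow> \<sigma>' x = \<tau> x" "\<sigma>' b = g b"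
      using field_hom_adjoin_extension[OF M(1) \<tau>(1) _ False, of "g b"] by blast
    thus ?thesis using M \<tau> by (intro exI[of _ \<sigma>']) auto
  next
    case True
    obtain S where S: "S \<subseteq> set bs" "b * \<Prod>S \<in> K"
      using kummer_square_roots[OF K _ _ True] Cons.prems by auto
    have bS: "b \<notin> S" "finite S"
      using S Cons.prems finite_subset[OF S(1)] by auto
    have SM: "\<Prod>S \<in> ?M" using is_subfield_prod[OF M(1), of S "\<lambda>x. x"] S M by auto
    have g0: "g x \<noteq> 0" if "x \<in> set bs" for x
      using that Cons.prems M \<tau> field_hom_eq_0_iff[OF M(1) \<tau>(1), of x] by auto
    have "g b * prod g S = prod g (insert b S)" using bS by simp
    also have "\<dots> = \<sigma> (\<Prod>(insert b S))" using Cons.prems(5)[of "insert b S"] S bS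
      by (simp add: subset_insertI2)
    also have "\<dots> = \<tau> (b * \<Prod>S)" using \<tau> S bS by simp
    also have "\<dots> = \<tau> b * \<tau> (\<Prod>S)" using field_hom_mult[OF \<tau>(1) True SM] .
    also have "\<tau> (\<Prod>S) = (\<Prod>x\<in>S. \<tau> x)" using field_hom_prod[OF M(1) \<tau>(1), of S "\<lambda>x. x"] S M by auto
    also have "\<dots> = prod g S" using \<tau> S by (intro prod.cong) auto
    finally have "g b * prod g S = \<tau> b * prod g S" .
    moreover have "prod g S \<noteq> 0" using g0 S bS by (auto simp: prod_zero_iff)
    ultimately have "\<tau> b = g b" by simp
    thus ?thesis using \<tau> adjoin_trivial[OF M(1) True] by (intro exI[of _ \<tau>]) auto
  qed
qed

lemma field_hom_adjoin_list_extends: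
  fixes \<sigma> :: "'a::field \<Rightarrow> 'a"
  assumes K: "is_subfield K" and \<sigma>: "field_hom K \<sigma>"
    and "\<And>b. b \<in> set bs \<Longrightarrow> b ^ 2 \<in> K" and sqrt: "\<And>z::'a. \<exists>w. w ^ 2 = z"
  shows "\<exists>\<sigma>'. field_hom (adjoin_list K bs) \<sigma>' \<and> (\<forall>x\<in>K. \<sigma>' x = \<sigma> x)"
  using assms(3)
proof (induction bs)
  case Nil thus ?case using \<sigma> by auto
next
  case (Cons b bs)
  let ?M = "adjoin_list K bs"
  have M: "is_subfield ?M" "K \<subseteq> ?M" using adjoin_list_subfield[OF K, of bs] Cons.prems by auto
  obtain \<tau> where \<tau>: "field_hom ?M \<tau>" "\<forall>x\<in>K. \<tau> x = \<sigma> x" using Cons by auto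
  show ?case
  proof (cases "b \<in> ?M")
    case False
    have b: "b ^ 2 \<in> ?M" using Cons.prems M by auto
    obtain w where "w ^ 2 = \<tau> (b ^ 2)" using sqrt by blast
    then obtain \<sigma>' where "field_hom (adjoin ?M b) \<sigma>'" "\<And>x. x \<in> ?M \<Longrightarrow> \<sigma>' x = \<tau> x"
      using field_hom_adjoin_extension[OF M(1) \<tau>(1) b False, of w] by blast
    thus ?thesis using M \<tau> by (intro exI[of _ \<sigma>']) auto
  next
    case True thus ?thesis using \<tau> adjoin_trivial[OF M(1) True] by (intro exI[of _ \<tau>]) auto
  qed
qed

text \<open>
  The conjugation \<open>b \<mapsto> - b\<close> over the previous field removes the part \<open>v b\<close> of a fixed element
  \<open>u + v b\<close>; so one adjoined root after the other can be dropped.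
\<close>

lemma adjoin_list_fixed_field:
  fixes x :: "'a::field_char_0"
  assumes K: "is_subfield K" and "\<And>b. b \<in> set bs \<Longrightarrow> b ^ 2 \<in> K"
    and "x \<in> adjoin_list K bs"
    and "\<And>\<sigma>. field_hom (adjoin_list K bs) \<sigma> \<Longrightarrow> (\<And>y. y \<in> K \<Longrightarrow> \<sigma> y = y) \<Longrightarrow> \<sigma> x = x"
  shows "x \<in> K"
  using assms(2-)
proof (induction bs)
  case (Cons b bs)
  let ?M = "adjoin_list K bs"
  have M: "is_subfield ?M" "K \<subseteq> ?M" using adjoin_list_subfield[OF K, of bs] Cons.prems by auto
  have b: "b ^ 2 \<in> ?M" "b ^ 2 \<in> K" using Cons.prems M by auto
  show ?case
  proof (cases "b \<in> ?M")
    case True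
    thus ?thesis using Cons adjoin_trivial[OF M(1) True] by auto
  next
    case False
    obtain u v where uv: "u \<in> ?M" "v \<in> ?M" "x = u + v * b"
      using Cons.prems(2) unfolding adjoin_list.simps adjoin_def by blast
    have L: "is_subfield (adjoin ?M b)" using is_subfield_adjoin[OF M(1) b(1)] .
    have uvL: "u \<in> adjoin ?M b" "v \<in> adjoin ?M b" "b \<in> adjoin ?M b"
      using uv adjoin_superset[OF M(1)] adjoin_generator[OF M(1)] by auto
    have "(- b) ^ 2 = b ^ 2" by simp
    then obtain \<sigma> where \<sigma>: "field_hom (adjoin ?M b) \<sigma>" "\<And>y. y \<in> ?M \<Longrightarrow> \<sigma> y = y" "\<sigma> b = - b"
      using field_hom_adjoin_extension[OF M(1) field_hom_id b(1) False, of "- b"] by metis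
    have "\<sigma> x = x" using Cons.prems(3)[of \<sigma>] \<sigma> M by auto
    moreover have "\<sigma> x = u - v * b"
      using uv uvL \<sigma> L by (simp add: field_hom_add[OF \<sigma>(1)] field_hom_mult[OF \<sigma>(1)] is_subfield_mult)
    ultimately have "2 * (v * b) = 0" using uv by (simp add: algebra_simps)
    hence "v * b = 0" by simp
    hence xM: "x \<in> ?M" using uv by (metis add.right_neutral)
    show ?thesis
    proof (rule Cons.IH[OF _ xM])
      fix \<tau> assume \<tau>: "field_hom ?M \<tau>" "\<And>y. y \<in> K \<Longrightarrow> \<tau> y = y"
      obtain \<sigma> where \<sigma>: "field_hom (adjoin ?M b) \<sigma>" "\<And>y. y \<in> ?M \<Longrightarrow> \<sigma> y = \<tau> y"
        using field_hom_adjoin_extension[OF M(1) \<tau>(1) b(1) False, of b] \<tau>(2)[OF b(2)] by metis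
      have "\<sigma> y = y" if "y \<in> K" for y using that \<sigma>(2)[of y] \<tau>(2)[of y] M(2) by auto
      hence "\<sigma> x = x" using Cons.prems(3)[of \<sigma>] \<sigma>(1) by auto
      thus "\<tau> x = x" using \<sigma> xM by auto
    qed (use Cons.prems in auto)
  qed
qed auto

section \<open>The preimage tree\<close>

lemma poly_map_to_ac_add:
  "poly (map_poly to_ac (p + q)) (x :: 'a::field alg_closure) = poly (map_poly to_ac p) x + poly (map_poly to_ac q) x"
proof -
  have "map_poly to_ac (p + q) = map_poly to_ac p + map_poly (to_ac :: 'a \<Rightarrow> _) q"
    by (rule poly_eqI) (simp add: coeff_map_poly)
  thus ?thesis by simp
qed

lemma poly_map_to_ac_mult:
  "poly (map_poly to_ac (p * q)) (x :: 'a::field alg_closure) = poly (map_poly to_ac p) x * poly (map_poly to_ac q) x"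
proof (induction p)
  case (pCons a p)
  have "map_poly to_ac (smult a q) = smult (to_ac a) (map_poly to_ac q)"
    by (rule poly_eqI) (simp add: coeff_map_poly)
  thus ?case using pCons by (simp add: poly_map_to_ac_add map_poly_pCons algebra_simps)
qed simp

lemma alg_closed_square_root: "\<exists>w. w ^ 2 = (z :: 'a::alg_closed_field)"
proof -
  have "degree [:- z, 0, 1:] > 0" by simp
  from alg_closed_imp_poly_has_root[OF this] obtain w where "poly [:- z, 0, 1:] w = 0" by blast
  hence "w ^ 2 = z" by (simp add: power2_eq_square)
  thus ?thesis by blast
qed

lemma rat_square_eq_int:
  fixes r :: rat
  assumes "r ^ 2 = of_int N"
  shows "\<exists>k::int. N = k ^ 2"
proof -
  obtain a b where ab: "r = of_int a / of_int b" "b > 0" "coprime a b"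
    by (metis quotient_of_coprime quotient_of_denom_pos quotient_of_div surj_pair)
  have "of_int (a ^ 2) = (of_int (N * b ^ 2) :: rat)"
    using assms ab by (simp add: power_divide field_simps)
  hence eq: "a ^ 2 = N * b ^ 2" by (simp only: of_int_eq_iff)
  hence "b ^ 2 dvd a ^ 2" by simp
  hence "is_unit (b ^ 2)" using ab(3) by (metis coprime_power_left_iff coprime_power_right_iff coprime_absorb_right coprime_commute zero_less_numeral)
  hence "b = 1" using ab(2) by (simp add: is_unit_power_iff power2_eq_1_iff)
  thus ?thesis using eq by auto
qed

locale quadratic =
  fixes c :: int
  assumes minus_c_nonsquare: "\<not> (\<exists>k::int. - c = k ^ 2)"
begin

definition f :: "rat poly" where "f = [:of_int c, 0, 1:]"

definition F :: "rat alg_closure \<Rightarrow> rat alg_closure" where "F z = z ^ 2 + of_int c"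

definition level :: "nat \<Rightarrow> rat alg_closure set" where "level n = {z. (F ^^ n) z = 0}"

definition crit :: "nat \<Rightarrow> int" where "crit n = ((\<lambda>x. x ^ 2 + c) ^^ n) 0"

text \<open>
  One of the two preimages of \<open>\<rho>\<close>, the other being its negative. The values of \<open>half\<close> on a level
  are thus one half of the next level.
\<close>

definition half :: "rat alg_closure \<Rightarrow> rat alg_closure" where "half \<rho> = (SOME w. F w = \<rho>)"

definition K :: "nat \<Rightarrow> rat alg_closure set" where "K n = splitting_field (poly_iterate f n)"

lemma poly_f: "poly (map_poly to_ac f) z = F z"
  by (simp add: f_def F_def map_poly_pCons power2_eq_square algebra_simps)

lemma poly_iterate_eval: "poly (map_poly to_ac (poly_iterate f n)) z = (F ^^ n) z"
proof (induction n)
  case 0 thus ?case by (simp add: poly_iterate_def map_poly_pCons)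
next
  case (Suc n)
  let ?p = "poly_iterate f n"
  have "poly_iterate f (Suc n) = [:of_int c:] + ?p * ?p"
    by (simp add: poly_iterate_def f_def pcompose_pCons)
  hence "poly (map_poly to_ac (poly_iterate f (Suc n))) z = F (poly (map_poly to_ac ?p) z)"
    by (simp add: poly_map_to_ac_add poly_map_to_ac_mult map_poly_pCons F_def power2_eq_square)
  thus ?case using Suc by simp
qed

lemma root_set_iterate: "root_set (poly_iterate f n) = level n"
  by (simp add: root_set_def level_def poly_iterate_eval)

lemma F_uminus [simp]: "F (- z) = F z"
  by (simp add: F_def)

lemma F_eq_iff: "F z = F w \<longleftrightarrow> z = w \<or> z = - w"
  by (simp add: F_def power2_eq_iff)

lemma F_half [simp]: "F (half \<rho>) = \<rho>"
proof -
  obtain w where "w ^ 2 = \<rho> - of_int c" using alg_closed_square_root by blast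
  hence "F w = \<rho>" by (simp add: F_def)
  thus ?thesis unfolding half_def by (rule someI)
qed

lemma half_square: "half \<rho> ^ 2 = \<rho> - of_int c"
  using F_half[of \<rho>] unfolding F_def by (simp add: algebra_simps)

lemma F_eq_iff_half: "F z = \<rho> \<longleftrightarrow> z = half \<rho> \<or> z = - half \<rho>"
  using F_eq_iff[of z "half \<rho>"] by simp

lemma inj_half: "inj_on half S"
  by (rule inj_on_inverseI[of _ F]) simp

lemma level_0 [simp]: "level 0 = {0}"
  by (auto simp: level_def)

lemma mem_level_Suc: "z \<in> level (Suc n) \<longleftrightarrow> F z \<in> level n"
  by (simp add: level_def funpow_swap1)

lemma half_in_level: "\<rho> \<in> level n \<Longrightarrow> half \<rho> \<in> level (Suc n)"
  by (simp add: mem_level_Suc)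

lemma level_Suc: "level (Suc n) = half ` level n \<union> (\<lambda>\<rho>. - half \<rho>) ` level n"
proof (intro equalityI subsetI)
  fix z assume "z \<in> level (Suc n)"
  hence "F z \<in> level n" "z = half (F z) \<or> z = - half (F z)"
    using F_eq_iff_half[of z "F z"] by (auto simp: mem_level_Suc)
  thus "z \<in> half ` level n \<union> (\<lambda>\<rho>. - half \<rho>) ` level n" by blast
qed (auto simp: mem_level_Suc)

lemma F_image_level: "F ` level (Suc n) = level n"
proof
  show "level n \<subseteq> F ` level (Suc n)"
    using half_in_level F_half by (metis imageI subsetI)
qed (auto simp: mem_level_Suc)

lemma finite_level [simp]: "finite (level n)"
  by (induction n) (simp_all add: level_Suc)

lemma crit_0 [simp]: "crit 0 = 0" by (simp add: crit_def)

lemma crit_Suc: "crit (Suc n) = crit n ^ 2 + c" by (simp add: crit_def)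

lemma of_int_crit: "of_int (crit n) = (F ^^ n) 0"
  by (induction n) (simp_all add: crit_Suc F_def)

lemma c_nz: "c \<noteq> 0" and c_neq_m1: "c \<noteq> -1"
  using minus_c_nonsquare by (auto, metis power2_eq_square mult_1 minus_minus)

lemma crit_growth: "n \<ge> 1 \<Longrightarrow> \<bar>crit n\<bar> \<ge> \<bar>c\<bar>"
proof (induction n rule: nat_induct_at_least)
  case base thus ?case using crit_Suc[of 0] by simp
next
  case (Suc n)
  have "\<bar>crit n\<bar> * \<bar>crit n\<bar> \<ge> \<bar>c\<bar> * \<bar>c\<bar>" using Suc by (intro mult_mono) auto
  hence 1: "crit n ^ 2 \<ge> \<bar>c\<bar> * \<bar>c\<bar>" by (simp add: power2_eq_square flip: abs_mult)
  show ?case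
  proof (cases "c > 0")
    case True
    moreover have "0 \<le> crit n ^ 2" by simp
    ultimately show ?thesis unfolding crit_Suc by linarith
  next
    case False
    hence "\<bar>c\<bar> \<ge> 2" using c_nz c_neq_m1 by linarith
    hence "\<bar>c\<bar> * \<bar>c\<bar> \<ge> 2 * \<bar>c\<bar>" by (intro mult_right_mono) auto
    thus ?thesis using 1 by (simp add: crit_Suc)
  qed
qed

text \<open>
  The number \<open>e\<^sup>2 + c\<close> with \<open>e \<ge> |c|\<close> lies strictly between two consecutive squares.
\<close>

lemma crit_nonsquare:
  assumes "n \<ge> 2" shows "\<not> (\<exists>k::int. crit n = k ^ 2)"
proof
  assume "\<exists>k. crit n = k ^ 2"
  then obtain k' where k': "crit n = k' ^ 2" by auto
  define k where "k = \<bar>k'\<bar>"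
  obtain m where m: "n = Suc m" "m \<ge> 1" using assms by (cases n) auto
  define e where "e = \<bar>crit m\<bar>"
  have e: "e \<ge> \<bar>c\<bar>" using crit_growth[OF m(2)] by (simp add: e_def)
  have eq: "k * k = e * e + c" and k: "k \<ge> 0"
    using k' m by (simp_all add: k_def e_def crit_Suc power2_eq_square flip: abs_mult)
  have e1: "e \<ge> 1" using e c_nz by linarith
  show False
  proof (cases "c > 0")
    case True
    have "k > e"
    proof (rule ccontr)
      assume "\<not> k > e"
      hence "k * k \<le> e * e" using k by (intro mult_mono) auto
      thus False using eq True by simp
    qed
    hence "k * k \<ge> (e + 1) * (e + 1)" using e1 by (intro mult_mono) auto
    hence "c \<ge> 2 * e + 1" using eq by (simp add: algebra_simps)
    thus False using e e1 by linarith
  next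
    case False
    have "k < e"
    proof (rule ccontr)
      assume "\<not> k < e"
      hence "k * k \<ge> e * e" using e1 by (intro mult_mono) auto
      thus False using eq False c_nz by simp
    qed
    hence "k * k \<le> (e - 1) * (e - 1)" using k by (intro mult_mono) auto
    hence "c \<le> 1 - 2 * e" using eq by (simp add: algebra_simps)
    hence "e = 1 \<and> c = -1" using e e1 by linarith
    thus False using c_neq_m1 by simp
  qed
qed

lemma crit_nz: "n \<ge> 1 \<Longrightarrow> crit n \<noteq> 0"
  using crit_growth[of n] c_nz by auto

text \<open>
  A common element of two levels would make 0 periodic under \<open>F\<close>, but \<open>crit n\<close> is never 0.
\<close>

lemma level_disjoint:
  assumes "z \<in> level m" "z \<in> level n" shows "m = n"
proof -
  have aux: "\<not> (z \<in> level m \<and> z \<in> level n)" if "m < n" for m n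
  proof
    assume z: "z \<in> level m \<and> z \<in> level n"
    have "(F ^^ n) z = (F ^^ (n - m)) ((F ^^ m) z)"
      using that by (metis add_diff_inverse_nat add.commute comp_apply funpow_add not_less_iff_gr_or_eq)
    hence "of_int (crit (n - m)) = (0 :: rat alg_closure)" using z unfolding level_def of_int_crit by simp metis
    thus False using crit_nz[of "n - m"] that by simp
  qed
  show ?thesis using aux[of m n] aux[of n m] assms by (cases m n rule: linorder_cases) auto
qed

lemma half_nz: "\<rho> \<in> level n \<Longrightarrow> half \<rho> \<noteq> 0"
proof
  assume "\<rho> \<in> level n" "half \<rho> = 0"
  hence "0 \<in> level (Suc n)" using half_in_level by metis
  thus False using level_disjoint[of 0 0 "Suc n"] by simp
qed

lemma level_Suc_nz: "z \<in> level (Suc n) \<Longrightarrow> z \<noteq> 0"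
  using level_disjoint[of 0 0 "Suc n"] by auto

lemma uminus_level: "z \<in> level (Suc n) \<Longrightarrow> - z \<in> level (Suc n)"
  by (simp add: mem_level_Suc)

lemma half_neq_minus_half:
  assumes "\<rho> \<in> level n" shows "half \<rho> \<noteq> - half \<sigma>"
proof
  assume "half \<rho> = - half \<sigma>"
  hence "\<rho> = \<sigma>" by (metis F_half F_uminus)
  thus False using \<open>half \<rho> = - half \<sigma>\<close> half_nz[OF assms] by simp
qed

text \<open>
  The factors of \<open>w\<close> and \<open>- w\<close> combine to \<open>(z - w)(z + w) = F z - F w\<close>, which reduces the claim to the
  level below.
\<close>

lemma prod_level: "(\<Prod>\<rho>\<in>level n. z - \<rho>) = (F ^^ n) z"
proof (induction n arbitrary: z)
  case (Suc n)
  have disj: "half ` level n \<inter> (\<lambda>\<rho>. - half \<rho>) ` level n = {}"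
    using half_neq_minus_half by blast
  have inj': "inj_on (\<lambda>\<rho>. - half \<rho>) (level n)"
    using inj_half by (auto simp: inj_on_def)
  have "(\<Prod>\<rho>\<in>level (Suc n). z - \<rho>) = (\<Prod>\<rho>\<in>level n. (z - half \<rho>) * (z + half \<rho>))"
    unfolding level_Suc
    by (simp add: prod.union_disjoint disj prod.reindex inj_half inj' prod.distrib)
  also have "\<dots> = (\<Prod>\<rho>\<in>level n. F z - \<rho>)"
  proof (rule prod.cong)
    fix \<rho>
    have "(z - half \<rho>) * (z + half \<rho>) = z ^ 2 - half \<rho> ^ 2" by (simp add: power2_eq_square algebra_simps)
    thus "(z - half \<rho>) * (z + half \<rho>) = F z - \<rho>" by (simp add: half_square F_def)
  qed simp
  finally show ?case using Suc by (simp add: funpow_swap1)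
qed simp

text \<open>
  The product of all \<open>\<rho> - c\<close> over level \<open>n\<close>, and the only candidate for a new square at step \<open>n\<close>.
  The sign at \<open>n = 0\<close> differs because level 0 is the only one of odd size.
\<close>

definition disc :: "nat \<Rightarrow> int" where "disc n = (if n = 0 then - c else crit (Suc n))"

lemma prod_level_disc: "(\<Prod>\<rho>\<in>level n. \<rho> - of_int c) = of_int (disc n)"
proof (cases n)
  case (Suc m)
  have "(\<Prod>\<rho>\<in>level n. \<rho> - of_int c) = (\<Prod>\<rho>\<in>level n. - of_int c - \<rho>)"
    by (rule prod.reindex_bij_witness[of _ uminus uminus]) (auto simp: Suc uminus_level)
  also have "\<dots> = (F ^^ n) (F 0)"
    unfolding prod_level Suc by (simp add: funpow_Suc_right F_def del: funpow.simps)
  finally show ?thesis using of_int_crit[of "Suc n"] by (simp add: disc_def Suc funpow_swap1)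
qed (simp add: disc_def)

lemma disc_nonsquare: "\<not> (\<exists>k::int. disc n = k ^ 2)"
  using minus_c_nonsquare crit_nonsquare[of "Suc n"] by (auto simp: disc_def)

lemma prod_half_square: "(\<Prod>\<rho>\<in>S. half \<rho>) ^ 2 = (\<Prod>\<rho>\<in>S. \<rho> - of_int c)"
  by (simp add: prod_power_distrib half_square)

end

section \<open>The tower of splitting fields\<close>

lemma subfield_imp_is_subfield:
  assumes "subfield K (ring_of_type_algebra :: 'a::field ring)" shows "is_subfield K"
proof -
  interpret R: field "ring_of_type_algebra :: 'a ring" by (rule field_from_type_algebra)
  have z: "\<zero>\<^bsub>ring_of_type_algebra\<^esub> = (0::'a)" "\<one>\<^bsub>ring_of_type_algebra\<^esub> = (1::'a)"
    "x \<oplus>\<^bsub>ring_of_type_algebra\<^esub> y = x + y" "x \<otimes>\<^bsub>ring_of_type_algebra\<^esub> y = x * y" for x y :: 'a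
    by (simp_all add: ring_of_type_algebra_def)
  note sr = subringE[OF subfieldE(1)[OF assms]]
  have um: "\<ominus>\<^bsub>ring_of_type_algebra\<^esub> x = - x" for x :: 'a
    by (rule R.minus_equality) (simp_all add: ring_of_type_algebra_def)
  have inv: "inv\<^bsub>ring_of_type_algebra\<^esub> x = inverse x" if "x \<noteq> 0" for x :: 'a
    by (rule R.comm_inv_char) (use that in \<open>simp_all add: ring_of_type_algebra_def\<close>)
  show ?thesis unfolding is_subfield_def
  proof (intro conjI ballI)
    show "1 \<in> K" using sr(3) z by simp
    fix x y assume xy: "x \<in> K" "y \<in> K"
    have "x + (- y) \<in> K" using sr(5)[OF xy(2)] sr(7)[OF xy(1)] um z by metis
    thus "x - y \<in> K" by simp
    show "x * y \<in> K" using sr(6)[OF xy] z by simp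
  next
    fix x assume x: "x \<in> K"
    show "inverse x \<in> K"
    proof (cases "x = 0")
      case False
      thus ?thesis using R.subfield_m_inv(1)[OF assms, of x] x inv z by auto
    qed (use x in auto)
  qed
qed

lemma is_subfield_imp_subfield:
  assumes "is_subfield K" shows "subfield K (ring_of_type_algebra :: 'a::field ring)"
proof -
  interpret R: field "ring_of_type_algebra :: 'a ring" by (rule field_from_type_algebra)
  have um: "\<ominus>\<^bsub>ring_of_type_algebra\<^esub> x = - x" for x :: 'a
    by (rule R.minus_equality) (simp_all add: ring_of_type_algebra_def)
  have inv: "inv\<^bsub>ring_of_type_algebra\<^esub> x = inverse x" if "x \<noteq> 0" for x :: 'a
    by (rule R.comm_inv_char) (use that in \<open>simp_all add: ring_of_type_algebra_def\<close>)
  show ?thesis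
  proof (rule R.subfieldI')
    show "subring K (ring_of_type_algebra :: 'a ring)"
      by (rule R.subringI)
        (use assms in \<open>auto simp: um is_subfield_intros\<close>, simp_all add: ring_of_type_algebra_def is_subfield_intros)
    fix k assume "k \<in> K - {\<zero>\<^bsub>ring_of_type_algebra\<^esub>}"
    thus "inv\<^bsub>ring_of_type_algebra\<^esub> k \<in> K"
      using assms inv[of k] by (auto simp: is_subfield_intros ring_of_type_algebra_def)
  qed
qed

lemma is_subfield_range_to_ac: "is_subfield (range (to_ac :: rat \<Rightarrow> _))"
  unfolding is_subfield_def
proof (intro conjI ballI)
  show "1 \<in> range (to_ac :: rat \<Rightarrow> _)" using to_ac_1 by (metis rangeI)
  fix x y assume "x \<in> range (to_ac :: rat \<Rightarrow> _)" "y \<in> range (to_ac :: rat \<Rightarrow> _)"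
  then obtain r s :: rat where "x = to_ac r" "y = to_ac s" by blast
  thus "x - y \<in> range to_ac" "x * y \<in> range to_ac"
    by (simp_all only: to_ac_diff[symmetric] to_ac_mult[symmetric] rangeI)
next
  fix x assume "x \<in> range (to_ac :: rat \<Rightarrow> _)"
  then obtain r :: rat where "x = to_ac r" by blast
  thus "inverse x \<in> range to_ac" by (simp only: to_ac_inverse[symmetric] rangeI)
qed

context quadratic
begin

lemma is_subfield_K: "is_subfield (K n)"
  and level_subset_K: "level n \<subseteq> K n"
  and to_ac_in_K: "to_ac r \<in> K n"
  and K_least: "is_subfield M \<Longrightarrow> range to_ac \<subseteq> M \<Longrightarrow> level n \<subseteq> M \<Longrightarrow> K n \<subseteq> M"
proof -
  interpret R: field "ring_of_type_algebra :: rat alg_closure ring" by (rule field_from_type_algebra)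
  have carr: "range to_ac \<union> level n \<subseteq> carrier (ring_of_type_algebra :: rat alg_closure ring)"
    by (simp add: ring_of_type_algebra_def)
  have K: "K n = generate_field ring_of_type_algebra (range to_ac \<union> level n)"
    by (simp add: K_def splitting_field_def root_set_iterate)
  note E = R.generate_fieldE[OF carr K]
  show "is_subfield (K n)" using E(1) by (rule subfield_imp_is_subfield)
  show "level n \<subseteq> K n" "to_ac r \<in> K n" using E(2) by auto
  show "K n \<subseteq> M" if "is_subfield M" "range to_ac \<subseteq> M" "level n \<subseteq> M"
    using E(3)[OF is_subfield_imp_subfield[OF that(1)]] that(2,3) by blast
qed

lemma K_0: "K 0 = range to_ac"
proof
  show "K 0 \<subseteq> range to_ac"
    using is_subfield_zero[OF is_subfield_range_to_ac]
    by (intro K_least is_subfield_range_to_ac) simp_all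
  show "range to_ac \<subseteq> K 0" using to_ac_in_K by blast
qed

lemma F_in_K: "z \<in> K n \<Longrightarrow> F z \<in> K n"
  unfolding F_def by (intro is_subfield_add[OF is_subfield_K] is_subfield_power[OF is_subfield_K]
    is_subfield_of_int[OF is_subfield_K])

lemma level_subset_K_Suc: "level n \<subseteq> K (Suc n)"
proof
  fix z assume "z \<in> level n"
  then obtain w where "w \<in> level (Suc n)" "z = F w" using F_image_level[of n] by blast
  thus "z \<in> K (Suc n)" using F_in_K level_subset_K by (metis subsetD)
qed

lemma K_Suc_superset: "K n \<subseteq> K (Suc n)"
  by (intro K_least is_subfield_K level_subset_K_Suc) (auto intro: to_ac_in_K)

lemma K_mono: "m \<le> n \<Longrightarrow> K m \<subseteq> K n"
  by (rule lift_Suc_mono_le[of K, OF K_Suc_superset])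

lemma lower_level_subset_K: "m \<le> n \<Longrightarrow> level m \<subseteq> K n"
  using level_subset_K K_mono by blast

lemma half_square_in_K: "\<rho> \<in> level n \<Longrightarrow> half \<rho> ^ 2 \<in> K n"
  unfolding half_square using level_subset_K
  by (intro is_subfield_diff[OF is_subfield_K] is_subfield_of_int[OF is_subfield_K]) auto

lemma K_Suc: 
  assumes "set bs = half ` level n"
  shows "K (Suc n) = adjoin_list (K n) bs"
proof
  have sq: "b ^ 2 \<in> K n" if "b \<in> set bs" for b using that assms half_square_in_K by auto
  have A: "is_subfield (adjoin_list (K n) bs)" "K n \<subseteq> adjoin_list (K n) bs" "set bs \<subseteq> adjoin_list (K n) bs"
    using adjoin_list_subfield[OF is_subfield_K, of bs n] sq by blast+
  show "K (Suc n) \<subseteq> adjoin_list (K n) bs"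
  proof (rule K_least[OF A(1)])
    show "level (Suc n) \<subseteq> adjoin_list (K n) bs"
      using A(3) assms is_subfield_uminus[OF A(1)] unfolding level_Suc by auto
  qed (use A(2) to_ac_in_K in auto)
  show "adjoin_list (K n) bs \<subseteq> K (Suc n)"
  proof (rule adjoin_list_least[OF is_subfield_K K_Suc_superset])
    show "set bs \<subseteq> K (Suc n)" unfolding assms using half_in_level level_subset_K by (meson image_subsetI subsetD)
  qed
qed

lemma half_list_exists: "\<exists>bs. set bs = half ` level n \<and> distinct bs"
  by (rule finite_distinct_list) simp

lemma prime_field_fixed: "field_hom (K n) \<sigma> \<Longrightarrow> \<sigma> (to_ac r) = to_ac r"
proof -
  assume \<sigma>: "field_hom (K n) \<sigma>"
  obtain a b where "r = of_int a / of_int b" by (metis quotient_of_div surj_pair)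
  hence "to_ac r = of_int a / of_int b" by simp
  thus ?thesis by (rule field_hom_id_prime[OF is_subfield_K \<sigma>])
qed

lemma hom_F:
  assumes "field_hom (K n) \<sigma>" "z \<in> K n" shows "\<sigma> (F z) = F (\<sigma> z)"
proof -
  have "\<sigma> (F z) = \<sigma> (z ^ 2) + \<sigma> (of_int c)"
    unfolding F_def
    by (intro field_hom_add[OF assms(1)] is_subfield_power[OF is_subfield_K] assms(2)
      is_subfield_of_int[OF is_subfield_K])
  thus ?thesis
    using field_hom_power2[OF is_subfield_K assms] field_hom_of_int[OF is_subfield_K assms(1)]
    by (simp add: F_def)
qed

lemma hom_F_iterate:
  assumes "field_hom (K n) \<sigma>" "z \<in> K n"
  shows "\<sigma> ((F ^^ m) z) = (F ^^ m) (\<sigma> z) \<and> (F ^^ m) z \<in> K n"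
  by (induction m) (use assms in \<open>auto simp: hom_F F_in_K\<close>)

lemma hom_level:
  assumes \<sigma>: "field_hom (K n) \<sigma>" and "m \<le> n"
  shows "\<sigma> ` level m = level m"
proof (rule endo_inj_surj)
  show "\<sigma> ` level m \<subseteq> level m"
  proof
    fix w assume "w \<in> \<sigma> ` level m"
    then obtain z where z: "z \<in> level m" "w = \<sigma> z" by auto
    hence "z \<in> K n" using lower_level_subset_K[OF assms(2)] by auto
    thus "w \<in> level m"
      using hom_F_iterate[OF \<sigma>, of z m] z field_hom_zero[OF is_subfield_K \<sigma>] by (simp add: level_def)
  qed
  show "inj_on \<sigma> (level m)"
    using field_hom_inj_on[OF is_subfield_K \<sigma>] lower_level_subset_K[OF assms(2)] inj_on_subset by blast
qed simp

lemma hom_K: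
  assumes \<sigma>: "field_hom (K n) \<sigma>"
  shows "\<sigma> ` K n = K n"
proof
  show "K n \<subseteq> \<sigma> ` K n"
  proof (rule K_least)
    show "is_subfield (\<sigma> ` K n)" by (rule is_subfield_field_hom_image[OF is_subfield_K \<sigma>])
    show "range to_ac \<subseteq> \<sigma> ` K n" using prime_field_fixed[OF \<sigma>] to_ac_in_K by (metis image_eqI image_subsetI)
    show "level n \<subseteq> \<sigma> ` K n" using hom_level[OF \<sigma> le_refl] level_subset_K by blast
  qed
  let ?M = "{x \<in> K n. \<sigma> x \<in> K n}"
  have "is_subfield ?M"
    unfolding is_subfield_def using is_subfield_K[of n] \<sigma>
    by (auto simp: is_subfield_one field_hom_one field_hom_diff is_subfield_diff field_hom_mult
        is_subfield_mult field_hom_inverse is_subfield_inverse)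
  moreover have "range to_ac \<subseteq> ?M" using prime_field_fixed[OF \<sigma>] to_ac_in_K by auto
  moreover have "level n \<subseteq> ?M" using hom_level[OF \<sigma> le_refl] level_subset_K by blast
  ultimately show "\<sigma> ` K n \<subseteq> K n" using K_least[of ?M n] by auto
qed

lemma hom_compose:
  "field_hom (K n) \<sigma> \<Longrightarrow> field_hom (K n) \<tau> \<Longrightarrow> field_hom (K n) (\<lambda>x. \<tau> (\<sigma> x))"
  using field_hom_compose[of "K n" \<sigma> "K n" \<tau>] hom_K[of n \<sigma>] by simp

lemma hom_eqI:
  assumes \<sigma>: "field_hom (K n) \<sigma>" and \<tau>: "field_hom (K n) \<tau>"
    and eq: "\<And>z. z \<in> level n \<Longrightarrow> \<sigma> z = \<tau> z" and x: "x \<in> K n"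
  shows "\<sigma> x = \<tau> x"
proof -
  let ?M = "{x \<in> K n. \<sigma> x = \<tau> x}"
  have "is_subfield ?M"
    unfolding is_subfield_def using is_subfield_K[of n] \<sigma> \<tau>
    by (auto simp: is_subfield_one field_hom_one field_hom_diff is_subfield_diff field_hom_mult
        is_subfield_mult field_hom_inverse is_subfield_inverse)
  moreover have "range to_ac \<subseteq> ?M" using prime_field_fixed[OF \<sigma>] prime_field_fixed[OF \<tau>] to_ac_in_K by auto
  moreover have "level n \<subseteq> ?M" using eq level_subset_K by blast
  ultimately show ?thesis using K_least[of ?M n] x by auto
qed

text \<open>
  Over an algebraically closed field square roots of all conjugates exist.
\<close>

lemma hom_extends_Suc:
  assumes \<sigma>: "field_hom (K n) \<sigma>"
  shows "\<exists>\<sigma>'. field_hom (K (Suc n)) \<sigma>' \<and> (\<forall>x\<in>K n. \<sigma>' x = \<sigma> x)"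
proof -
  obtain bs where bs: "set bs = half ` level n" using half_list_exists by blast
  show ?thesis unfolding K_Suc[OF bs]
    by (rule field_hom_adjoin_list_extends[OF is_subfield_K \<sigma> _ alg_closed_square_root])
      (use bs half_square_in_K in auto)
qed

lemma fixed_field_rational:
  assumes "x \<in> K n" "\<And>\<sigma>. field_hom (K n) \<sigma> \<Longrightarrow> \<sigma> x = x"
  shows "x \<in> range to_ac"
  using assms
proof (induction n)
  case 0 thus ?case using K_0 by simp
next
  case (Suc n)
  obtain bs where bs: "set bs = half ` level n" using half_list_exists by blast
  have "x \<in> K n"
  proof (rule adjoin_list_fixed_field[OF is_subfield_K, of bs])
    show "x \<in> adjoin_list (K n) bs" using Suc.prems K_Suc[OF bs] by simp
  qed (use bs half_square_in_K Suc.prems K_Suc[OF bs] in auto)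
  thus ?case
  proof (rule Suc.IH)
    fix \<sigma> assume "field_hom (K n) \<sigma>"
    then obtain \<sigma>' where "field_hom (K (Suc n)) \<sigma>'" "\<forall>x\<in>K n. \<sigma>' x = \<sigma> x" using hom_extends_Suc by blast
    thus "\<sigma> x = x" using Suc.prems(2)[of \<sigma>'] \<open>x \<in> K n\<close> by auto
  qed
qed

lemma rational_square_disc:
  assumes "P \<in> range to_ac" "P ^ 2 = (of_int (disc n) :: rat alg_closure)"
  shows False
proof -
  obtain r where r: "P = to_ac r" using assms by auto
  have "to_ac (r ^ 2) = to_ac (of_int (disc n))" using assms(2) r by simp
  hence "r ^ 2 = of_int (disc n)" by (simp only: to_ac_eq_iff)
  thus False using rat_square_eq_int disc_nonsquare by blast
qed

text \<open>
  The orbit of \<open>u\<close> maps onto the level below by induction. If it did not contain \<open>- u\<close>, it would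
  contain exactly one of the two preimages of each vertex. The product of the orbit would then be
  rational, being fixed by Galois, with square \<open>disc n\<close>; but \<open>disc n\<close> is not a square.
\<close>

lemma galois_transitive:
  assumes "u \<in> level n" "v \<in> level n"
  shows "\<exists>\<sigma>. field_hom (K n) \<sigma> \<and> \<sigma> u = v"
  using assms
proof (induction n arbitrary: u v)
  case 0 thus ?case using field_hom_id[of "K 0"] by auto
next
  case (Suc n)
  let ?H = "{\<sigma>. field_hom (K (Suc n)) \<sigma>}"
  have lift: "\<exists>\<sigma>\<in>?H. F (\<sigma> w) = \<rho>" if w: "w \<in> level (Suc n)" and \<rho>: "\<rho> \<in> level n" for w \<rho>
  proof -
    have "F w \<in> level n" using w by (simp add: mem_level_Suc)
    then obtain \<sigma> where "field_hom (K n) \<sigma>" "\<sigma> (F w) = \<rho>" using Suc.IH \<rho> by blast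
    then obtain \<sigma>' where \<sigma>': "field_hom (K (Suc n)) \<sigma>'" "\<forall>x\<in>K n. \<sigma>' x = \<sigma> x"
      using hom_extends_Suc by blast
    have "F (\<sigma>' w) = \<sigma>' (F w)" using hom_F[OF \<sigma>'(1)] w level_subset_K by (metis subsetD)
    moreover have "F w \<in> K n" using \<open>F w \<in> level n\<close> level_subset_K by blast
    ultimately have "F (\<sigma>' w) = \<rho>" using \<sigma>'(2) \<open>\<sigma> (F w) = \<rho>\<close> by simp
    thus ?thesis using \<sigma>'(1) by blast
  qed
  define O' where "O' = (\<lambda>\<sigma>. \<sigma> u) ` ?H"
  have O': "O' \<subseteq> level (Suc n)"
    using hom_level[OF _ le_refl, of "Suc n"] Suc.prems(1) by (auto simp: O'_def)
  have finO: "finite O'" using O' finite_subset finite_level by blast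
  have uO: "u \<in> O'" unfolding O'_def using field_hom_id by (intro image_eqI[of _ _ "\<lambda>x. x"]) auto
  have inj: "inj_on \<sigma> (level (Suc n))" if "\<sigma> \<in> ?H" for \<sigma>
    using field_hom_inj_on[OF is_subfield_K, of "Suc n" \<sigma>] that level_subset_K inj_on_subset by blast
  have stab: "\<sigma> ` O' = O'" if "\<sigma> \<in> ?H" for \<sigma>
  proof (rule endo_inj_surj[OF finO])
    show "\<sigma> ` O' \<subseteq> O'"
      using hom_compose that unfolding O'_def by fastforce
    show "inj_on \<sigma> O'" using inj[OF that] O' inj_on_subset by blast
  qed
  have neg: "- u \<in> O'"
  proof (rule ccontr)
    assume nu: "- u \<notin> O'"
    have FO: "inj_on F O'"
    proof (rule inj_onI)
      fix x y assume xy: "x \<in> O'" "y \<in> O'" "F x = F y"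
      show "x = y"
      proof (rule ccontr)
        assume "x \<noteq> y"
        hence xmy: "x = - y" using xy F_eq_iff by blast
        obtain \<sigma> where \<sigma>: "\<sigma> \<in> ?H" "y = \<sigma> u" using xy by (auto simp: O'_def)
        have "u \<in> K (Suc n)" using Suc.prems(1) level_subset_K by auto
        hence "x = \<sigma> (- u)" using \<sigma> xmy field_hom_uminus[OF is_subfield_K, of "Suc n" \<sigma> u] by simp
        moreover obtain z where "z \<in> O'" "x = \<sigma> z" using stab[OF \<sigma>(1)] xy(1) by blast
        moreover have "- u \<in> level (Suc n)" using uminus_level[OF Suc.prems(1)] .
        ultimately have "- u \<in> O'" using inj[OF \<sigma>(1)] O' by (metis inj_on_eq_iff subsetD)
        thus False using nu by simp
      qed
    qed
    have FOi: "F ` O' = level n"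
    proof
      show "F ` O' \<subseteq> level n" using O' by (auto simp: mem_level_Suc)
      show "level n \<subseteq> F ` O'" using lift[OF Suc.prems(1)] by (fastforce simp: O'_def)
    qed
    define P where "P = \<Prod>O'"
    have OK: "O' \<subseteq> K (Suc n)" using O' level_subset_K by blast
    have PK: "P \<in> K (Suc n)"
      unfolding P_def using is_subfield_prod[OF is_subfield_K, of O' "\<lambda>x. x" "Suc n"] OK by auto
    have "\<sigma> P = P" if "field_hom (K (Suc n)) \<sigma>" for \<sigma>
    proof -
      have "\<sigma> P = prod \<sigma> O'"
        unfolding P_def using field_hom_prod[OF is_subfield_K that, of O' "\<lambda>x. x"] OK by auto
      also have "\<dots> = \<Prod>(\<sigma> ` O')"
        using prod.reindex[of \<sigma> O' "\<lambda>x. x"] inj[of \<sigma>] that O' inj_on_subset by fastforce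
      finally show ?thesis using stab[of \<sigma>] that by (simp add: P_def)
    qed
    hence PQ: "P \<in> range to_ac" using fixed_field_rational[OF PK] by blast
    have "P ^ 2 = (\<Prod>x\<in>O'. x ^ 2)" by (simp add: P_def prod_power_distrib)
    also have "\<dots> = (\<Prod>x\<in>O'. F x - of_int c)" by (simp add: F_def)
    also have "\<dots> = (\<Prod>\<rho>\<in>level n. \<rho> - of_int c)" using prod.reindex[OF FO, of "\<lambda>\<rho>. \<rho> - of_int c"] FOi by simp
    finally have "P ^ 2 = of_int (disc n)" by (simp add: prod_level_disc)
    thus False using rational_square_disc[OF PQ] by blast
  qed
  obtain \<sigma> where \<sigma>: "\<sigma> \<in> ?H" "F (\<sigma> u) = F v"
    using lift[of u "F v"] Suc.prems by (auto simp: mem_level_Suc)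
  show ?case
  proof (cases "\<sigma> u = v")
    case True thus ?thesis using \<sigma> by auto
  next
    case False
    hence "v = \<sigma> (- u)"
      using \<sigma> F_eq_iff field_hom_uminus[OF is_subfield_K, of "Suc n" \<sigma> u] Suc.prems(1) level_subset_K
      by (metis (no_types, lifting) mem_Collect_eq minus_minus subsetD)
    moreover obtain \<tau> where "\<tau> \<in> ?H" "\<tau> u = - u" using neg by (auto simp: O'_def)
    ultimately show ?thesis using hom_compose[of "Suc n" \<tau> \<sigma>] \<sigma> by (intro exI[of _ "\<lambda>x. \<sigma> (\<tau> x)"]) auto
  qed
qed

section \<open>Square relations among the discriminants\<close>

text \<open>
  Automorphisms of the tree up to level \<open>m\<close>, as functions of which only the values on these levels
  matter. This covers both Galois automorphisms and automorphisms of the infinite tree.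
\<close>

definition tree_map :: "nat \<Rightarrow> (rat alg_closure \<Rightarrow> rat alg_closure) \<Rightarrow> bool" where
  "tree_map m g \<longleftrightarrow> (\<forall>k\<le>m. bij_betw g (level k) (level k)) \<and>
     (\<forall>k<m. \<forall>w\<in>level (Suc k). F (g w) = g (F w))"

lemma tree_map_mono: "tree_map n g \<Longrightarrow> m \<le> n \<Longrightarrow> tree_map m g"
  unfolding tree_map_def by (meson le_trans less_le_trans)

lemma tree_map_inj: "tree_map m g \<Longrightarrow> k \<le> m \<Longrightarrow> inj_on g (level k)"
  and tree_map_image: "tree_map m g \<Longrightarrow> k \<le> m \<Longrightarrow> g ` level k = level k"
  and tree_map_F: "tree_map m g \<Longrightarrow> k < m \<Longrightarrow> w \<in> level (Suc k) \<Longrightarrow> F (g w) = g (F w)"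
  by (auto simp: tree_map_def bij_betw_def)

lemma tree_map_uminus:
  assumes g: "tree_map m g" and k: "k < m" and w: "w \<in> level (Suc k)"
  shows "g (- w) = - g w"
proof -
  have "F (g (- w)) = F (g w)"
    using tree_map_F[OF g k w] tree_map_F[OF g k uminus_level[OF w]] by simp
  hence "g (- w) = g w \<or> g (- w) = - g w" using F_eq_iff by blast
  moreover have "g (- w) \<noteq> g w"
  proof
    assume "g (- w) = g w"
    hence "- w = w" using tree_map_inj[OF g, of "Suc k"] k w uminus_level[OF w]
      by (auto simp: inj_on_def)
    thus False using level_Suc_nz[OF w] by simp
  qed
  ultimately show ?thesis by blast
qed

lemma tree_map_hom: "field_hom (K n) \<sigma> \<Longrightarrow> tree_map n \<sigma>"
  unfolding tree_map_def
proof (intro conjI allI impI ballI)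
  assume \<sigma>: "field_hom (K n) \<sigma>"
  show "bij_betw \<sigma> (level k) (level k)" if "k \<le> n" for k
    using hom_level[OF \<sigma> that] field_hom_inj_on[OF is_subfield_K \<sigma>] lower_level_subset_K[OF that]
    by (metis bij_betw_def inj_on_subset)
  show "F (\<sigma> w) = \<sigma> (F w)" if "k < n" "w \<in> level (Suc k)" for k w
    using hom_F[OF \<sigma>] lower_level_subset_K[of "Suc k" n] that by (metis Suc_leI subsetD)
qed

definition negation_closed :: "rat alg_closure set \<Rightarrow> bool" where
  "negation_closed S \<longleftrightarrow> (\<forall>w\<in>S. - w \<in> S)"

lemma negation_closed_uminus_iff: "negation_closed S \<Longrightarrow> - w \<in> S \<longleftrightarrow> w \<in> S"
  unfolding negation_closed_def using minus_minus[of w] by metis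

lemma F_mem_image_iff: "negation_closed S \<Longrightarrow> F w \<in> F ` S \<longleftrightarrow> w \<in> S"
  using negation_closed_uminus_iff by (auto simp: F_eq_iff)

lemma negation_closed_sym_diff:
  "negation_closed S \<Longrightarrow> negation_closed T \<Longrightarrow> negation_closed (sym_diff S T)"
  using negation_closed_uminus_iff[of S] negation_closed_uminus_iff[of T]
  unfolding negation_closed_def[of "sym_diff S T"] by auto

lemma F_image_sym_diff:
  assumes "negation_closed S" "negation_closed T"
  shows "F ` sym_diff S T = sym_diff (F ` S) (F ` T)"
proof (rule Set.set_eqI)
  fix \<rho>
  have "\<rho> \<in> F ` A \<longleftrightarrow> half \<rho> \<in> A" if "negation_closed A" for A
    using F_mem_image_iff[OF that, of "half \<rho>"] by simp
  thus "\<rho> \<in> F ` sym_diff S T \<longleftrightarrow> \<rho> \<in> sym_diff (F ` S) (F ` T)"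
    using assms negation_closed_sym_diff[OF assms] by simp
qed

lemma inj_image_sym_diff:
  assumes "inj_on g A" "S \<subseteq> A" "T \<subseteq> A"
  shows "g ` sym_diff S T = sym_diff (g ` S) (g ` T)"
proof -
  have "S - T \<subseteq> A" "T - S \<subseteq> A" using assms by auto
  thus ?thesis
    unfolding image_Un using inj_on_image_set_diff[OF assms(1)] assms(2,3) by presburger
qed

text \<open>
  A subset closed under negation is the full preimage of its image under \<open>F\<close>, so \<open>F\<close> transports the
  family \<open>V\<close> isomorphically to the level below.
\<close>

lemma fixed_subset_of_negation_closed:
  assumes IH: "\<And>V. V \<subseteq> Pow (level m) \<Longrightarrow> (\<And>S T. S \<in> V \<Longrightarrow> T \<in> V \<Longrightarrow> sym_diff S T \<in> V) \<Longrightarrow>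
      (\<And>g S. g \<in> G \<Longrightarrow> S \<in> V \<Longrightarrow> g ` S \<in> V) \<Longrightarrow> \<exists>S\<in>V. S \<noteq> {} \<Longrightarrow> \<exists>S\<in>V. S \<noteq> {} \<and> (\<forall>g\<in>G. g ` S = S)"
    and G: "\<And>g. g \<in> G \<Longrightarrow> tree_map (Suc m) g"
    and V: "V \<subseteq> Pow (level (Suc m))" "\<And>S. S \<in> V \<Longrightarrow> negation_closed S"
    and add: "\<And>S T. S \<in> V \<Longrightarrow> T \<in> V \<Longrightarrow> sym_diff S T \<in> V"
    and inv: "\<And>g S. g \<in> G \<Longrightarrow> S \<in> V \<Longrightarrow> g ` S \<in> V"
    and ne: "\<exists>S\<in>V. S \<noteq> {}"
  shows "\<exists>S\<in>V. S \<noteq> {} \<and> (\<forall>g\<in>G. g ` S = S)"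
proof -
  have Fg: "F ` g ` S = g ` F ` S" if "g \<in> G" "S \<in> V" for g S
    using tree_map_F[OF G[OF that(1)], of m] V(1) that(2) by (force simp: image_image)
  let ?V = "(\<lambda>S. F ` S) ` V"
  have "\<exists>S\<in>?V. S \<noteq> {} \<and> (\<forall>g\<in>G. g ` S = S)"
  proof (rule IH)
    show "?V \<subseteq> Pow (level m)" using V(1) by (force simp: mem_level_Suc)
    show "sym_diff S T \<in> ?V" if ST: "S \<in> ?V" "T \<in> ?V" for S T
    proof -
      obtain A B where AB: "A \<in> V" "S = F ` A" "B \<in> V" "T = F ` B" using ST by blast
      show ?thesis
        unfolding AB(2,4) F_image_sym_diff[OF V(2)[OF AB(1)] V(2)[OF AB(3)], symmetric]
        by (intro imageI add AB)
    qed
    show "g ` S \<in> ?V" if gS: "g \<in> G" "S \<in> ?V" for g S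
    proof -
      obtain A where A: "A \<in> V" "S = F ` A" using gS by blast
      show ?thesis
        unfolding A(2) Fg[OF gS(1) A(1), symmetric] by (intro imageI inv gS(1) A(1))
    qed
    show "\<exists>S\<in>?V. S \<noteq> {}" using ne by blast
  qed
  then obtain S where S: "S \<in> V" "S \<noteq> {}" "\<And>g. g \<in> G \<Longrightarrow> g ` F ` S = F ` S" by blast
  have "g ` S = S" if "g \<in> G" for g
  proof -
    have "F ` g ` S = F ` S" using Fg S that by simp
    hence "w \<in> g ` S \<longleftrightarrow> w \<in> S" for w
      using F_mem_image_iff[OF V(2)[OF S(1)], of w] F_mem_image_iff[OF V(2)[OF inv[OF that S(1)]], of w]
      by argo
    thus ?thesis by (rule Set.set_eqI)
  qed
  thus ?thesis using S by blast
qed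

text \<open>
  This replaces the fact that a 2-group acting on a nonzero vector space over the field with two
  elements has a nonzero fixed vector; the induction follows the tree. The negation-closed subsets form an
  invariant subspace. If \<open>V\<close> meets it trivially, then the invariant linear map \<open>D\<close>, whose values are
  negation-closed and whose kernel consists of the negation-closed sets, is injective on \<open>V\<close>, and a fixed
  element of \<open>D V\<close> comes from a fixed element of \<open>V\<close>.
\<close>

lemma fixed_subset_exists:
  assumes "\<And>g. g \<in> G \<Longrightarrow> tree_map m g"
    and "V \<subseteq> Pow (level m)"
    and "\<And>S T. S \<in> V \<Longrightarrow> T \<in> V \<Longrightarrow> sym_diff S T \<in> V"
    and "\<And>g S. g \<in> G \<Longrightarrow> S \<in> V \<Longrightarrow> g ` S \<in> V"
    and "\<exists>S\<in>V. S \<noteq> {}"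
  shows "\<exists>S\<in>V. S \<noteq> {} \<and> (\<forall>g\<in>G. g ` S = S)"
  using assms
proof (induction m arbitrary: V)
  case 0
  then obtain S where "S \<in> V" "S \<noteq> {}" by blast
  moreover have "S \<subseteq> {0}" using 0(2) \<open>S \<in> V\<close> by auto
  ultimately have S: "S \<in> V" "S = {0}" by blast+
  have "g ` {0} = {0}" if "g \<in> G" for g
    using tree_map_image[OF 0(1)[OF that], of 0] by simp
  thus ?case using S by blast
next
  case (Suc m)
  have G: "tree_map m g" if "g \<in> G" for g using Suc.prems(1)[OF that] tree_map_mono by auto
  have sub: "\<exists>S\<in>W. S \<noteq> {} \<and> (\<forall>g\<in>G. g ` S = S)"
    if W: "W \<subseteq> Pow (level (Suc m))" "\<And>S. S \<in> W \<Longrightarrow> negation_closed S"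
      "\<And>S T. S \<in> W \<Longrightarrow> T \<in> W \<Longrightarrow> sym_diff S T \<in> W"
      "\<And>g S. g \<in> G \<Longrightarrow> S \<in> W \<Longrightarrow> g ` S \<in> W" "\<exists>S\<in>W. S \<noteq> {}" for W
  proof (rule fixed_subset_of_negation_closed[OF _ _ W])
    fix V' assume V': "V' \<subseteq> Pow (level m)" "\<And>S T. S \<in> V' \<Longrightarrow> T \<in> V' \<Longrightarrow> sym_diff S T \<in> V'"
      "\<And>g S. g \<in> G \<Longrightarrow> S \<in> V' \<Longrightarrow> g ` S \<in> V'" "\<exists>S\<in>V'. S \<noteq> {}"
    show "\<exists>S\<in>V'. S \<noteq> {} \<and> (\<forall>g\<in>G. g ` S = S)"
      by (rule Suc.IH) (use G V' in blast)+
  qed (rule Suc.prems(1))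
  show ?case
  proof (cases "\<exists>S\<in>V. S \<noteq> {} \<and> negation_closed S")
    case True
    let ?V = "{S\<in>V. negation_closed S}"
    have nc: "negation_closed (g ` S)" if "g \<in> G" "S \<in> V" "negation_closed S" for g S
    proof -
      have "- g w \<in> g ` S" if "w \<in> S" for w
        using tree_map_uminus[OF Suc.prems(1)[OF \<open>g \<in> G\<close>], of m w] that \<open>S \<in> V\<close> \<open>negation_closed S\<close>
          Suc.prems(2) unfolding negation_closed_def by (metis PowD imageI lessI subsetD)
      thus ?thesis by (auto simp: negation_closed_def)
    qed
    have "\<exists>S\<in>?V. S \<noteq> {} \<and> (\<forall>g\<in>G. g ` S = S)"
    proof (rule sub)
      show "?V \<subseteq> Pow (level (Suc m))" using Suc.prems(2) by blast
      show "sym_diff S T \<in> ?V" if "S \<in> ?V" "T \<in> ?V" for S T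
        using Suc.prems(3) negation_closed_sym_diff that by simp
      show "g ` S \<in> ?V" if "g \<in> G" "S \<in> ?V" for g S
        using Suc.prems(4) nc that by simp
    qed (use True in auto)
    thus ?thesis by blast
  next
    case False
    define D where "D S = sym_diff S (uminus ` S)" for S :: "rat alg_closure set"
    have memD: "w \<in> D S \<longleftrightarrow> (w \<in> S) \<noteq> (- w \<in> S)" for w S
      unfolding D_def by (auto intro: image_eqI[of _ _ "- w"])
    have Dadd: "D (sym_diff S T) = sym_diff (D S) (D T)" for S T
      by (auto simp: memD)
    have D0: "negation_closed S" if "D S = {}" for S
      using that memD unfolding negation_closed_def by blast
    have Dg: "D (g ` S) = g ` D S" if "g \<in> G" "S \<in> V" for g S
    proof -
      note tm = Suc.prems(1)[OF that(1)]
      have SL: "S \<subseteq> level (Suc m)" using that Suc.prems(2) by blast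
      have UL: "uminus ` S \<subseteq> level (Suc m)" using SL uminus_level by blast
      have "uminus ` g ` S = g ` uminus ` S"
        using tree_map_uminus[OF tm, of m] SL by (force simp: image_image)
      thus ?thesis
        unfolding D_def by (simp only: inj_image_sym_diff[OF tree_map_inj[OF tm le_refl] SL UL])
    qed
    have "\<exists>S\<in>D ` V. S \<noteq> {} \<and> (\<forall>g\<in>G. g ` S = S)"
    proof (rule sub)
      show "D ` V \<subseteq> Pow (level (Suc m))"
        using Suc.prems(2) uminus_level unfolding D_def by blast
      show "negation_closed S" if "S \<in> D ` V" for S
        using that by (auto simp: negation_closed_def memD)
      show "sym_diff S T \<in> D ` V" if ST: "S \<in> D ` V" "T \<in> D ` V" for S T
      proof -
        obtain A B where AB: "A \<in> V" "S = D A" "B \<in> V" "T = D B" using ST by blast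
        show ?thesis unfolding AB(2,4) Dadd[symmetric] by (intro imageI Suc.prems(3) AB)
      qed
      show "g ` S \<in> D ` V" if gS: "g \<in> G" "S \<in> D ` V" for g S
      proof -
        obtain A where A: "A \<in> V" "S = D A" using gS by blast
        show ?thesis unfolding A(2) Dg[OF gS(1) A(1), symmetric] by (intro imageI Suc.prems(4) gS A)
      qed
      obtain S where "S \<in> V" "S \<noteq> {}" using Suc.prems(5) by blast
      moreover from this have "D S \<noteq> {}" using False D0[of S] by blast
      ultimately show "\<exists>S\<in>D ` V. S \<noteq> {}" by (intro bexI[of _ "D S"] imageI)
    qed
    then obtain S where S: "S \<in> V" "D S \<noteq> {}" "\<And>g. g \<in> G \<Longrightarrow> g ` D S = D S" by blast
    have "g ` S = S" if "g \<in> G" for g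
    proof -
      have "D (sym_diff S (g ` S)) = {}" using Dadd Dg S that by simp
      hence "negation_closed (sym_diff S (g ` S))" by (rule D0)
      moreover have "sym_diff S (g ` S) \<in> V"
        using Suc.prems(3)[OF S(1) Suc.prems(4)[OF that S(1)]] .
      ultimately have "sym_diff S (g ` S) = {}" using False by metis
      thus ?thesis by blast
    qed
    moreover have "S \<noteq> {}" using S(2) by (auto simp: D_def)
    ultimately show ?thesis using S(1) by blast
  qed
qed

text \<open>
  The kernel of the Kummer map: the sets \<open>S\<close> for which the product of the \<open>\<rho> - c\<close> over \<open>S\<close> is a square in
  \<open>K n\<close>. It is a vector space over the field with two elements under symmetric difference.
\<close>

definition relations :: "nat \<Rightarrow> rat alg_closure set set" where
  "relations n = {S. S \<subseteq> level n \<and> (\<Prod>\<rho>\<in>S. half \<rho>) \<in> K n}"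

text \<open>
  Equivalent to the degree of \<open>K (n + 1)\<close> over \<open>K n\<close> being as large as possible, namely \<open>2\<close> to the
  power \<open>2\<^sup>n\<close>; one direction is \<open>maximal_step_relations\<close>.
\<close>

definition maximal_step :: "nat \<Rightarrow> bool" where
  "maximal_step n \<longleftrightarrow> \<not> (\<exists>y\<in>K n. y ^ 2 = of_int (disc n))"

lemma prod_half_nz: "S \<subseteq> level n \<Longrightarrow> (\<Prod>\<rho>\<in>S. half \<rho>) \<noteq> 0"
  using half_nz by (metis finite_level finite_subset prod_zero_iff subsetD)

lemma relations_sym_diff:
  assumes "S \<in> relations n" "T \<in> relations n" shows "sym_diff S T \<in> relations n"
proof -
  have ST: "S \<subseteq> level n" "T \<subseteq> level n" and fin: "finite S" "finite T"
    using assms finite_subset[OF _ finite_level] by (auto simp: relations_def)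
  let ?p = "\<lambda>S. \<Prod>\<rho>\<in>S. half \<rho>"
  have "?p S = ?p (S - T) * ?p (S \<inter> T)" "?p T = ?p (T - S) * ?p (S \<inter> T)"
    using fin prod.Int_Diff[of S half T] prod.Int_Diff[of T half S] by (simp_all add: Int_commute mult.commute)
  moreover have "?p (sym_diff S T) = ?p (S - T) * ?p (T - S)"
    using fin by (subst prod.union_disjoint) auto
  ultimately have "?p (sym_diff S T) * ?p (S \<inter> T) ^ 2 = ?p S * ?p T"
    by (simp add: power2_eq_square mult_ac)
  moreover have "?p S * ?p T \<in> K n" using assms is_subfield_mult[OF is_subfield_K] by (auto simp: relations_def)
  moreover have "?p (S \<inter> T) ^ 2 \<in> K n"
    unfolding prod_power_distrib using ST half_square_in_K
    by (intro is_subfield_prod[OF is_subfield_K]) auto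
  moreover have "?p (S \<inter> T) ^ 2 \<noteq> 0" using prod_half_nz[of "S \<inter> T" n] ST by auto
  ultimately have "?p (sym_diff S T) \<in> K n" using is_subfield_cancel[OF is_subfield_K] by metis
  thus ?thesis using ST by (auto simp: relations_def)
qed

lemma relations_hom:
  assumes \<sigma>: "field_hom (K n) \<sigma>" and S: "S \<in> relations n"
  shows "\<sigma> ` S \<in> relations n"
proof -
  have SL: "S \<subseteq> level n" using S by (auto simp: relations_def)
  have SK: "S \<subseteq> K n" using SL level_subset_K by blast
  have inj: "inj_on \<sigma> S" using SK field_hom_inj_on[OF is_subfield_K \<sigma>] inj_on_subset by blast
  let ?x = "\<Prod>\<rho>\<in>S. half \<rho>"
  have x: "?x \<in> K n" using S by (simp add: relations_def)
  have "(\<Prod>\<rho>\<in>\<sigma> ` S. half \<rho>) ^ 2 = (\<Prod>\<rho>\<in>S. \<sigma> \<rho> - of_int c)"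
    unfolding prod_half_square by (simp add: prod.reindex[OF inj])
  also have "\<dots> = (\<Prod>\<rho>\<in>S. \<sigma> (\<rho> - of_int c))"
    using SK field_hom_diff[OF is_subfield_K \<sigma> _ is_subfield_of_int[OF is_subfield_K]]
      field_hom_of_int[OF is_subfield_K \<sigma>] by (intro prod.cong) auto
  also have "\<dots> = \<sigma> (\<Prod>\<rho>\<in>S. \<rho> - of_int c)"
    using SK by (intro field_hom_prod[OF is_subfield_K \<sigma>, symmetric] is_subfield_diff[OF is_subfield_K]
        is_subfield_of_int[OF is_subfield_K]) auto
  also have "\<dots> = \<sigma> ?x ^ 2"
    using field_hom_power2[OF is_subfield_K \<sigma> x] by (simp add: prod_half_square)
  finally have "(\<Prod>\<rho>\<in>\<sigma> ` S. half \<rho>) = \<sigma> ?x \<or> (\<Prod>\<rho>\<in>\<sigma> ` S. half \<rho>) = - \<sigma> ?x"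
    by (simp add: power2_eq_iff)
  moreover have "\<sigma> ?x \<in> K n" using hom_K[OF \<sigma>] x by blast
  ultimately have "(\<Prod>\<rho>\<in>\<sigma> ` S. half \<rho>) \<in> K n" using is_subfield_uminus[OF is_subfield_K] by metis
  moreover have "\<sigma> ` S \<subseteq> level n" using hom_level[OF \<sigma> le_refl] SL by blast
  ultimately show ?thesis by (simp add: relations_def)
qed

text \<open>
  By transitivity a nonempty Galois-invariant set of relations can only be the whole level, whose
  product is a square root of \<open>disc n\<close>.
\<close>

lemma maximal_step_relations:
  assumes "maximal_step n" "S \<in> relations n" shows "S = {}"
proof (rule ccontr)
  assume "S \<noteq> {}"
  let ?G = "{\<sigma>. field_hom (K n) \<sigma>}"
  have "\<exists>S\<in>relations n. S \<noteq> {} \<and> (\<forall>g\<in>?G. g ` S = S)"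
    using \<open>S \<noteq> {}\<close> assms(2) relations_sym_diff relations_hom tree_map_hom
    by (intro fixed_subset_exists[of ?G n]) (auto simp: relations_def)
  then obtain T where T: "T \<in> relations n" "T \<noteq> {}" "\<And>g. field_hom (K n) g \<Longrightarrow> g ` T = T" by blast
  have TL: "T \<subseteq> level n" using T by (simp add: relations_def)
  obtain u where u: "u \<in> T" using T by blast
  have "level n \<subseteq> T"
  proof
    fix v assume "v \<in> level n"
    then obtain \<sigma> where "field_hom (K n) \<sigma>" "\<sigma> u = v" using galois_transitive u TL by blast
    thus "v \<in> T" using T(3) u by blast
  qed
  hence "T = level n" using TL by simp
  hence "(\<Prod>\<rho>\<in>level n. half \<rho>) \<in> K n" using T by (simp add: relations_def)
  moreover have "(\<Prod>\<rho>\<in>level n. half \<rho>) ^ 2 = of_int (disc n)"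
    by (simp add: prod_half_square prod_level_disc)
  ultimately show False using assms(1) unfolding maximal_step_def by blast
qed

text \<open>
  A tree automorphism sends a square root of \<open>\<rho> - c\<close> to a square root of \<open>\<tau> \<rho> - c\<close>, so the Kummer
  extension lemma applies once the relations are respected.
\<close>

lemma hom_extends_to_tree_map:
  assumes \<sigma>: "field_hom (K n) \<sigma>" and \<tau>: "tree_map (Suc n) \<tau>"
    and eq: "\<And>\<rho>. \<rho> \<in> level n \<Longrightarrow> \<sigma> \<rho> = \<tau> \<rho>"
    and compat: "\<And>S. S \<in> relations n \<Longrightarrow> \<sigma> (\<Prod>\<rho>\<in>S. half \<rho>) = (\<Prod>\<rho>\<in>S. \<tau> (half \<rho>))"
  shows "\<exists>\<sigma>'. field_hom (K (Suc n)) \<sigma>' \<and> (\<forall>x\<in>K n. \<sigma>' x = \<sigma> x) \<and> (\<forall>z\<in>level (Suc n). \<sigma>' z = \<tau> z)"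
proof -
  obtain bs where bs: "set bs = half ` level n" "distinct bs" using half_list_exists by blast
  have "\<exists>\<sigma>'. field_hom (adjoin_list (K n) bs) \<sigma>' \<and> (\<forall>x\<in>K n. \<sigma>' x = \<sigma> x) \<and> (\<forall>b\<in>set bs. \<sigma>' b = \<tau> b)"
  proof (rule field_hom_adjoin_list_extension[OF is_subfield_K \<sigma> _ _ bs(2)])
    fix b assume "b \<in> set bs"
    then obtain \<rho> where \<rho>: "\<rho> \<in> level n" "b = half \<rho>" using bs by auto
    show "b ^ 2 \<in> K n" using half_square_in_K \<rho> by simp
    show "b \<noteq> 0" using half_nz \<rho> by simp
    have "F (\<tau> b) = \<tau> \<rho>" using tree_map_F[OF \<tau>, of n b] \<rho> half_in_level by simp
    hence "\<tau> b ^ 2 = \<sigma> \<rho> - of_int c" using eq[OF \<rho>(1)] by (simp add: F_def algebra_simps)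
    also have "\<dots> = \<sigma> (\<rho> - of_int c)"
      using field_hom_diff[OF is_subfield_K \<sigma> _ is_subfield_of_int[OF is_subfield_K]]
        field_hom_of_int[OF is_subfield_K \<sigma>] \<rho>(1) level_subset_K by (metis subsetD)
    finally show "\<tau> b ^ 2 = \<sigma> (b ^ 2)" by (simp add: \<rho>(2) half_square)
  next
    fix S assume S: "S \<subseteq> set bs" "\<Prod>S \<in> K n"
    define T where "T = F ` S"
    have ST: "S = half ` T" using S bs(1) by (force simp: T_def image_image)
    have TL: "T \<subseteq> level n" using S bs(1) by (auto simp: T_def)
    have p: "(\<Prod>\<rho>\<in>T. g (half \<rho>)) = prod g S" for g :: "rat alg_closure \<Rightarrow> rat alg_closure"
      unfolding ST by (simp add: prod.reindex[OF inj_half])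
    have "T \<in> relations n" using S(2) TL p[of "\<lambda>x. x"] by (simp add: relations_def)
    thus "\<sigma> (\<Prod>S) = prod \<tau> S" using compat[of T] p[of "\<lambda>x. x"] p[of \<tau>] by simp
  qed
  then obtain \<sigma>' where \<sigma>': "field_hom (K (Suc n)) \<sigma>'" "\<forall>x\<in>K n. \<sigma>' x = \<sigma> x" "\<forall>b\<in>set bs. \<sigma>' b = \<tau> b"
    unfolding K_Suc[OF bs(1)] by blast
  have "\<sigma>' z = \<tau> z" if z: "z \<in> level (Suc n)" for z
  proof -
    have Fz: "F z \<in> level n" using z by (simp add: mem_level_Suc)
    have h: "half (F z) \<in> level (Suc n)" "\<sigma>' (half (F z)) = \<tau> (half (F z))"
      using half_in_level[OF Fz] \<sigma>'(3) bs Fz by auto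
    consider "z = half (F z)" | "z = - half (F z)" using F_eq_iff_half by blast
    thus ?thesis
    proof cases
      case 1 thus ?thesis using h by metis
    next
      case 2
      have "\<tau> (- half (F z)) = - \<tau> (half (F z))" "\<sigma>' (- half (F z)) = - \<sigma>' (half (F z))"
        using tree_map_uminus[OF \<tau> lessI h(1)] tree_map_uminus[OF tree_map_hom[OF \<sigma>'(1)] lessI h(1)] by auto
      thus ?thesis using h 2 by metis
    qed
  qed
  thus ?thesis using \<sigma>' by blast
qed

lemma hom_extends_maximal:
  assumes "maximal_step n" "field_hom (K n) \<sigma>" "tree_map (Suc n) \<tau>"
    and "\<And>\<rho>. \<rho> \<in> level n \<Longrightarrow> \<sigma> \<rho> = \<tau> \<rho>"
  shows "\<exists>\<sigma>'. field_hom (K (Suc n)) \<sigma>' \<and> (\<forall>x\<in>K n. \<sigma>' x = \<sigma> x) \<and> (\<forall>z\<in>level (Suc n). \<sigma>' z = \<tau> z)"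
proof (rule hom_extends_to_tree_map[OF assms(2-4)])
  fix S assume "S \<in> relations n"
  hence "S = {}" by (rule maximal_step_relations[OF assms(1)])
  thus "\<sigma> (\<Prod>\<rho>\<in>S. half \<rho>) = (\<Prod>\<rho>\<in>S. \<tau> (half \<rho>))" using field_hom_one[OF assms(2)] by simp
qed

end

section \<open>Unramified primes\<close>

text \<open>
  An elementary substitute for the integral closure of the integers localised at \<open>p\<close> in a field
  unramified at \<open>p\<close>: \<open>A\<close> is closed under those square roots that lie in \<open>M\<close>, and \<open>A\<close> modulo \<open>p\<close> has no element with
  square zero (an element whose square is divisible by \<open>p\<close> is divisible by \<open>p\<close>). Both
  properties survive the adjunction of the square root of a unit when 2 is invertible.
\<close>

definition unramified_order :: "nat \<Rightarrow> 'a::field set \<Rightarrow> 'a set \<Rightarrow> bool" where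
  "unramified_order p A M \<longleftrightarrow> is_subfield M \<and> A \<subseteq> M \<and> 1 \<in> A \<and> inverse 2 \<in> A \<and>
     (\<forall>x\<in>A. \<forall>y\<in>A. x - y \<in> A \<and> x * y \<in> A) \<and>
     (\<forall>x\<in>M. x ^ 2 \<in> A \<longrightarrow> x \<in> A) \<and> (\<forall>x\<in>M. x ^ 2 / of_nat p \<in> A \<longrightarrow> x / of_nat p \<in> A) \<and>
     inverse (of_nat p) \<notin> A"

context
  fixes p A and M :: "'a::field_char_0 set"
  assumes A: "unramified_order p A M"
begin

lemma order_diff: "x \<in> A \<Longrightarrow> y \<in> A \<Longrightarrow> x - y \<in> A"
  and order_mult: "x \<in> A \<Longrightarrow> y \<in> A \<Longrightarrow> x * y \<in> A"
  and order_one: "1 \<in> A"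
  and order_sqrt: "x \<in> M \<Longrightarrow> x ^ 2 \<in> A \<Longrightarrow> x \<in> A"
  and order_sqrt_p: "x \<in> M \<Longrightarrow> x ^ 2 / of_nat p \<in> A \<Longrightarrow> x / of_nat p \<in> A"
  and order_subfield: "is_subfield M"
  and order_subset: "A \<subseteq> M"
  and order_inverse_p: "inverse (of_nat p) \<notin> A"
  using A by (auto simp: unramified_order_def)

lemma order_zero: "0 \<in> A"
  using order_diff[OF order_one order_one] by simp

lemma order_uminus: "x \<in> A \<Longrightarrow> - x \<in> A"
  using order_diff[OF order_zero, of x] by simp

lemma order_add: "x \<in> A \<Longrightarrow> y \<in> A \<Longrightarrow> x + y \<in> A"
  using order_diff[of x "- y"] order_uminus by simp

lemma order_of_nat: "of_nat n \<in> A"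
  by (induction n) (simp_all add: order_zero order_add order_one)

lemma order_of_int: "of_int n \<in> A"
  by (cases n) (simp_all add: order_of_nat order_uminus order_add order_diff order_one)

lemma order_prod: "(\<And>x. x \<in> S \<Longrightarrow> g x \<in> A) \<Longrightarrow> prod g S \<in> A"
  by (induction S rule: infinite_finite_induct) (simp_all add: order_one order_mult)

lemma order_halve: "2 * x \<in> A \<Longrightarrow> x \<in> A"
proof -
  assume "2 * x \<in> A"
  moreover have "inverse 2 \<in> A" using A by (simp add: unramified_order_def)
  ultimately have "inverse 2 * (2 * x) \<in> A" by (rule order_mult[rotated])
  thus ?thesis by simp
qed

lemma order_p_nz: "(of_nat p :: 'a) \<noteq> 0"
  using order_inverse_p order_zero by (metis inverse_zero)

lemma unramified_order_adjoin:
  assumes b: "b ^ 2 \<in> A" "inverse (b ^ 2) \<in> A" "b \<notin> M" and b0: "b \<noteq> 0"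
  shows "unramified_order p {x + y * b |x y. x \<in> A \<and> y \<in> A} (adjoin M b)"
proof -
  let ?B = "{x + y * b |x y. x \<in> A \<and> y \<in> A}"
  let ?p = "of_nat p :: 'a"
  have bM: "b ^ 2 \<in> M" using b order_subset by blast
  have BI: "x + y * b \<in> ?B" if "x \<in> A" "y \<in> A" for x y using that by blast
  have AB: "x \<in> ?B" if "x \<in> A" for x using BI[OF that order_zero] by simp
  note coords = adjoin_coords_unique[OF order_subfield b(3)]
  have BA: "x \<in> A \<and> y \<in> A" if "x + y * b \<in> ?B" "x \<in> M" "y \<in> M" for x y
  proof -
    obtain x' y' where xy': "x + y * b = x' + y' * b" "x' \<in> A" "y' \<in> A" using \<open>x + y * b \<in> ?B\<close> by blast
    hence "x = x' \<and> y = y'" using coords[OF \<open>x \<in> M\<close> \<open>y \<in> M\<close>, of x' y'] order_subset by blast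
    thus ?thesis using xy' by simp
  qed
  \<comment> \<open>Let \<open>u = x + y b\<close>, let \<open>u'\<close> be its conjugate and \<open>N = u u'\<close>. From \<open>N\<^sup>2 = u\<^sup>2 u'\<^sup>2\<close> the norm \<open>N\<close>
    is integral, and then so are \<open>2 x\<close> and \<open>2 y\<close>, since \<open>(u + u')\<^sup>2\<close> and \<open>(u - u')\<^sup>2\<close> are \<open>u\<^sup>2 + u'\<^sup>2 \<plusminus> 2 N\<close>.
    The case \<open>s = p\<close> keeps track of one factor \<open>p\<close> throughout.\<close>
  have key: "x / s \<in> A \<and> y / s \<in> A"
    if s: "s = 1 \<or> s = ?p" and x: "x \<in> M" and y: "y \<in> M" and u: "(x + y * b) ^ 2 / s \<in> ?B" for x y s
  proof -
    have s0: "s \<noteq> 0" "s \<in> A" "s \<in> M" using s order_p_nz order_one order_of_nat order_subset by auto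
    note Mi = is_subfield_add[OF order_subfield] is_subfield_mult[OF order_subfield]
      is_subfield_divide[OF order_subfield] is_subfield_diff[OF order_subfield]
      is_subfield_power[OF order_subfield] is_subfield_numeral[OF order_subfield]
    have root: "z / s \<in> A" if "z \<in> M" "z ^ 2 / s \<in> A" for z
      using s order_sqrt[OF that(1)] order_sqrt_p[OF that(1)] that(2) by auto
    define U where "U = (x ^ 2 + y ^ 2 * b ^ 2) / s"
    define V where "V = 2 * x * y / s"
    have "(x + y * b) ^ 2 / s = U + V * b"
      using s0 by (simp add: U_def V_def power2_eq_square field_simps)
    moreover have "U \<in> M" "V \<in> M" unfolding U_def V_def using x y bM s0 by (auto intro!: Mi)
    ultimately have UV: "U \<in> A" "V \<in> A" using BA[of U V] u by auto
    define N where "N = x ^ 2 - y ^ 2 * b ^ 2"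
    have NM: "N \<in> M" unfolding N_def using x y bM by (auto intro!: Mi)
    have "(N / s) ^ 2 = U ^ 2 - V ^ 2 * b ^ 2"
      using s0 by (simp add: N_def U_def V_def power2_eq_square field_simps)
    also have "\<dots> \<in> A" using UV b by (auto intro!: order_diff order_mult simp: power2_eq_square)
    finally have Ns: "N / s \<in> A" using order_sqrt[of "N / s"] NM s0 by (auto intro: Mi)
    have "(2 * x) ^ 2 / s = 2 * (U + N / s)"
      using s0 by (simp add: N_def U_def power2_eq_square field_simps)
    also have "\<dots> \<in> A" using order_mult[OF order_of_nat[of 2] order_add[OF UV(1) Ns]] by simp
    finally have "2 * x / s \<in> A" using root[of "2 * x"] x by (auto intro: Mi)
    hence 1: "x / s \<in> A" using order_halve[of "x / s"] by simp
    have "(2 * y) ^ 2 / s = 2 * (U - N / s) * inverse (b ^ 2)"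
      using s0 b0 by (simp add: N_def U_def power2_eq_square field_simps)
    also have "\<dots> \<in> A" using order_mult[OF order_mult[OF order_of_nat[of 2] order_diff[OF UV(1) Ns]] b(2)] by simp
    finally have "2 * y / s \<in> A" using root[of "2 * y"] y by (auto intro: Mi)
    hence "y / s \<in> A" using order_halve[of "y / s"] by simp
    thus ?thesis using 1 by simp
  qed
  show ?thesis unfolding unramified_order_def
  proof (intro conjI ballI impI)
    show "is_subfield (adjoin M b)" by (rule is_subfield_adjoin[OF order_subfield bM])
    show "?B \<subseteq> adjoin M b" using order_subset unfolding adjoin_def by blast
    show "1 \<in> ?B" by (rule AB[OF order_one])
    show "inverse 2 \<in> ?B" by (rule AB[OF order_halve]) (simp add: order_one)
    fix u v assume "u \<in> ?B" "v \<in> ?B"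
    then obtain x y x' y' where xy: "x \<in> A" "y \<in> A" "x' \<in> A" "y' \<in> A" "u = x + y * b" "v = x' + y' * b"
      by blast
    have "u - v = (x - x') + (y - y') * b" by (simp add: xy algebra_simps)
    also have "\<dots> \<in> ?B" by (intro BI order_diff xy)
    finally show "u - v \<in> ?B" .
    have "u * v = (x * x' + y * y' * b ^ 2) + (x * y' + x' * y) * b"
      by (simp add: xy power2_eq_square algebra_simps)
    also have "\<dots> \<in> ?B" by (intro BI order_add order_mult xy b)
    finally show "u * v \<in> ?B" .
  next
    fix u assume "u \<in> adjoin M b" "u ^ 2 \<in> ?B"
    then obtain x y where xy: "x \<in> M" "y \<in> M" "u = x + y * b" unfolding adjoin_def by blast
    thus "u \<in> ?B" using key[of 1 x y] \<open>u ^ 2 \<in> ?B\<close> BI by simp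
  next
    fix u assume "u \<in> adjoin M b" and u: "u ^ 2 / ?p \<in> ?B"
    then obtain x y where xy: "x \<in> M" "y \<in> M" "u = x + y * b" unfolding adjoin_def by blast
    have "u / ?p = x / ?p + y / ?p * b" using xy by (simp add: add_divide_distrib)
    thus "u / ?p \<in> ?B" using key[of ?p x y] u xy BI[of "x / ?p" "y / ?p"] by simp
  next
    show "inverse ?p \<notin> ?B"
    proof
      assume "inverse ?p \<in> ?B"
      hence "inverse ?p + 0 * b \<in> ?B" by simp
      moreover have "inverse ?p \<in> M" "0 \<in> M"
        using order_of_nat[of p] order_zero order_subset is_subfield_inverse[OF order_subfield] by blast+
      ultimately have "inverse ?p \<in> A" using BA by blast
      thus False using order_inverse_p by simp
    qed
  qed
qed

end

lemma unramified_order_adjoin_list: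
  fixes M :: "'a::field_char_0 set"
  assumes "unramified_order p A M" "\<And>b. b \<in> set bs \<Longrightarrow> b ^ 2 \<in> A \<and> inverse (b ^ 2) \<in> A \<and> b \<noteq> 0"
  shows "\<exists>B. unramified_order p B (adjoin_list M bs) \<and> A \<subseteq> B \<and> set bs \<subseteq> B"
  using assms(2)
proof (induction bs)
  case Nil thus ?case using assms(1) by auto
next
  case (Cons b bs)
  then obtain B where B: "unramified_order p B (adjoin_list M bs)" "A \<subseteq> B" "set bs \<subseteq> B" by auto
  have b: "b ^ 2 \<in> B" "inverse (b ^ 2) \<in> B" "b \<noteq> 0" using Cons.prems B by auto
  show ?case
  proof (cases "b \<in> adjoin_list M bs")
    case True
    hence "b \<in> B" using order_sqrt[OF B(1) True b(1)] by simp
    thus ?thesis using B adjoin_trivial[OF order_subfield[OF B(1)] True] by (intro exI[of _ B]) auto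
  next
    case False
    let ?B = "{x + y * b |x y. x \<in> B \<and> y \<in> B}"
    have "B \<subseteq> ?B" using order_zero[OF B(1)] by force
    moreover have "b \<in> ?B" using order_zero[OF B(1)] order_one[OF B(1)] by force
    ultimately show ?thesis
      using unramified_order_adjoin[OF B(1) b(1,2) False b(3)] B(2,3)
      by (intro exI[of _ ?B]) auto
  qed
qed

lemma unramified_order_rat:
  assumes p: "prime p" "odd p"
  shows "unramified_order p {to_ac (of_int a / of_int b) |a b. \<not> int p dvd b} (range (to_ac :: rat \<Rightarrow> _))"
proof -
  let ?A = "{to_ac (of_int a / of_int b) |a b. \<not> int p dvd b} :: rat alg_closure set"
  have pr: "prime (int p)" using p by simp
  have nz: "of_int b \<noteq> (0::rat)" if "\<not> int p dvd b" for b using that by auto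
  have AI: "to_ac x \<in> ?A" if "x = of_int a / of_int b" "\<not> int p dvd b" for x a b using that by blast
  have p0: "of_nat p \<noteq> (0::rat)" using p(1) prime_gt_0_nat by simp
  \<comment> \<open>Reduced fractions: a power of \<open>p\<close> in the denominator would survive squaring.\<close>
  have reduce: "\<exists>a b. r = of_int a / of_int b \<and> b \<noteq> 0 \<and> coprime a b" for r :: rat
    by (metis quotient_of_coprime quotient_of_denom_pos less_irrefl quotient_of_div surj_pair)
  show ?thesis unfolding unramified_order_def
  proof (intro conjI ballI impI)
    show "is_subfield (range (to_ac :: rat \<Rightarrow> _))" by (rule is_subfield_range_to_ac)
    show "?A \<subseteq> range to_ac" by blast
    have "\<not> int p dvd 1" using pr by (simp add: prime_int_iff)
    thus "1 \<in> ?A" using AI[of 1 1 1] by simp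
    have "\<not> int p dvd 2" using p by (metis int_dvd_int_iff of_nat_numeral primes_dvd_imp_eq two_is_prime_nat even_numeral dvd_refl)
    thus "inverse 2 \<in> ?A" using AI[of "inverse 2" 1 2] by (simp add: inverse_eq_divide)
  next
    fix x y assume "x \<in> ?A" "y \<in> ?A"
    then obtain a b a' b' where ab: "x = to_ac (of_int a / of_int b)" "\<not> int p dvd b"
      "y = to_ac (of_int a' / of_int b')" "\<not> int p dvd b'" by blast
    have bb: "\<not> int p dvd b * b'" using ab pr by (simp add: prime_dvd_mult_iff)
    have "(of_int a / of_int b - of_int a' / of_int b' :: rat) = of_int (a * b' - a' * b) / of_int (b * b')"
      using nz ab by (simp add: field_simps)
    thus "x - y \<in> ?A" unfolding ab(1,3) to_ac_diff[symmetric] by (rule AI[OF _ bb])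
    have "(of_int a / of_int b * (of_int a' / of_int b') :: rat) = of_int (a * a') / of_int (b * b')"
      by simp
    thus "x * y \<in> ?A" unfolding ab(1,3) to_ac_mult[symmetric] by (rule AI[OF _ bb])
  next
    fix x :: "rat alg_closure" assume "x \<in> range to_ac" "x ^ 2 \<in> ?A"
    then obtain r a b where r: "x = to_ac r" and ab: "to_ac (r ^ 2) = to_ac (of_int a / of_int b)" "\<not> int p dvd b"
      by auto
    obtain m n where mn: "r = of_int m / of_int n" "n \<noteq> 0" "coprime m n" using reduce by blast
    have "of_int (m ^ 2 * b) = (of_int (a * n ^ 2) :: rat)"
      using ab(1) nz[OF ab(2)] mn by (simp add: field_simps power_divide del: to_ac_power to_ac_divide)
    hence eq: "m ^ 2 * b = a * n ^ 2" by (simp only: of_int_eq_iff)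
    have "\<not> int p dvd n"
    proof
      assume pn: "int p dvd n"
      hence "int p dvd m ^ 2 * b" using eq by (simp add: power2_eq_square)
      hence "int p dvd m" using ab(2) pr by (metis prime_dvd_mult_iff prime_dvd_power)
      thus False using mn(3) pn pr by (meson coprime_common_divisor not_prime_unit)
    qed
    thus "x \<in> ?A" using AI[OF mn(1)] r by simp
  next
    fix x :: "rat alg_closure" assume "x \<in> range to_ac" "x ^ 2 / of_nat p \<in> ?A"
    then obtain r a b where r: "x = to_ac r" and "to_ac r ^ 2 / of_nat p = to_ac (of_int a / of_int b)"
      and b: "\<not> int p dvd b" by auto
    hence "to_ac (r ^ 2 / of_nat p) = to_ac (of_int a / of_int b)" by simp
    hence ab: "r ^ 2 / of_nat p = of_int a / of_int b" by (simp only: to_ac_eq_iff)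
    obtain m n where mn: "r = of_int m / of_int n" "n \<noteq> 0" "coprime m n" using reduce by blast
    have "of_int (m ^ 2 * b) = (of_int (int p * a * n ^ 2) :: rat)"
      using ab nz[OF b] mn p0 by (simp add: field_simps power_divide)
    hence eq: "m ^ 2 * b = int p * a * n ^ 2" by (simp only: of_int_eq_iff)
    have "int p dvd m ^ 2 * b" using eq by simp
    hence pm: "int p dvd m" using b pr by (metis prime_dvd_mult_iff prime_dvd_power)
    hence pn: "\<not> int p dvd n" using mn(3) pr by (meson coprime_common_divisor not_prime_unit)
    obtain k where k: "m = int p * k" using pm by (elim dvdE)
    have "r / of_nat p = of_int k / of_int n" using mn k p0 by simp
    hence "to_ac (r / of_nat p) \<in> ?A" by (rule AI[OF _ pn])
    moreover have "to_ac (r / of_nat p) = x / of_nat p" using r by simp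
    ultimately show "x / of_nat p \<in> ?A" by metis
  next
    show "inverse (of_nat p) \<notin> ?A"
    proof
      assume "inverse (of_nat p) \<in> ?A"
      then obtain a b where "inverse (of_nat p) = (to_ac (of_int a / of_int b) :: rat alg_closure)" and b: "\<not> int p dvd b" by blast
      hence "to_ac (inverse (of_nat p) :: rat) = to_ac (of_int a / of_int b)" by simp
      hence "inverse (of_nat p) = (of_int a / of_int b :: rat)" by (simp only: to_ac_eq_iff)
      hence "of_int b = (of_int (int p * a) :: rat)" using p0 nz[OF b] by (simp add: field_simps)
      hence "b = int p * a" by (simp only: of_int_eq_iff)
      thus False using b by simp
    qed
  qed
qed

context quadratic
begin

text \<open>
  The square roots adjoined at level \<open>m\<close> are those of \<open>\<rho> - c\<close>, and these are units at \<open>p\<close> because their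
  product is \<open>disc m\<close>.
\<close>

lemma unramified_order_K:
  assumes p: "prime p" "odd p" and good: "\<And>m. 1 \<le> m \<Longrightarrow> m \<le> n \<Longrightarrow> \<not> int p dvd crit m"
  shows "\<exists>A. unramified_order p A (K n) \<and> level n \<subseteq> A \<and> (\<forall>a b. \<not> int p dvd b \<longrightarrow> of_int a / of_int b \<in> A)"
  using good
proof (induction n)
  case 0
  have "\<not> int p dvd 1" using prime_gt_1_nat[OF p(1)] by auto
  let ?A = "{to_ac (of_int a / of_int b) |a b. \<not> int p dvd b} :: rat alg_closure set"
  have quot: "of_int a / of_int b \<in> ?A" if "\<not> int p dvd b" for a b
  proof -
    have "to_ac (of_int a / of_int b) \<in> ?A" using that by blast
    thus ?thesis by simp
  qed
  have "level 0 \<subseteq> ?A" using quot[OF \<open>\<not> int p dvd 1\<close>, of 0] by simp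
  thus ?case using unramified_order_rat[OF p] quot unfolding K_0 by blast
next
  case (Suc n)
  then obtain A where A: "unramified_order p A (K n)" "level n \<subseteq> A"
    "\<And>a b. \<not> int p dvd b \<Longrightarrow> of_int a / of_int b \<in> A" by auto
  obtain bs where bs: "set bs = half ` level n" using half_list_exists by blast
  have inA: "\<rho> - of_int c \<in> A" if "\<rho> \<in> level n" for \<rho>
    using that A(2) order_diff[OF A(1) _ order_of_int[OF A(1)]] by blast
  have "\<not> int p dvd disc n" using Suc.prems[of "Suc n"] by (auto simp: disc_def crit_Suc)
  hence unit: "inverse (of_int (disc n)) \<in> A" using A(3)[of "disc n" 1] by (simp add: inverse_eq_divide)
  have "inverse (\<rho> - of_int c) \<in> A" if \<rho>: "\<rho> \<in> level n" for \<rho>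
  proof -
    let ?Q = "\<Prod>\<rho>'\<in>level n - {\<rho>}. \<rho>' - of_int c"
    have "(\<rho> - of_int c) * ?Q = of_int (disc n)"
      using \<rho> by (simp add: prod_level_disc[symmetric] prod.remove[of "level n" \<rho>])
    moreover have "disc n \<noteq> 0" using \<open>\<not> int p dvd disc n\<close> by auto
    ultimately have "(\<rho> - of_int c) * (?Q * inverse (of_int (disc n))) = 1"
      by (metis (no_types, lifting) mult.assoc of_int_eq_0_iff right_inverse)
    hence "inverse (\<rho> - of_int c) = ?Q * inverse (of_int (disc n))" by (rule inverse_unique)
    moreover have "?Q \<in> A" using inA by (intro order_prod[OF A(1)]) auto
    ultimately show ?thesis using order_mult[OF A(1)] unit by simp
  qed
  hence "b ^ 2 \<in> A \<and> inverse (b ^ 2) \<in> A \<and> b \<noteq> 0" if "b \<in> set bs" for b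
    using that bs inA half_nz by (auto simp: half_square)
  then obtain B where B: "unramified_order p B (K (Suc n))" "A \<subseteq> B" "set bs \<subseteq> B"
    using unramified_order_adjoin_list[OF A(1), of bs] K_Suc[OF bs] by auto
  have "level (Suc n) \<subseteq> B" unfolding level_Suc using B(3) bs order_uminus[OF B(1)] by auto
  thus ?case using B A(3) by (intro exI[of _ B]) auto
qed

text \<open>
  Otherwise \<open>y\<^sup>2\<close> is exactly divisible by \<open>p\<close> in an order that is unramified at \<open>p\<close>: then \<open>y / p\<close> is
  integral, and so is its square \<open>d / p\<^sup>2\<close>, which has a denominator \<open>p\<close>.
\<close>

lemma ramified_prime_divides_orbit:
  assumes sf: "squarefree d" and y: "y \<in> K n" "y ^ 2 = of_int d"
    and p: "prime p" "odd p" "int p dvd d"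
  shows "\<exists>m. 1 \<le> m \<and> m \<le> n \<and> int p dvd crit m"
proof (rule ccontr)
  assume "\<not> ?thesis"
  hence "\<And>m. 1 \<le> m \<Longrightarrow> m \<le> n \<Longrightarrow> \<not> int p dvd crit m" by blast
  then obtain A where A: "unramified_order p A (K n)" "\<And>a b. \<not> int p dvd b \<Longrightarrow> of_int a / of_int b \<in> A"
    using unramified_order_K[OF p(1,2)] by metis
  obtain u where u: "d = int p * u" using p(3) by (elim dvdE)
  have pu: "\<not> int p dvd u"
  proof
    assume "int p dvd u"
    hence "int p ^ 2 dvd d" using u by (auto simp: power2_eq_square)
    hence "int p dvd 1" by (rule squarefreeD[OF sf])
    thus False using prime_gt_1_nat[OF p(1)] by auto
  qed
  let ?p = "of_nat p :: rat alg_closure"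
  have p0: "?p \<noteq> 0" using p(1) prime_gt_0_nat by simp
  have "y ^ 2 / ?p = of_int u" using y(2) u p0 by simp
  also have "\<dots> \<in> A" by (rule order_of_int[OF A(1)])
  finally have "y / ?p \<in> A" by (rule order_sqrt_p[OF A(1) y(1)])
  hence "(y / ?p) * (y / ?p) \<in> A" by (intro order_mult[OF A(1)])
  moreover have "(y / ?p) * (y / ?p) = of_int u / ?p" using y(2) u p0 by (simp add: power2_eq_square field_simps)
  moreover have "of_int 1 / of_int u \<in> A" by (rule A(2)[OF pu])
  ultimately have "(of_int u / ?p) * (of_int 1 / of_int u) \<in> A" using order_mult[OF A(1)] by metis
  moreover have "(of_int u :: rat alg_closure) \<noteq> 0" using pu by auto
  ultimately have "inverse ?p \<in> A" by (simp add: inverse_eq_divide)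
  thus False using order_inverse_p[OF A(1)] by simp
qed

end

section \<open>The tree automorphism group and the image of Galois\<close>

lemma (in group) card_rcosets_eq_2:
  assumes H: "subgroup H G" and x0: "x0 \<in> carrier G" "x0 \<notin> H"
    and quot: "\<And>x y. x \<in> carrier G \<Longrightarrow> x \<notin> H \<Longrightarrow> y \<in> carrier G \<Longrightarrow> y \<notin> H \<Longrightarrow> x \<otimes> inv y \<in> H"
  shows "card (rcosets H) = 2"
proof -
  have coset: "H #> a = (if a \<in> H then H else H #> x0)" if a: "a \<in> carrier G" for a
  proof (cases "a \<in> H")
    case True thus ?thesis using coset_join2[OF a H] by simp
  next
    case False
    have "a = (a \<otimes> inv x0) \<otimes> x0" using a x0 by (simp add: m_assoc)
    hence "a \<in> H #> x0" unfolding r_coset_def using quot[OF a False x0] by blast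
    thus ?thesis using repr_independence[OF _ x0(1) H] False by simp
  qed
  have "x0 \<in> H #> x0" using rcos_self[OF x0(1) H] .
  hence ne: "H #> x0 \<noteq> H" using x0 by blast
  have "rcosets H = {H, H #> x0}"
  proof
    show "rcosets H \<subseteq> {H, H #> x0}"
    proof
      fix C assume "C \<in> rcosets H"
      then obtain a where "a \<in> carrier G" "C = H #> a" unfolding RCOSETS_def by blast
      thus "C \<in> {H, H #> x0}" using coset[of a] by (simp split: if_splits)
    qed
    have "H = H #> \<one>" using coset_join2[OF one_closed H] subgroup.one_closed[OF H] by simp
    hence "H \<in> rcosets H" unfolding RCOSETS_def using one_closed by blast
    thus "{H, H #> x0} \<subseteq> rcosets H" unfolding RCOSETS_def using x0(1) by blast
  qed
  thus ?thesis using ne by simp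
qed

context quadratic
begin

abbreviation tree :: "rat alg_closure set" where "tree \<equiv> preimage_tree f"

lemma mem_tree: "z \<in> tree \<longleftrightarrow> (\<exists>n. z \<in> level n)"
  by (simp add: preimage_tree_def root_set_iterate)

lemma tree_edge_iff: "tree_edge f \<alpha> \<beta> \<longleftrightarrow> F \<alpha> = \<beta> \<or> F \<beta> = \<alpha>"
  by (simp add: tree_edge_def poly_f)

text \<open>
  An edge between \<open>z\<close> and \<open>F z\<close> goes to an edge, whose direction could only be reversed if \<open>\<sigma>\<close>
  identified \<open>z\<close> with \<open>F (F z)\<close> or sent \<open>z\<close> below the root; so levels are preserved from the root upwards.
\<close>

lemma tree_aut_imp_tree_map:
  assumes bij: "bij_betw \<sigma> tree tree" and zero: "\<sigma> 0 = 0"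
    and edge: "\<And>\<alpha> \<beta>. \<alpha> \<in> tree \<Longrightarrow> \<beta> \<in> tree \<Longrightarrow> tree_edge f (\<sigma> \<alpha>) (\<sigma> \<beta>) \<longleftrightarrow> tree_edge f \<alpha> \<beta>"
  shows "tree_map n \<sigma>"
proof -
  have inj: "inj_on \<sigma> tree" and img: "\<And>z. z \<in> tree \<Longrightarrow> \<sigma> z \<in> tree"
    using bij by (auto simp: bij_betw_def)
  have main: "\<forall>z\<in>level k. \<sigma> z \<in> level k \<and> (k > 0 \<longrightarrow> F (\<sigma> z) = \<sigma> (F z))" for k
  proof (induction k)
    case 0 thus ?case by (simp add: zero)
  next
    case (Suc k)
    show ?case
    proof
      fix z assume z: "z \<in> level (Suc k)"
      have Fz: "F z \<in> level k" using z by (simp add: mem_level_Suc)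
      have zT: "z \<in> tree" "F z \<in> tree" using z Fz mem_tree by auto
      have "tree_edge f (\<sigma> z) (\<sigma> (F z))" using edge[OF zT] by (simp add: tree_edge_iff)
      hence "F (\<sigma> z) = \<sigma> (F z) \<or> F (\<sigma> (F z)) = \<sigma> z" by (simp add: tree_edge_iff)
      moreover have "F (\<sigma> (F z)) \<noteq> \<sigma> z"
      proof
        assume eq: "F (\<sigma> (F z)) = \<sigma> z"
        show False
        proof (cases k)
          case 0
          obtain m where "\<sigma> z \<in> level m" using img[OF zT(1)] mem_tree by blast
          hence "0 \<in> level (Suc m)" using eq 0 Fz zero by (simp add: mem_level_Suc)
          thus False using level_Suc_nz by blast
        next
          case (Suc j)
          have "F (F z) \<in> level j" using Fz Suc by (simp add: mem_level_Suc)
          moreover have "\<sigma> (F (F z)) = \<sigma> z" using Suc.IH Fz Suc eq by simp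
          ultimately have "F (F z) = z" using inj zT mem_tree by (metis inj_onD)
          thus False using level_disjoint[OF z, of j] \<open>F (F z) \<in> level j\<close> Suc by simp
        qed
      qed
      ultimately have "F (\<sigma> z) = \<sigma> (F z)" by blast
      moreover have "\<sigma> (F z) \<in> level k" using Suc.IH Fz by blast
      ultimately show "\<sigma> z \<in> level (Suc k) \<and> (Suc k > 0 \<longrightarrow> F (\<sigma> z) = \<sigma> (F z))"
        by (simp add: mem_level_Suc)
    qed
  qed
  have "bij_betw \<sigma> (level k) (level k)" for k
  proof -
    have "inj_on \<sigma> (level k)" using inj mem_tree by (meson inj_on_subset subsetI)
    moreover from this have "\<sigma> ` level k = level k"
      using main[of k] by (intro endo_inj_surj) auto
    ultimately show ?thesis by (simp add: bij_betw_def)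
  qed
  thus ?thesis using main unfolding tree_map_def by blast
qed

lemma tree_map_imp_tree_aut:
  assumes tm: "\<And>n. tree_map n \<sigma>"
  shows "bij_betw \<sigma> tree tree" and "\<sigma> 0 = 0"
    and "\<alpha> \<in> tree \<Longrightarrow> \<beta> \<in> tree \<Longrightarrow> tree_edge f (\<sigma> \<alpha>) (\<sigma> \<beta>) \<longleftrightarrow> tree_edge f \<alpha> \<beta>"
proof -
  note img = tree_map_image[OF tm le_refl] and inj = tree_map_inj[OF tm le_refl]
  have lev: "\<sigma> z \<in> level n \<longleftrightarrow> z \<in> level n" if z: "z \<in> tree" for z n
  proof -
    obtain m where m: "z \<in> level m" using z mem_tree by blast
    hence "\<sigma> z \<in> level m" using img by blast
    thus ?thesis using m level_disjoint by blast
  qed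
  have inj': "z = w" if zw: "z \<in> tree" "w \<in> tree" "\<sigma> z = \<sigma> w" for z w
  proof -
    obtain m where m: "z \<in> level m" using zw(1) mem_tree by blast
    hence "w \<in> level m" using lev zw by metis
    thus ?thesis using inj[of m] m zw(3) by (auto dest: inj_onD)
  qed
  have "\<sigma> ` tree = tree"
  proof -
    have "tree = (\<Union>n. level n)" using mem_tree by auto
    thus ?thesis by (simp add: image_UN img)
  qed
  thus "bij_betw \<sigma> tree tree" using inj' by (auto simp: bij_betw_def inj_on_def)
  show "\<sigma> 0 = 0" using img[of 0] by simp
  have down: "F (\<sigma> \<alpha>) = \<sigma> \<beta> \<longleftrightarrow> F \<alpha> = \<beta>" if ab: "\<alpha> \<in> tree" "\<beta> \<in> tree" for \<alpha> \<beta>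
  proof -
    obtain n where n: "\<beta> \<in> level n" using ab mem_tree by blast
    show ?thesis
    proof
      assume "F \<alpha> = \<beta>"
      hence "\<alpha> \<in> level (Suc n)" using n by (simp add: mem_level_Suc)
      thus "F (\<sigma> \<alpha>) = \<sigma> \<beta>" using tree_map_F[OF tm lessI] \<open>F \<alpha> = \<beta>\<close> by blast
    next
      assume eq: "F (\<sigma> \<alpha>) = \<sigma> \<beta>"
      have "\<sigma> \<beta> \<in> level n" using n lev ab by blast
      hence "\<sigma> \<alpha> \<in> level (Suc n)" using eq by (simp add: mem_level_Suc)
      hence a: "\<alpha> \<in> level (Suc n)" using lev ab by blast
      hence "F \<alpha> \<in> tree" using mem_tree mem_level_Suc by blast
      moreover have "\<sigma> (F \<alpha>) = \<sigma> \<beta>" using tree_map_F[OF tm lessI a] eq by simp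
      ultimately show "F \<alpha> = \<beta>" using inj' ab by blast
    qed
  qed
  show "tree_edge f (\<sigma> \<alpha>) (\<sigma> \<beta>) \<longleftrightarrow> tree_edge f \<alpha> \<beta>" if "\<alpha> \<in> tree" "\<beta> \<in> tree"
    using down[OF that] down[OF that(2,1)] by (simp add: tree_edge_iff)
qed

lemma carrier_tree_aut: "\<sigma> \<in> carrier (tree_aut f) \<longleftrightarrow> \<sigma> \<in> extensional tree \<and> (\<forall>n. tree_map n \<sigma>)"
  using tree_aut_imp_tree_map[of \<sigma>] tree_map_imp_tree_aut[of \<sigma>]
  by (auto simp: tree_aut_def Bij_def)

lemma tree_aut_mult:
  "\<sigma> \<in> carrier (tree_aut f) \<Longrightarrow> \<tau> \<in> carrier (tree_aut f) \<Longrightarrow> \<sigma> \<otimes>\<^bsub>tree_aut f\<^esub> \<tau> = compose tree \<sigma> \<tau>"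
  by (simp add: tree_aut_def BijGroup_def)

lemma tree_aut_one: "\<one>\<^bsub>tree_aut f\<^esub> = (\<lambda>x\<in>tree. x)"
  by (simp add: tree_aut_def BijGroup_def)

lemma group_tree_aut: "group (tree_aut f)"
proof -
  let ?A = "{\<sigma> \<in> Bij tree. \<sigma> 0 = 0 \<and>
      (\<forall>\<alpha>\<in>tree. \<forall>\<beta>\<in>tree. tree_edge f (\<sigma> \<alpha>) (\<sigma> \<beta>) \<longleftrightarrow> tree_edge f \<alpha> \<beta>)}"
  have 0: "0 \<in> tree" using mem_tree[of 0] level_0 by blast
  have "subgroup ?A (BijGroup tree)"
  proof (rule group.subgroupI[OF group_BijGroup])
    show "?A \<subseteq> carrier (BijGroup tree)" by (auto simp: BijGroup_def)
    have "(\<lambda>x\<in>tree. x) \<in> ?A" using id_Bij 0 by simp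
    thus "?A \<noteq> {}" by blast
  next
    fix \<sigma> assume s: "\<sigma> \<in> ?A"
    hence sB: "\<sigma> \<in> Bij tree" by simp
    let ?i = "restrict (inv_into tree \<sigma>) tree"
    have im: "\<sigma> ` tree = tree" "inj_on \<sigma> tree" using sB by (auto simp: Bij_def bij_betw_def)
    have r: "\<sigma> (?i z) = z" "?i z \<in> tree" if "z \<in> tree" for z
      using that im by (auto simp: f_inv_into_f inv_into_into)
    have "?i 0 = 0" using 0 s im by (simp add: inv_into_f_eq)
    moreover have "tree_edge f (?i \<alpha>) (?i \<beta>) \<longleftrightarrow> tree_edge f \<alpha> \<beta>" if ab: "\<alpha> \<in> tree" "\<beta> \<in> tree" for \<alpha> \<beta>
    proof -
      have "tree_edge f (\<sigma> (?i \<alpha>)) (\<sigma> (?i \<beta>)) \<longleftrightarrow> tree_edge f (?i \<alpha>) (?i \<beta>)" using s r(2) ab by blast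
      thus ?thesis using r(1) ab by simp
    qed
    ultimately have "?i \<in> ?A" using restrict_inv_into_Bij[OF sB] by blast
    thus "inv\<^bsub>BijGroup tree\<^esub> \<sigma> \<in> ?A" by (simp only: inv_BijGroup[OF sB])
  next
    fix \<sigma> \<tau> assume st: "\<sigma> \<in> ?A" "\<tau> \<in> ?A"
    hence B: "\<sigma> \<in> Bij tree" "\<tau> \<in> Bij tree" by auto
    have im: "\<tau> z \<in> tree" if "z \<in> tree" for z using Bij_imp_funcset[OF B(2)] that by blast
    have "compose tree \<sigma> \<tau> \<in> ?A" using compose_Bij[OF B] st im 0 by (simp add: compose_def)
    thus "\<sigma> \<otimes>\<^bsub>BijGroup tree\<^esub> \<tau> \<in> ?A" using B by (simp add: BijGroup_def)
  qed
  thus ?thesis unfolding tree_aut_def by (rule subgroup.subgroup_is_group[OF _ group_BijGroup])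
qed

text \<open>
  The image of \<open>G_inf f\<close> without inverse limits: the automorphisms that are Galois on every single
  level. The automorphisms of the \<open>K n\<close> found level by level are compatible because each is
  determined by its values on level \<open>n\<close> (\<open>tree_action_image\<close>).
\<close>

definition galois_image :: "(rat alg_closure \<Rightarrow> rat alg_closure) set" where
  "galois_image = {\<tau> \<in> carrier (tree_aut f). \<forall>n. \<exists>\<sigma>. field_hom (K n) \<sigma> \<and> (\<forall>z\<in>level n. \<sigma> z = \<tau> z)}"

lemma G_fin_field_hom: "s \<in> carrier (G_fin f n) \<Longrightarrow> field_hom (K n) s"
  by (auto simp: G_fin_def galois_group_def K_def[symmetric] ring_iso_def ring_hom_def field_hom_def
      ring_of_type_algebra_def)

lemma field_hom_G_fin:
  assumes "field_hom (K n) \<sigma>" shows "restrict \<sigma> (K n) \<in> carrier (G_fin f n)"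
proof -
  have bij: "bij_betw (restrict \<sigma> (K n)) (K n) (K n)"
    using hom_K[OF assms] field_hom_inj_on[OF is_subfield_K assms] by (simp add: bij_betw_def inj_on_def)
  have mem: "\<sigma> x \<in> K n" if "x \<in> K n" for x using hom_K[OF assms] that by blast
  show ?thesis
    using assms bij mem is_subfield_K[of n] prime_field_fixed[OF assms] to_ac_in_K
    by (auto simp: G_fin_def galois_group_def K_def[symmetric] ring_iso_def ring_hom_def field_hom_def
      ring_of_type_algebra_def Bij_def is_subfield_intros)
qed

lemma carrier_G_inf:
  "s \<in> carrier (G_inf f) \<longleftrightarrow> (\<forall>n. s n \<in> carrier (G_fin f n)) \<and>
    (\<forall>m n. m \<le> n \<longrightarrow> restrict (s n) (K m) = s m)"
  by (auto simp: G_inf_def K_def PiE_iff)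

lemma tree_action_level:
  assumes "z \<in> level n" shows "tree_action f s z = s n z"
proof -
  have "(LEAST m. z \<in> level m) = n"
    using assms level_disjoint by (intro Least_equality) auto
  moreover have "z \<in> tree" using assms mem_tree by blast
  ultimately show ?thesis by (simp add: tree_action_def root_set_iterate)
qed

text \<open>
  Every vertex of level \<open>m\<close> is an image of a vertex of level \<open>n\<close> under an iterate of \<open>F\<close>.
\<close>

lemma agree_lower_level:
  assumes "tree_map n \<sigma>" "tree_map n \<tau>" "\<And>z. z \<in> level n \<Longrightarrow> \<sigma> z = \<tau> z" "m \<le> n" "z \<in> level m"
  shows "\<sigma> z = \<tau> z"
  using assms(4,5)
proof (induction m arbitrary: z rule: inc_induct)
  case base thus ?case using assms(3) by blast
next
  case (step m)
  have h: "half z \<in> level (Suc m)" using half_in_level step.prems by blast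
  have "\<sigma> (F (half z)) = \<tau> (F (half z))"
    using tree_map_F[OF assms(1) step.hyps(2) h] tree_map_F[OF assms(2) step.hyps(2) h] step.IH[OF h] by simp
  thus ?case by simp
qed

lemma tree_action_image: "tree_action f ` carrier (G_inf f) = galois_image"
proof
  show "tree_action f ` carrier (G_inf f) \<subseteq> galois_image"
  proof
    fix \<tau> assume "\<tau> \<in> tree_action f ` carrier (G_inf f)"
    then obtain s where s: "s \<in> carrier (G_inf f)" and \<tau>: "\<tau> = tree_action f s" by blast
    have hom: "field_hom (K n) (s n)" for n using s carrier_G_inf G_fin_field_hom by blast
    have restr: "restrict (s n) (K m) = s m" if "m \<le> n" for m n using s carrier_G_inf that by blast
    have val: "\<tau> z = s n z" if "z \<in> level n" for z n using \<tau> tree_action_level[OF that] by simp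
    have "tree_map n \<tau>" for n unfolding tree_map_def
    proof (intro conjI allI impI ballI)
      fix k
      show "bij_betw \<tau> (level k) (level k)"
        using tree_map_hom[OF hom[of k]] bij_betw_cong[of "level k" \<tau> "s k"] val
        by (auto simp: tree_map_def)
      fix w assume w: "w \<in> level (Suc k)"
      have Fw: "F w \<in> level k" using w by (simp add: mem_level_Suc)
      have "F (\<tau> w) = s (Suc k) (F w)" using tree_map_F[OF tree_map_hom[OF hom] lessI w] val[OF w] by simp
      also have "\<dots> = s k (F w)" using restr[of k "Suc k"] Fw level_subset_K
        by (metis le_SucI le_refl restrict_apply' subsetD)
      finally show "F (\<tau> w) = \<tau> (F w)" using val[OF Fw] by simp
    qed
    moreover have "\<tau> \<in> extensional tree" by (simp add: \<tau> tree_action_def)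
    ultimately have "\<tau> \<in> carrier (tree_aut f)" using carrier_tree_aut by blast
    thus "\<tau> \<in> galois_image" unfolding galois_image_def using hom val by fastforce
  qed
  show "galois_image \<subseteq> tree_action f ` carrier (G_inf f)"
  proof
    fix \<tau> assume "\<tau> \<in> galois_image"
    hence \<tau>: "\<tau> \<in> extensional tree" "\<And>n. tree_map n \<tau>"
      and "\<forall>n. \<exists>\<sigma>. field_hom (K n) \<sigma> \<and> (\<forall>z\<in>level n. \<sigma> z = \<tau> z)"
      using carrier_tree_aut by (auto simp: galois_image_def)
    then obtain \<sigma> where \<sigma>: "\<And>n. field_hom (K n) (\<sigma> n)" "\<And>n z. z \<in> level n \<Longrightarrow> \<sigma> n z = \<tau> z" by metis
    define s where "s n = restrict (\<sigma> n) (K n)" for n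
    have "restrict (s n) (K m) = s m" if mn: "m \<le> n" for m n
    proof -
      have "\<sigma> n x = \<sigma> m x" if x: "x \<in> K m" for x
      proof (rule hom_eqI[OF _ \<sigma>(1) _ x])
        show "field_hom (K m) (\<sigma> n)" using field_hom_subset[OF \<sigma>(1) K_mono[OF mn]] .
        show "\<sigma> n z = \<sigma> m z" if "z \<in> level m" for z
          using agree_lower_level[OF tree_map_hom[OF \<sigma>(1)] \<tau>(2) \<sigma>(2) mn that] \<sigma>(2)[OF that] by simp
      qed
      thus ?thesis using K_mono[OF mn] by (auto simp: s_def restrict_def fun_eq_iff)
    qed
    hence s: "s \<in> carrier (G_inf f)" using carrier_G_inf field_hom_G_fin[OF \<sigma>(1)] by (simp add: s_def)
    have "tree_action f s = \<tau>"
    proof (rule extensionalityI[OF _ \<tau>(1)])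
      show "tree_action f s \<in> extensional tree" by (simp add: tree_action_def)
      fix z assume "z \<in> tree"
      then obtain n where n: "z \<in> level n" using mem_tree by blast
      thus "tree_action f s z = \<tau> z" using tree_action_level[OF n] \<sigma>(2)[OF n] level_subset_K
        by (auto simp: s_def)
    qed
    thus "\<tau> \<in> tree_action f ` carrier (G_inf f)" using s by blast
  qed
qed

lemma field_hom_inv:
  assumes \<sigma>: "field_hom (K n) \<sigma>" shows "field_hom (K n) (inv_into (K n) \<sigma>)"
proof -
  let ?i = "inv_into (K n) \<sigma>"
  have inj: "inj_on \<sigma> (K n)" by (rule field_hom_inj_on[OF is_subfield_K \<sigma>])
  have r: "?i x \<in> K n" "\<sigma> (?i x) = x" if "x \<in> K n" for x
    using hom_K[OF \<sigma>] that by (metis inv_into_into, metis f_inv_into_f)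
  have inv: "?i (\<sigma> x) = x" if "x \<in> K n" for x using inj that by (rule inv_into_f_f)
  show ?thesis unfolding field_hom_def
  proof (intro conjI ballI)
    show "?i 1 = 1" using inv[OF is_subfield_one[OF is_subfield_K]] field_hom_one[OF \<sigma>] by simp
    fix x y assume xy: "x \<in> K n" "y \<in> K n"
    show "?i (x + y) = ?i x + ?i y"
      using inv[of "?i x + ?i y"] r xy field_hom_add[OF \<sigma>] is_subfield_add[OF is_subfield_K] by simp
    show "?i (x * y) = ?i x * ?i y"
      using inv[of "?i x * ?i y"] r xy field_hom_mult[OF \<sigma>] is_subfield_mult[OF is_subfield_K] by simp
  qed
qed

lemma subgroup_galois_image: "subgroup galois_image (tree_aut f)"
proof (rule group.subgroupI[OF group_tree_aut])
  show "galois_image \<subseteq> carrier (tree_aut f)" by (auto simp: galois_image_def)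
  interpret G: group "tree_aut f" by (rule group_tree_aut)
  have "\<one>\<^bsub>tree_aut f\<^esub> \<in> galois_image" unfolding galois_image_def
  proof (intro CollectI conjI allI G.one_closed)
    fix n show "\<exists>\<sigma>. field_hom (K n) \<sigma> \<and> (\<forall>z\<in>level n. \<sigma> z = \<one>\<^bsub>tree_aut f\<^esub> z)"
      using field_hom_id[of "K n"] mem_tree by (auto simp: tree_aut_one intro!: exI[of _ "\<lambda>x. x"])
  qed
  thus "galois_image \<noteq> {}" by blast
next
  interpret G: group "tree_aut f" by (rule group_tree_aut)
  fix \<tau> assume t: "\<tau> \<in> galois_image"
  hence \<tau>: "\<tau> \<in> carrier (tree_aut f)" by (simp add: galois_image_def)
  have "compose tree (inv\<^bsub>tree_aut f\<^esub> \<tau>) \<tau> = \<one>\<^bsub>tree_aut f\<^esub>"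
    using G.l_inv[OF \<tau>] tree_aut_mult[OF G.inv_closed[OF \<tau>] \<tau>] by simp
  hence inv: "(inv\<^bsub>tree_aut f\<^esub> \<tau>) (\<tau> z) = z" if "z \<in> tree" for z
    using that compose_eq[OF that, of "inv\<^bsub>tree_aut f\<^esub> \<tau>" \<tau>] by (simp add: tree_aut_one)
  show "inv\<^bsub>tree_aut f\<^esub> \<tau> \<in> galois_image" unfolding galois_image_def
  proof (intro CollectI conjI allI G.inv_closed[OF \<tau>])
    fix n
    obtain \<sigma> where \<sigma>: "field_hom (K n) \<sigma>" "\<forall>z\<in>level n. \<sigma> z = \<tau> z" using t by (auto simp: galois_image_def)
    have "inv_into (K n) \<sigma> z = (inv\<^bsub>tree_aut f\<^esub> \<tau>) z" if z: "z \<in> level n" for z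
    proof -
      obtain w where w: "w \<in> level n" "z = \<sigma> w" using hom_level[OF \<sigma>(1) le_refl] z by blast
      have "inv_into (K n) \<sigma> z = w"
        using w level_subset_K field_hom_inj_on[OF is_subfield_K \<sigma>(1)] by (auto intro: inv_into_f_f)
      moreover have "z = \<tau> w" using w \<sigma>(2) by simp
      ultimately show ?thesis using inv[of w] w mem_tree by metis
    qed
    thus "\<exists>\<sigma>. field_hom (K n) \<sigma> \<and> (\<forall>z\<in>level n. \<sigma> z = (inv\<^bsub>tree_aut f\<^esub> \<tau>) z)"
      using field_hom_inv[OF \<sigma>(1)] by blast
  qed
next
  interpret G: group "tree_aut f" by (rule group_tree_aut)
  fix \<tau> \<tau>' assume t: "\<tau> \<in> galois_image" "\<tau>' \<in> galois_image"
  hence \<tau>: "\<tau> \<in> carrier (tree_aut f)" "\<tau>' \<in> carrier (tree_aut f)" by (auto simp: galois_image_def)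
  show "\<tau> \<otimes>\<^bsub>tree_aut f\<^esub> \<tau>' \<in> galois_image" unfolding galois_image_def
  proof (intro CollectI conjI allI G.m_closed \<tau>)
    fix n
    obtain \<sigma> where \<sigma>1: "field_hom (K n) \<sigma>" "\<forall>z\<in>level n. \<sigma> z = \<tau> z"
      using t(1) by (auto simp: galois_image_def)
    obtain \<sigma>' where \<sigma>2: "field_hom (K n) \<sigma>'" "\<forall>z\<in>level n. \<sigma>' z = \<tau>' z"
      using t(2) by (auto simp: galois_image_def)
    note \<sigma> = \<sigma>1 \<sigma>2
    have "\<sigma> (\<sigma>' z) = (\<tau> \<otimes>\<^bsub>tree_aut f\<^esub> \<tau>') z" if z: "z \<in> level n" for z
    proof -
      have "\<sigma>' z \<in> level n" using hom_level[OF \<sigma>(3) le_refl] z by blast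
      moreover have "z \<in> tree" using z mem_tree by blast
      ultimately show ?thesis using \<sigma> z by (simp add: tree_aut_mult[OF \<tau>] compose_eq)
    qed
    thus "\<exists>\<sigma>. field_hom (K n) \<sigma> \<and> (\<forall>z\<in>level n. \<sigma> z = (\<tau> \<otimes>\<^bsub>tree_aut f\<^esub> \<tau>') z)"
      using hom_compose[OF \<sigma>(3,1)] by blast
  qed
qed

lemma G_inf_cosets_eq: "G_inf_cosets f = rcosets\<^bsub>tree_aut f\<^esub> galois_image"
  by (simp add: G_inf_cosets_def tree_action_image)

text \<open>
  Above level \<open>N\<close> every prescription of signs is realised, so the automorphism is followed one level
  at a time.
\<close>

lemma galois_image_from_level:
  assumes max: "\<And>n. n \<ge> N \<Longrightarrow> maximal_step n" and \<tau>: "\<tau> \<in> carrier (tree_aut f)"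
    and low: "\<And>n. n \<le> N \<Longrightarrow> \<exists>\<sigma>. field_hom (K n) \<sigma> \<and> (\<forall>z\<in>level n. \<sigma> z = \<tau> z)"
  shows "\<tau> \<in> galois_image"
proof -
  have "\<exists>\<sigma>. field_hom (K n) \<sigma> \<and> (\<forall>z\<in>level n. \<sigma> z = \<tau> z)" for n
  proof (cases "n \<le> N")
    case True thus ?thesis using low by blast
  next
    case False
    hence "n \<ge> N" by simp
    thus ?thesis
    proof (induction n rule: dec_induct)
      case base show ?case using low by blast
    next
      case (step n)
      then obtain \<sigma> where \<sigma>: "field_hom (K n) \<sigma>" "\<forall>z\<in>level n. \<sigma> z = \<tau> z" by blast
      have "tree_map (Suc n) \<tau>" using \<tau> carrier_tree_aut by blast
      thus ?case using hom_extends_maximal[OF max[OF step.hyps(1)] \<sigma>(1)] \<sigma>(2) by blast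
    qed
  qed
  thus ?thesis using \<tau> by (simp add: galois_image_def)
qed

text \<open>
  Two automorphisms with the same restriction to the levels up to \<open>N\<close> differ by one that is trivial
  there, and hence lies in the image of Galois. There are finitely many restrictions.
\<close>

theorem finite_cosets_if_eventually_maximal:
  assumes max: "\<And>n. n \<ge> N \<Longrightarrow> maximal_step n"
  shows "finite (G_inf_cosets f)"
proof -
  interpret G: group "tree_aut f" by (rule group_tree_aut)
  let ?L = "\<Union>k\<le>N. level k"
  let ?r = "\<lambda>\<tau>. restrict \<tau> ?L"
  have fin: "finite (?r ` carrier (tree_aut f))"
  proof (rule finite_subset)
    show "?r ` carrier (tree_aut f) \<subseteq> PiE ?L (\<lambda>_. ?L)"
    proof
      fix g assume "g \<in> ?r ` carrier (tree_aut f)"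
      then obtain \<tau> where \<tau>: "\<tau> \<in> carrier (tree_aut f)" "g = ?r \<tau>" by blast
      have "\<tau> z \<in> level k" if "z \<in> level k" for z k
        using \<tau>(1) carrier_tree_aut tree_map_image[of k \<tau> k] that by blast
      thus "g \<in> PiE ?L (\<lambda>_. ?L)" using \<tau>(2) by auto
    qed
  qed (intro finite_PiE, auto)
  have key: "galois_image #>\<^bsub>tree_aut f\<^esub> \<tau> = galois_image #>\<^bsub>tree_aut f\<^esub> \<tau>'"
    if t: "\<tau> \<in> carrier (tree_aut f)" "\<tau>' \<in> carrier (tree_aut f)" "?r \<tau> = ?r \<tau>'" for \<tau> \<tau>'
  proof -
    define g where "g = \<tau>' \<otimes>\<^bsub>tree_aut f\<^esub> inv\<^bsub>tree_aut f\<^esub> \<tau>"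
    have g: "g \<in> carrier (tree_aut f)" using t by (simp add: g_def)
    have gt: "g \<otimes>\<^bsub>tree_aut f\<^esub> \<tau> = \<tau>'" using t by (simp add: g_def G.m_assoc)
    have "g w = w" if w: "w \<in> level k" "k \<le> N" for w k
    proof -
      obtain z where z: "z \<in> level k" "w = \<tau> z"
        using t(1) carrier_tree_aut tree_map_image[of k \<tau> k] w(1) by blast
      have "z \<in> tree" using z mem_tree by blast
      hence "g (\<tau> z) = \<tau>' z" using gt tree_aut_mult[OF g t(1)] by (metis compose_eq)
      moreover have "\<tau>' z = \<tau> z" using t(3) z(1) w(2) by (metis UN_I atMost_iff restrict_apply')
      ultimately show ?thesis using z by simp
    qed
    hence "\<exists>\<sigma>. field_hom (K n) \<sigma> \<and> (\<forall>z\<in>level n. \<sigma> z = g z)" if "n \<le> N" for n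
      using that field_hom_id[of "K n"] by (intro exI[of _ "\<lambda>x. x"]) auto
    hence "g \<in> galois_image" using galois_image_from_level[of N g] max g by blast
    hence "\<tau>' \<in> galois_image #>\<^bsub>tree_aut f\<^esub> \<tau>" using gt unfolding r_coset_def by blast
    thus ?thesis using G.repr_independence[OF _ t(1) subgroup_galois_image] by simp
  qed
  define pick where "pick g = galois_image #>\<^bsub>tree_aut f\<^esub> (SOME \<tau>. \<tau> \<in> carrier (tree_aut f) \<and> ?r \<tau> = g)" for g
  have "G_inf_cosets f \<subseteq> pick ` ?r ` carrier (tree_aut f)"
  proof
    fix C assume "C \<in> G_inf_cosets f"
    then obtain \<tau> where \<tau>: "\<tau> \<in> carrier (tree_aut f)" "C = galois_image #>\<^bsub>tree_aut f\<^esub> \<tau>"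
      unfolding G_inf_cosets_eq RCOSETS_def by blast
    let ?t = "SOME \<tau>'. \<tau>' \<in> carrier (tree_aut f) \<and> ?r \<tau>' = ?r \<tau>"
    have "?t \<in> carrier (tree_aut f) \<and> ?r ?t = ?r \<tau>" by (rule someI[of _ \<tau>]) (use \<tau> in simp)
    hence "C = pick (?r \<tau>)" using key[of \<tau> ?t] \<tau> by (simp add: pick_def)
    thus "C \<in> pick ` ?r ` carrier (tree_aut f)" using \<tau>(1) by blast
  qed
  thus ?thesis using fin finite_subset by blast
qed

end

section \<open>Prime divisors of the critical orbit\<close>

lemma squarefree_dvd_if_primes_dvd:
  fixes d W :: int
  assumes "squarefree d" "W \<noteq> 0" "\<And>p. prime p \<Longrightarrow> p dvd d \<Longrightarrow> p dvd W"
  shows "d dvd W"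
proof (rule multiplicity_le_imp_dvd)
  show "d \<noteq> 0" using assms(1) by auto
  fix p :: int assume p: "prime p"
  show "multiplicity p d \<le> multiplicity p W"
  proof (cases "p dvd d")
    case True
    have "\<not> p ^ 2 dvd d"
      using assms(1) p squarefreeD not_prime_unit by blast
    hence "multiplicity p d < 2" using p \<open>d \<noteq> 0\<close>
      by (metis linorder_not_less multiplicity_dvd')
    moreover have "multiplicity p W \<ge> 1"
      using multiplicity_gt_zero_iff[OF assms(2), of p] assms(3)[OF p True] p not_prime_unit
      by (metis Suc_leI One_nat_def)
    ultimately show ?thesis by linarith
  qed (simp add: not_dvd_imp_multiplicity_0)
qed

context quadratic
begin

lemma crit_shift_dvd: "d dvd crit m \<Longrightarrow> d dvd crit (k + m) - crit k"
proof (induction k)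
  case (Suc k)
  have "crit (Suc k + m) - crit (Suc k) = (crit (k + m) - crit k) * (crit (k + m) + crit k)"
    by (simp add: crit_Suc power2_eq_square algebra_simps)
  thus ?case using Suc by simp
qed simp

lemma crit_mod_dvd: "d dvd crit m \<Longrightarrow> d dvd crit (k + j * m) - crit k"
proof (induction j)
  case (Suc j)
  have "d dvd crit ((k + j * m) + m) - crit (k + j * m)" by (rule crit_shift_dvd[OF Suc.prems])
  hence "d dvd (crit ((k + j * m) + m) - crit (k + j * m)) + (crit (k + j * m) - crit k)"
    using Suc by (intro dvd_add) auto
  thus ?case by (simp add: algebra_simps)
qed simp

text \<open>
  Modulo \<open>p\<close> the orbit of 0 is periodic, and it returns to 0 exactly at the multiples of the least
  such index \<open>r\<close>.
\<close>

lemma crit_rank_divides: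
  assumes "1 \<le> m" "m < N" "p dvd crit m" "p dvd crit N"
  shows "\<exists>r. 1 \<le> r \<and> r < N \<and> r dvd N \<and> p dvd crit r"
proof -
  define r where "r = (LEAST r. 1 \<le> r \<and> p dvd crit r)"
  have r: "1 \<le> r" "p dvd crit r" and min: "\<And>s. 1 \<le> s \<Longrightarrow> p dvd crit s \<Longrightarrow> r \<le> s"
    using LeastI[of "\<lambda>r. 1 \<le> r \<and> p dvd crit r" m] Least_le[of "\<lambda>r. 1 \<le> r \<and> p dvd crit r"] assms
    by (auto simp: r_def)
  have "p dvd crit (N mod r + (N div r) * r) - crit (N mod r)" by (rule crit_mod_dvd[OF r(2)])
  hence "p dvd crit (N mod r)" using assms(4) by (simp add: dvd_diff_right_iff)
  hence "N mod r = 0" using min[of "N mod r"] r(1) by (metis less_one linorder_not_less mod_less_divisor order_less_le_trans zero_less_one)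
  moreover have "r < N" using min[of m] assms by simp
  ultimately show ?thesis using r by (intro exI[of _ r]) auto
qed

text \<open>
  The possible classes of \<open>crit N\<close> modulo squares when step \<open>N - 1\<close> is not maximal: up to the factor 2,
  the class \<open>d\<close> has no prime divisor that is new at \<open>N\<close>.
\<close>

definition imprimitive_class :: "nat \<Rightarrow> int \<Rightarrow> bool" where
  "imprimitive_class N d \<longleftrightarrow> squarefree d \<and> (\<exists>y. crit N = d * y ^ 2) \<and>
     (\<forall>p. prime p \<longrightarrow> odd p \<longrightarrow> int p dvd d \<longrightarrow>
       (\<exists>m. 1 \<le> m \<and> m < N \<and> m dvd N \<and> int p dvd crit m))"

lemma imprimitive_class_prime:
  assumes "imprimitive_class N d" "prime p" "odd p" "int p dvd d"
  obtains m where "1 \<le> m" "m < N" "m dvd N" "int p dvd crit m"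
  using assms unfolding imprimitive_class_def by blast

lemma not_maximal_step_imprimitive_class:
  assumes n: "n \<ge> 1" and nm: "\<not> maximal_step n"
  obtains d where "imprimitive_class (Suc n) d"
proof -
  let ?N = "crit (Suc n)"
  obtain Y where Y: "Y \<in> K n" "Y ^ 2 = of_int ?N" using nm n by (auto simp: maximal_step_def disc_def)
  define d s where "d = squarefree_part ?N" and "s = square_part ?N"
  have N: "?N = d * s ^ 2" unfolding d_def s_def by (rule squarefree_decompose)
  have N0: "?N \<noteq> 0" by (rule crit_nz) simp
  hence s0: "s \<noteq> 0" using N by auto
  have sf: "squarefree d" by (simp add: d_def)
  let ?Y = "Y / of_int s"
  have Y': "?Y \<in> K n" by (intro is_subfield_divide[OF is_subfield_K] Y is_subfield_of_int[OF is_subfield_K])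
  have "?Y ^ 2 = of_int ?N / of_int (s ^ 2)" by (simp add: power_divide Y(2))
  also have "\<dots> = of_int d" using N s0 by simp
  finally have Y'2: "?Y ^ 2 = of_int d" .
  have "\<exists>m. 1 \<le> m \<and> m < Suc n \<and> m dvd Suc n \<and> int p dvd crit m"
    if p: "prime p" "odd p" "int p dvd d" for p
  proof -
    obtain m where "1 \<le> m" "m \<le> n" "int p dvd crit m"
      using ramified_prime_divides_orbit[OF sf Y' Y'2 p] by blast
    moreover have "int p dvd ?N" using p(3) N by simp
    ultimately show ?thesis
      using crit_rank_divides[of m "Suc n" "int p"] by simp
  qed
  thus ?thesis using that sf N unfolding imprimitive_class_def by blast
qed

lemma proper_divisor_le_half: "r dvd N \<Longrightarrow> r < N \<Longrightarrow> r \<le> N div (2::nat)"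
proof -
  assume "r dvd N" "r < N"
  then obtain j where j: "N = r * j" by (elim dvdE)
  hence "j \<ge> 2" using \<open>r < N\<close> by (cases j) (auto simp: Suc_le_eq)
  hence "r * 2 \<le> N" using j by simp
  thus ?thesis by simp
qed

lemma imprimitive_class_bound:
  assumes d: "imprimitive_class N d"
  shows "\<bar>d\<bar> \<le> 2 * (\<Prod>m=1..N div 2. \<bar>crit m\<bar>)"
proof -
  let ?W = "2 * (\<Prod>m=1..N div 2. crit m)"
  have X0: "?W \<noteq> 0" using crit_nz by simp
  have "d dvd ?W"
  proof (rule squarefree_dvd_if_primes_dvd[OF _ X0])
    show "squarefree d" using d by (simp add: imprimitive_class_def)
    fix q :: int assume q: "prime q" "q dvd d"
    then obtain p' where p': "q = int p'" "prime p'"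
      by (metis prime_ge_0_int nonneg_int_cases prime_int_nat_transfer nat_int)
    show "q dvd ?W"
    proof (cases "odd p'")
      case True
      then obtain m where m: "1 \<le> m" "m < N" "m dvd N" "q dvd crit m" using imprimitive_class_prime[OF d p'(2)] p'(1) q by blast
      hence "m \<in> {1..N div 2}" using proper_divisor_le_half by simp
      hence "crit m dvd (\<Prod>m=1..N div 2. crit m)" by (intro dvd_prodI) auto
      thus ?thesis using m(4) by (meson dvd_mult dvd_trans)
    next
      case False
      hence "q = 2" using p' by (metis even_iff_mod_2_eq_zero dvd_refl of_nat_numeral primes_dvd_imp_eq two_is_prime_nat)
      thus ?thesis by simp
    qed
  qed
  hence "\<bar>d\<bar> \<le> \<bar>?W\<bar>" using X0 by (intro dvd_imp_le_int)
  thus ?thesis by (simp add: abs_mult abs_prod)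
qed

section \<open>Consequences of the Hall-Lang conjecture\<close>

text \<open>
  The summand \<open>|c|\<close> makes the induction work: the square of the left-hand side dominates the next one.
\<close>

lemma crit_upper: "m \<ge> 1 \<Longrightarrow> \<bar>crit m\<bar> + \<bar>c\<bar> \<le> (2 * \<bar>c\<bar>) ^ 2 ^ m"
proof (induction m rule: nat_induct_at_least)
  case base
  have "2 * \<bar>c\<bar> \<ge> 1" using c_nz by linarith
  hence "(2 * \<bar>c\<bar>) ^ 1 \<le> (2 * \<bar>c\<bar>) ^ 2" by (intro power_increasing) auto
  thus ?case by (simp add: crit_Suc)
next
  case (Suc m)
  have "\<bar>crit m\<bar> \<ge> 1" using crit_nz[OF Suc.hyps] by linarith
  hence "2 * \<bar>c\<bar> \<le> 2 * (\<bar>crit m\<bar> * \<bar>c\<bar>)" using mult_right_mono[of 1 "\<bar>crit m\<bar>" "\<bar>c\<bar>"] by simp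
  moreover have "(\<bar>crit m\<bar> + \<bar>c\<bar>) ^ 2 = crit m ^ 2 + 2 * (\<bar>crit m\<bar> * \<bar>c\<bar>) + \<bar>c\<bar> ^ 2"
    by (simp add: power2_sum)
  moreover have "\<bar>crit (Suc m)\<bar> \<le> crit m ^ 2 + \<bar>c\<bar>"
    using abs_triangle_ineq[of "crit m ^ 2" c] by (simp add: crit_Suc)
  ultimately have "\<bar>crit (Suc m)\<bar> + \<bar>c\<bar> \<le> (\<bar>crit m\<bar> + \<bar>c\<bar>) ^ 2"
    using zero_le_power2[of "\<bar>c\<bar>"] by linarith
  also have "\<dots> \<le> ((2 * \<bar>c\<bar>) ^ 2 ^ m) ^ 2" using Suc.IH by (intro power_mono) auto
  also have "\<dots> = (2 * \<bar>c\<bar>) ^ 2 ^ Suc m" by (simp only: power_mult[symmetric] power_Suc mult.commute)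
  finally show ?case .
qed

lemma prod_crit_upper: "(\<Prod>m=1..k. \<bar>crit m\<bar>) \<le> (2 * \<bar>c\<bar>) ^ 2 ^ Suc k"
proof -
  have b: "2 * \<bar>c\<bar> \<ge> 1" using c_nz by linarith
  have "(\<Prod>m=1..k. \<bar>crit m\<bar>) \<le> (\<Prod>m=1..k. (2 * \<bar>c\<bar>) ^ 2 ^ m)"
  proof (rule prod_mono)
    fix m assume "m \<in> {1..k}"
    thus "0 \<le> \<bar>crit m\<bar> \<and> \<bar>crit m\<bar> \<le> (2 * \<bar>c\<bar>) ^ 2 ^ m" using crit_upper[of m] by auto
  qed
  also have "\<dots> = (2 * \<bar>c\<bar>) ^ (\<Sum>m=1..k. 2 ^ m)" by (simp add: power_sum)
  also have "\<dots> \<le> (2 * \<bar>c\<bar>) ^ 2 ^ Suc k"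
  proof (rule power_increasing[OF _ b])
    show "(\<Sum>m=1..k. 2 ^ m) \<le> (2::nat) ^ Suc k" by (induction k) auto
  qed
  finally show ?thesis .
qed

lemma crit_ge_twice_c:
  assumes c2: "c \<noteq> -2"
  shows "m \<ge> 2 \<Longrightarrow> \<bar>crit m\<bar> \<ge> 2 * \<bar>c\<bar>"
proof (induction m rule: nat_induct_at_least)
  case base
  have crit2: "crit 2 = c * (c + 1)"
    using crit_Suc[of 1] crit_Suc[of 0] by (simp add: numeral_2_eq_2 power2_eq_square algebra_simps)
  have "\<bar>c + 1\<bar> \<ge> 2" using c_nz c_neq_m1 c2 by linarith
  hence "\<bar>c\<bar> * 2 \<le> \<bar>c\<bar> * \<bar>c + 1\<bar>" by (intro mult_left_mono) auto
  thus ?case by (simp add: crit2 abs_mult)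
next
  case (Suc m)
  have c1: "\<bar>c\<bar> \<ge> 1" using c_nz by linarith
  have "(2 * \<bar>c\<bar>) * 2 \<le> \<bar>crit m\<bar> * \<bar>crit m\<bar>" using Suc.IH c1 by (intro mult_mono) auto
  hence "4 * \<bar>c\<bar> \<le> crit m ^ 2" by (simp add: power2_eq_square flip: abs_mult)
  thus ?case using c1 unfolding crit_Suc by linarith
qed

text \<open>
  Once the orbit has reached \<open>2 |c|\<close>, the quantity \<open>|crit m| - 1\<close> is at least squared in every step. The value
  \<open>c = -2\<close>, for which the orbit of 0 is finite, must be excluded.
\<close>

lemma crit_lower:
  assumes c2: "c \<noteq> -2"
  shows "m \<ge> 3 \<Longrightarrow> \<bar>crit m\<bar> \<ge> 2 ^ 2 ^ (m - 3) + 1"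
proof (induction m rule: nat_induct_at_least)
  case base
  have c1: "\<bar>c\<bar> \<ge> 1" using c_nz by linarith
  have e2: "\<bar>crit 2\<bar> \<ge> 2 * \<bar>c\<bar>" using crit_ge_twice_c[OF c2] by simp
  hence "(2 * \<bar>c\<bar>) * 2 \<le> \<bar>crit 2\<bar> * \<bar>crit 2\<bar>" using c1 by (intro mult_mono) auto
  hence "4 * \<bar>c\<bar> \<le> crit 2 ^ 2" by (simp add: power2_eq_square flip: abs_mult)
  hence "\<bar>crit 3\<bar> \<ge> 3" using c1 crit_Suc[of 2] by (simp add: numeral_3_eq_3 numeral_2_eq_2)
  thus ?case by simp
next
  case (Suc m)
  let ?e = "\<bar>crit m\<bar>"
  have e: "?e \<ge> 2 * \<bar>c\<bar>" using crit_ge_twice_c[OF c2, of m] Suc.hyps by simp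
  have e2: "?e \<ge> 2" using e c_nz by linarith
  have "(?e - 1) ^ 2 = crit m ^ 2 - 2 * ?e + 1" by (simp add: power2_diff)
  moreover have "\<bar>crit (Suc m)\<bar> \<ge> crit m ^ 2 - \<bar>c\<bar>" unfolding crit_Suc by linarith
  ultimately have "\<bar>crit (Suc m)\<bar> - 1 \<ge> (?e - 1) ^ 2" using e e2 by linarith
  moreover have "(?e - 1) ^ 2 \<ge> (2 ^ 2 ^ (m - 3)) ^ 2" using Suc.IH by (intro power_mono) auto
  moreover have "((2::int) ^ 2 ^ (m - 3)) ^ 2 = 2 ^ 2 ^ (Suc m - 3)"
    using Suc.hyps by (simp only: power_mult[symmetric] Suc_diff_le power_Suc mult.commute)
  ultimately show ?case by linarith
qed

text \<open>
  The identity \<open>d y\<^sup>2 a\<^sup>2 = (W\<^sup>2 + c)(W - c)\<close> times \<open>3\<^sup>6 d\<^sup>3\<close>. In terms of \<open>U = 9 d W\<close> the right-hand side is a monic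
  cubic whose quadratic coefficient \<open>- 9 d c\<close> is removed by the shift \<open>U - 3 d c\<close>.
\<close>

lemma hall_lang_point:
  fixes d y a :: int
  defines "W \<equiv> a ^ 2 + c"
  assumes "W ^ 2 + c = d * y ^ 2"
  shows "(27 * d ^ 2 * y * a) ^ 2 =
    (9 * d * W - 3 * d * c) ^ 3 + (27 * c * d ^ 2 * (3 - c)) * (9 * d * W - 3 * d * c) + (- 54 * c ^ 2 * d ^ 3 * (c + 9))"
proof -
  have "(27 * d ^ 2 * y * a) ^ 2 = 729 * d ^ 3 * (d * y ^ 2) * (W - c)"
    by (simp add: W_def power2_eq_square power3_eq_cube)
  also have "\<dots> = 729 * d ^ 3 * (W ^ 2 + c) * (W - c)" using assms by simp
  also have "\<dots> = (9 * d * W - 3 * d * c) ^ 3 + (27 * c * d ^ 2 * (3 - c)) * (9 * d * W - 3 * d * c)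
      + (- 54 * c ^ 2 * d ^ 3 * (c + 9))"
    by (simp add: power2_eq_square power3_eq_cube algebra_simps)
  finally show ?thesis .
qed

text \<open>
  The cubic \<open>(u - c)(u\<^sup>2 + c)\<close> has a double root only for \<open>c = 0\<close> and \<open>c = -1\<close>, and then \<open>- c\<close> is a
  square.
\<close>

lemma hall_lang_nonsingular:
  fixes d :: int
  assumes "d \<noteq> 0"
  shows "4 * (27 * c * d ^ 2 * (3 - c)) ^ 3 + 27 * (- 54 * c ^ 2 * d ^ 3 * (c + 9)) ^ 2 \<noteq> 0"
proof -
  have "4 * (27 * c * d ^ 2 * (3 - c)) ^ 3 + 27 * (- 54 * c ^ 2 * d ^ 3 * (c + 9)) ^ 2
      = 2125764 * (c ^ 3 * d ^ 6 * (c + 1) ^ 2)"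
    by (simp add: eval_nat_numeral algebra_simps)
  moreover have "c + 1 \<noteq> 0" using c_neq_m1 by linarith
  ultimately show ?thesis using assms c_nz by simp
qed

text \<open>
  The coefficients of the Weierstrass equation are at most a constant multiple of \<open>|d|\<^sup>3\<close>, and its point
  has first coordinate \<open>3 d (3 crit (n + 1) - c)\<close>.
\<close>

lemma hall_lang_orbit_bound:
  assumes "hall_lang_conjecture"
  obtains C \<kappa> :: real where "C \<ge> 1" "\<kappa> \<ge> 0"
    "\<And>n d y. crit (Suc (Suc n)) = d * y ^ 2 \<Longrightarrow>
      \<bar>real_of_int (crit (Suc n))\<bar> \<le> C * (\<bar>real_of_int d\<bar> ^ 3) powr \<kappa>"
proof -
  obtain C0 \<kappa>0 :: real where hl: "\<And>A B x y :: int. 4 * A ^ 3 + 27 * B ^ 2 \<noteq> 0 \<Longrightarrow> y ^ 2 = x ^ 3 + A * x + B \<Longrightarrow>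
      real_of_int \<bar>x\<bar> \<le> C0 * real_of_int (max \<bar>A\<bar> \<bar>B\<bar>) powr \<kappa>0"
    using assms unfolding hall_lang_conjecture_def by blast
  define M where "M = real_of_int (27 * \<bar>c\<bar> * \<bar>3 - c\<bar> + 54 * c ^ 2 * \<bar>c + 9\<bar> + 1)"
  define \<kappa> where "\<kappa> = max \<kappa>0 0"
  define C where "C = max C0 1 * M powr \<kappa>"
  have M1: "M \<ge> 1" by (simp add: M_def)
  have C1: "C \<ge> 1" unfolding C_def
    using M1 ge_one_powr_ge_zero[of M \<kappa>] mult_mono[of 1 "max C0 1" 1 "M powr \<kappa>"] by (simp add: \<kappa>_def)
  have bound: "\<bar>real_of_int (crit (Suc n))\<bar> \<le> C * (\<bar>real_of_int d\<bar> ^ 3) powr \<kappa>"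
    if eq: "crit (Suc (Suc n)) = d * y ^ 2" for n d y
  proof -
    let ?W = "crit (Suc n)"
    let ?A = "27 * c * d ^ 2 * (3 - c)" and ?B = "- 54 * c ^ 2 * d ^ 3 * (c + 9)"
    let ?x = "9 * d * ?W - 3 * d * c"
    have d0: "d \<noteq> 0" using eq crit_nz[of "Suc (Suc n)"] by auto
    hence d1: "\<bar>d\<bar> \<ge> 1" by linarith
    have "(27 * d ^ 2 * y * crit n) ^ 2 = ?x ^ 3 + ?A * ?x + ?B"
      using hall_lang_point[of "crit n" d y] eq by (simp only: crit_Suc)
    hence hx: "real_of_int \<bar>?x\<bar> \<le> C0 * real_of_int (max \<bar>?A\<bar> \<bar>?B\<bar>) powr \<kappa>0"
      by (rule hl[OF hall_lang_nonsingular[OF d0]])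
    have m1: "max \<bar>?A\<bar> \<bar>?B\<bar> \<ge> 1"
    proof (rule ccontr)
      assume "\<not> max \<bar>?A\<bar> \<bar>?B\<bar> \<ge> 1"
      hence AB: "?A = 0" "?B = 0" by linarith+
      show False using hall_lang_nonsingular[OF d0] unfolding AB by simp
    qed
    have d23: "d ^ 2 \<le> \<bar>d\<bar> ^ 3"
      using power_increasing[of 2 3 "\<bar>d\<bar>"] d1 by simp
    have "\<bar>?A\<bar> \<le> 27 * \<bar>c\<bar> * \<bar>3 - c\<bar> * \<bar>d\<bar> ^ 3"
    proof -
      have "\<bar>?A\<bar> = 27 * \<bar>c\<bar> * \<bar>3 - c\<bar> * d ^ 2" by (simp add: abs_mult)
      thus ?thesis using mult_left_mono[OF d23, of "27 * \<bar>c\<bar> * \<bar>3 - c\<bar>"] by simp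
    qed
    moreover have "\<bar>?B\<bar> = 54 * c ^ 2 * \<bar>c + 9\<bar> * \<bar>d\<bar> ^ 3" by (simp add: abs_mult power_abs)
    moreover have "0 \<le> 27 * \<bar>c\<bar> * \<bar>3 - c\<bar> * \<bar>d\<bar> ^ 3" "0 \<le> 54 * c ^ 2 * \<bar>c + 9\<bar> * \<bar>d\<bar> ^ 3" "0 \<le> \<bar>d\<bar> ^ 3"
      by simp_all
    ultimately have "max \<bar>?A\<bar> \<bar>?B\<bar> \<le> (27 * \<bar>c\<bar> * \<bar>3 - c\<bar> + 54 * c ^ 2 * \<bar>c + 9\<bar> + 1) * \<bar>d\<bar> ^ 3"
      unfolding distrib_right by linarith
    hence "real_of_int (max \<bar>?A\<bar> \<bar>?B\<bar>) \<le> real_of_int ((27 * \<bar>c\<bar> * \<bar>3 - c\<bar> + 54 * c ^ 2 * \<bar>c + 9\<bar> + 1) * \<bar>d\<bar> ^ 3)"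
      by (simp only: of_int_le_iff)
    hence mM: "real_of_int (max \<bar>?A\<bar> \<bar>?B\<bar>) \<le> M * \<bar>real_of_int d\<bar> ^ 3" by (simp add: M_def)
    have "\<bar>?W\<bar> \<le> \<bar>?x\<bar>"
    proof -
      have "\<bar>?W\<bar> \<le> \<bar>3 * ?W - c\<bar>" using crit_growth[of "Suc n"] by linarith
      also have "\<dots> \<le> (3 * \<bar>d\<bar>) * \<bar>3 * ?W - c\<bar>"
        using mult_right_mono[of 1 "3 * \<bar>d\<bar>" "\<bar>3 * ?W - c\<bar>"] d1 by simp
      also have "\<dots> = \<bar>(3 * d) * (3 * ?W - c)\<bar>" by (simp only: abs_mult abs_numeral)
      also have "(3 * d) * (3 * ?W - c) = ?x" by (simp add: algebra_simps)
      finally show ?thesis .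
    qed
    hence "\<bar>real_of_int ?W\<bar> \<le> real_of_int \<bar>?x\<bar>" by (simp only: of_int_abs[symmetric] of_int_le_iff)
    also have "\<dots> \<le> C0 * real_of_int (max \<bar>?A\<bar> \<bar>?B\<bar>) powr \<kappa>0" by (rule hx)
    also have "\<dots> \<le> max C0 1 * real_of_int (max \<bar>?A\<bar> \<bar>?B\<bar>) powr \<kappa>"
      using m1 by (intro mult_mono powr_mono) (auto simp: \<kappa>_def)
    also have "\<dots> \<le> max C0 1 * (M * \<bar>real_of_int d\<bar> ^ 3) powr \<kappa>"
      using mM m1 by (intro mult_left_mono powr_mono2) (auto simp: \<kappa>_def)
    also have "\<dots> = C * (\<bar>real_of_int d\<bar> ^ 3) powr \<kappa>"
      using M1 by (simp add: C_def powr_mult)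
    finally show ?thesis .
  qed
  show ?thesis by (rule that[OF C1 _ bound]) (simp add: \<kappa>_def)
qed

text \<open>
  With \<open>t = 2\<^sup>k\<close> and \<open>k = (n + 1) div 2\<close> the logarithm of \<open>|crit n|\<close> is at least a constant times \<open>t\<^sup>2\<close>,
  while the logarithm of the bound from the conjecture is at most linear in \<open>t\<close>.
\<close>

theorem hall_lang_eventually_maximal:
  assumes hl: "hall_lang_conjecture" and c2: "c \<noteq> -2"
  shows "\<exists>N. \<forall>n\<ge>N. maximal_step n"
proof -
  obtain C \<kappa> :: real where C: "C \<ge> 1" and \<kappa>: "\<kappa> \<ge> 0" and bd: "\<And>n d y. crit (Suc (Suc n)) = d * y ^ 2 \<Longrightarrow>
      \<bar>real_of_int (crit (Suc n))\<bar> \<le> C * (\<bar>real_of_int d\<bar> ^ 3) powr \<kappa>"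
    using hall_lang_orbit_bound[OF hl] by blast
  define b where "b = 2 * \<bar>c\<bar>"
  have b2: "b \<ge> 2" using c_nz by (simp add: b_def) 
  define \<beta> where "\<beta> = 12 * \<kappa> * ln (real_of_int b)"
  have \<beta>0: "\<beta> \<ge> 0" unfolding \<beta>_def using \<kappa> b2 by simp
  have lnC: "ln C \<ge> 0" using C by simp
  obtain k0 :: nat where k0: "real k0 > 16 * (ln C + \<beta>) / ln 2" using reals_Archimedean2 by blast
  have "maximal_step n" if n: "n \<ge> 2 * k0 + 5" for n
  proof (rule ccontr)
    assume "\<not> maximal_step n"
    then obtain d where ic: "imprimitive_class (Suc n) d"
      using not_maximal_step_imprimitive_class[of n] n by auto
    then obtain y where dy: "crit (Suc n) = d * y ^ 2" unfolding imprimitive_class_def by blast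
    define k where "k = Suc n div 2"
    have k: "k \<ge> k0" "2 * k \<le> Suc n" using n by (auto simp: k_def)
    have "\<bar>d\<bar> \<le> 2 * (\<Prod>m=1..k. \<bar>crit m\<bar>)" using imprimitive_class_bound[OF ic] by (simp add: k_def)
    also have "\<dots> \<le> b * b ^ 2 ^ Suc k"
      using prod_crit_upper[of k] b2 by (intro mult_mono) (auto simp: b_def intro!: prod_nonneg)
    also have "\<dots> = b ^ (1 + 2 ^ Suc k)" by simp
    also have "\<dots> \<le> b ^ (4 * 2 ^ k)" using b2 by (intro power_increasing) auto
    finally have db: "\<bar>d\<bar> \<le> b ^ (4 * 2 ^ k)" .
    have d0: "d \<noteq> 0" using dy crit_nz[of "Suc n"] by auto
    obtain n' where n': "n = Suc n'" using n by (cases n) auto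
    have "(2::int) ^ 2 ^ (n - 3) \<le> \<bar>crit n\<bar>" using crit_lower[OF c2, of n] n by simp
    hence "real_of_int (2 ^ 2 ^ (n - 3)) \<le> real_of_int \<bar>crit n\<bar>" by (simp only: of_int_le_iff)
    hence "(2::real) ^ 2 ^ (n - 3) \<le> \<bar>real_of_int (crit n)\<bar>" by simp
    also have "\<dots> \<le> C * (\<bar>real_of_int d\<bar> ^ 3) powr \<kappa>" using bd[of n' d y] dy n' by simp
    also have "\<dots> \<le> C * ((real_of_int b ^ (4 * 2 ^ k)) ^ 3) powr \<kappa>"
    proof -
      have "\<bar>real_of_int d\<bar> \<le> real_of_int b ^ (4 * 2 ^ k)"
        using db by (metis of_int_abs of_int_le_iff of_int_power)
      thus ?thesis using C \<kappa> by (intro mult_left_mono powr_mono2 power_mono) auto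
    qed
    finally have le: "(2::real) ^ 2 ^ (n - 3) \<le> C * ((real_of_int b ^ (4 * 2 ^ k)) ^ 3) powr \<kappa>" .
    have pos: "0 < (real_of_int b ^ (4 * 2 ^ k)) ^ 3" using b2 by simp
    have "ln ((2::real) ^ 2 ^ (n - 3)) \<le> ln (C * ((real_of_int b ^ (4 * 2 ^ k)) ^ 3) powr \<kappa>)"
      using le by (intro ln_mono) auto
    also have "ln (C * ((real_of_int b ^ (4 * 2 ^ k)) ^ 3) powr \<kappa>) = ln C + \<beta> * 2 ^ k"
      using C pos b2 by (simp add: ln_mult ln_powr ln_realpow \<beta>_def)
    finally have l1: "2 ^ (n - 3) * ln 2 \<le> ln C + \<beta> * 2 ^ k" by (simp add: ln_realpow)
    let ?t = "(2::real) ^ k"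
    have "?t ^ 2 = 2 ^ (2 * k)" by (simp add: power_mult[symmetric] mult.commute)
    also have "\<dots> \<le> 2 ^ (n - 3 + 4)" using k n by (intro power_increasing) auto
    also have "\<dots> = 16 * 2 ^ (n - 3)" by (simp add: power_add)
    finally have "?t ^ 2 * ln 2 \<le> 16 * 2 ^ (n - 3) * ln 2" by (intro mult_right_mono) auto
    also have "\<dots> \<le> 16 * (ln C + \<beta> * ?t)" using l1 by simp
    also have "\<dots> \<le> 16 * ((ln C + \<beta>) * ?t)"
      using lnC mult_left_mono[of 1 ?t "ln C"] by (simp add: distrib_right)
    finally have "(?t * ln 2) * ?t \<le> (16 * (ln C + \<beta>)) * ?t" by (simp add: power2_eq_square mult_ac)
    hence "?t * ln 2 \<le> 16 * (ln C + \<beta>)" by (rule mult_right_le_imp_le) simp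
    hence "?t \<le> 16 * (ln C + \<beta>) / ln 2" by (simp add: pos_le_divide_eq)
    moreover have "real k0 \<le> ?t"
      using k(1) of_nat_less_two_power[of k, where ?'a = real] by linarith
    ultimately show False using k0 by linarith
  qed
  thus ?thesis by blast
qed

end

section \<open>The signs of the first levels\<close>

context quadratic
begin

lemma maximal_step_0: "maximal_step 0"
  unfolding maximal_step_def using rational_square_disc K_0 by blast

text \<open>
  The sign by which \<open>\<tau>\<close> fails to respect the choice of preimages above \<open>\<rho>\<close>. The product over a level, the
  \<open>level_sign\<close>, is a homomorphism to \<open>\<plusminus>1\<close> that is independent of these choices.
\<close>

definition half_sign :: "(rat alg_closure \<Rightarrow> rat alg_closure) \<Rightarrow> rat alg_closure \<Rightarrow> int" where
  "half_sign \<tau> \<rho> = (if \<tau> (half \<rho>) = half (\<tau> \<rho>) then 1 else -1)"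

definition level_sign :: "nat \<Rightarrow> (rat alg_closure \<Rightarrow> rat alg_closure) \<Rightarrow> int" where
  "level_sign n \<tau> = (\<Prod>\<rho>\<in>level n. half_sign \<tau> \<rho>)"

lemma half_sign_square: "half_sign \<tau> \<rho> * half_sign \<tau> \<rho> = 1"
  by (simp add: half_sign_def)

lemma half_sign_cases: "half_sign \<tau> \<rho> = 1 \<or> half_sign \<tau> \<rho> = -1"
  by (simp add: half_sign_def)

lemma level_sign_square: "level_sign n \<tau> * level_sign n \<tau> = 1"
  by (simp add: level_sign_def prod.distrib[symmetric] half_sign_square)

lemma level_sign_cases: "level_sign n \<tau> = 1 \<or> level_sign n \<tau> = -1"
  using level_sign_square[of n \<tau>] by (simp add: zmult_eq_1_iff)

lemma tree_map_half:
  assumes "tree_map (Suc n) \<tau>" "\<rho> \<in> level n"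
  shows "\<tau> (half \<rho>) = of_int (half_sign \<tau> \<rho>) * half (\<tau> \<rho>)"
proof -
  have "F (\<tau> (half \<rho>)) = \<tau> \<rho>"
    using tree_map_F[OF assms(1) lessI half_in_level[OF assms(2)]] by simp
  hence "\<tau> (half \<rho>) = half (\<tau> \<rho>) \<or> \<tau> (half \<rho>) = - half (\<tau> \<rho>)" using F_eq_iff_half by blast
  thus ?thesis by (auto simp: half_sign_def)
qed

lemma prod_tree_map_half:
  assumes \<tau>: "tree_map (Suc n) \<tau>"
  shows "(\<Prod>\<rho>\<in>level n. \<tau> (half \<rho>)) = of_int (level_sign n \<tau>) * (\<Prod>\<rho>\<in>level n. half \<rho>)"
proof -
  have "(\<Prod>\<rho>\<in>level n. \<tau> (half \<rho>)) = (\<Prod>\<rho>\<in>level n. of_int (half_sign \<tau> \<rho>) * half (\<tau> \<rho>))"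
    using tree_map_half[OF \<tau>] by (intro prod.cong) auto
  also have "\<dots> = of_int (level_sign n \<tau>) * (\<Prod>\<rho>\<in>level n. half (\<tau> \<rho>))"
    by (simp add: prod.distrib level_sign_def)
  also have "(\<Prod>\<rho>\<in>level n. half (\<tau> \<rho>)) = (\<Prod>\<rho>\<in>\<tau> ` level n. half \<rho>)"
    using tree_map_inj[OF \<tau>, of n] by (simp add: prod.reindex)
  finally show ?thesis using tree_map_image[OF \<tau>, of n] by simp
qed

lemma level_sign_mult:
  assumes \<sigma>: "tree_map (Suc n) \<sigma>" and \<tau>: "tree_map (Suc n) \<tau>"
  shows "level_sign n (\<lambda>z. \<sigma> (\<tau> z)) = level_sign n \<sigma> * level_sign n \<tau>"
proof -
  have "half_sign (\<lambda>z. \<sigma> (\<tau> z)) \<rho> = half_sign \<sigma> (\<tau> \<rho>) * half_sign \<tau> \<rho>" if \<rho>: "\<rho> \<in> level n" for \<rho>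
  proof -
    have t\<rho>: "\<tau> \<rho> \<in> level n" using tree_map_image[OF \<tau>, of n] \<rho> by auto
    have s\<rho>: "\<sigma> (\<tau> \<rho>) \<in> level n" using tree_map_image[OF \<sigma>, of n] t\<rho> by auto
    note h = tree_map_half[OF \<sigma> t\<rho>] half_in_level[OF t\<rho>] half_neq_minus_half[OF s\<rho>]
    have "\<sigma> (\<tau> (half \<rho>)) = of_int (half_sign \<tau> \<rho>) * \<sigma> (half (\<tau> \<rho>))"
      using tree_map_half[OF \<tau> \<rho>] tree_map_uminus[OF \<sigma> lessI h(2)] half_sign_cases[of \<tau> \<rho>]
      by (elim disjE) simp_all
    hence "\<sigma> (\<tau> (half \<rho>)) = of_int (half_sign \<tau> \<rho> * half_sign \<sigma> (\<tau> \<rho>)) * half (\<sigma> (\<tau> \<rho>))"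
      using h(1) by simp
    thus ?thesis
      using h(3)[of "\<sigma> (\<tau> \<rho>)"] unfolding half_sign_def[of "\<lambda>z. \<sigma> (\<tau> z)"]
      by (auto simp: half_sign_def split: if_splits)
  qed
  hence "level_sign n (\<lambda>z. \<sigma> (\<tau> z)) = (\<Prod>\<rho>\<in>level n. half_sign \<sigma> (\<tau> \<rho>)) * level_sign n \<tau>"
    by (simp add: level_sign_def prod.distrib)
  also have "(\<Prod>\<rho>\<in>level n. half_sign \<sigma> (\<tau> \<rho>)) = (\<Prod>\<rho>\<in>\<tau> ` level n. half_sign \<sigma> \<rho>)"
    using tree_map_inj[OF \<tau>, of n] by (simp add: prod.reindex)
  finally show ?thesis using tree_map_image[OF \<tau>, of n] by (simp add: level_sign_def)
qed

lemma level_sign_cong: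
  assumes "\<And>z. z \<in> tree \<Longrightarrow> \<sigma> z = \<tau> z" shows "level_sign n \<sigma> = level_sign n \<tau>"
  unfolding level_sign_def half_sign_def
  using assms half_in_level mem_tree by (intro prod.cong) (auto, metis+)

text \<open>
  The automorphism that exchanges the two subtrees above the vertex \<open>r\<close> of level \<open>k\<close> and otherwise respects
  the choice of preimages. The recursion is over the level \<open>n\<close> of the vertex \<open>w\<close>.
\<close>

primrec swap_above :: "rat alg_closure \<Rightarrow> nat \<Rightarrow> nat \<Rightarrow> rat alg_closure \<Rightarrow> rat alg_closure" where
  "swap_above r k 0 w = w"
| "swap_above r k (Suc n) w =
    (if n = k \<and> F w = r then -1 else 1) *
    (if w = half (F w) then half (swap_above r k n (F w)) else - half (swap_above r k n (F w)))"

lemma F_swap_above: "F (swap_above r k (Suc n) w) = swap_above r k n (F w)"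
  by simp

lemma swap_above_level: "w \<in> level n \<Longrightarrow> swap_above r k n w \<in> level n"
  by (induction n arbitrary: w) (auto simp: mem_level_Suc simp del: swap_above.simps(2) simp: F_swap_above)

lemma swap_above_uminus:
  assumes "w \<in> level (Suc n)" shows "swap_above r k (Suc n) (- w) = - swap_above r k (Suc n) w"
proof -
  have "w = half (F w) \<or> w = - half (F w)" using F_eq_iff_half by blast
  moreover have "half (F w) \<noteq> - half (F w)"
    using half_neq_minus_half[of "F w" n] assms by (simp add: mem_level_Suc)
  ultimately have neg: "- w = half (F w) \<longleftrightarrow> \<not> w = half (F w)" by (metis minus_minus)
  have "s * (if \<not> Q then b else - b) = - (s * (if Q then b else - b))" for s b :: "rat alg_closure" and Q
    by simp
  thus ?thesis unfolding swap_above.simps F_uminus neg .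
qed

lemma swap_above_inj: "inj_on (swap_above r k n) (level n)"
proof (induction n)
  case (Suc n)
  show ?case
  proof (rule inj_onI)
    fix w w' assume w: "w \<in> level (Suc n)" "w' \<in> level (Suc n)"
      "swap_above r k (Suc n) w = swap_above r k (Suc n) w'"
    hence "swap_above r k n (F w) = swap_above r k n (F w')" using F_swap_above by metis
    hence "F w = F w'" using Suc w(1,2) by (auto simp: mem_level_Suc dest: inj_onD)
    hence "w' = w \<or> w' = - w" using F_eq_iff by metis
    moreover have "w' \<noteq> - w"
    proof
      assume "w' = - w"
      hence "swap_above r k (Suc n) w = - swap_above r k (Suc n) w"
        using swap_above_uminus[OF w(1)] w(3) by metis
      hence "swap_above r k (Suc n) w = 0" by simp
      thus False using level_Suc_nz[OF swap_above_level[OF w(1)]] by blast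
    qed
    ultimately show "w = w'" by simp
  qed
qed auto

lemma exists_single_swap:
  assumes r: "r \<in> level k"
  obtains \<tau> where "\<tau> \<in> carrier (tree_aut f)" "level_sign k \<tau> = -1"
    "\<And>n. n \<noteq> k \<Longrightarrow> level_sign n \<tau> = 1"
proof -
  define \<tau> where "\<tau> = (\<lambda>z\<in>tree. swap_above r k (LEAST n. z \<in> level n) z)"
  have val: "\<tau> z = swap_above r k n z" if z: "z \<in> level n" for z n
  proof -
    have "(LEAST m. z \<in> level m) = n" using z level_disjoint by (intro Least_equality) auto
    moreover have "z \<in> tree" using z mem_tree by blast
    ultimately show ?thesis by (simp add: \<tau>_def)
  qed
  have "bij_betw \<tau> (level n) (level n)" for n
  proof -
    have "inj_on \<tau> (level n)" using swap_above_inj val by (simp add: inj_on_def)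
    moreover have "\<tau> ` level n \<subseteq> level n" using swap_above_level val by auto
    ultimately show ?thesis using endo_inj_surj[of "level n" \<tau>] by (simp add: bij_betw_def)
  qed
  moreover have "F (\<tau> w) = \<tau> (F w)" if w: "w \<in> level (Suc n)" for n w
    using val[OF w] val[of "F w" n] w F_swap_above by (metis mem_level_Suc)
  ultimately have tm: "tree_map n \<tau>" for n by (simp add: tree_map_def)
  have \<tau>c: "\<tau> \<in> carrier (tree_aut f)" using tm carrier_tree_aut by (simp add: \<tau>_def)
  have hs: "half_sign \<tau> \<rho> = (if n = k \<and> \<rho> = r then -1 else 1)" if \<rho>: "\<rho> \<in> level n" for \<rho> n
  proof -
    have "\<tau> \<rho> \<in> level n" using tree_map_image[OF tm[of n], of n] \<rho> by auto
    thus ?thesis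
      using val[OF half_in_level[OF \<rho>]] val[OF \<rho>] half_neq_minus_half[of "\<tau> \<rho>" n "\<tau> \<rho>"]
      by (auto simp: half_sign_def)
  qed
  have "level_sign n \<tau> = (\<Prod>\<rho>\<in>level n. if n = k \<and> \<rho> = r then -1 else 1)" for n
    unfolding level_sign_def by (intro prod.cong) (auto simp: hs)
  hence ls: "level_sign n \<tau> = (if n = k then -1 else 1)" for n
    using r by (simp add: prod.delta)
  show ?thesis using that[OF \<tau>c] ls by simp
qed

section \<open>The first two levels for \<open>c = 3\<close>\<close>

context
  assumes c3: "c = 3"
begin

lemma crit_Suc_3: "crit (Suc n) = crit n ^ 2 + 3"
  using crit_Suc[of n] c3 by simp

lemma F_3: "F z = z ^ 2 + 3"
  using F_def[of z] c3 by simp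

lemma half_square_3: "half \<rho> ^ 2 = \<rho> - 3"
  using half_square[of \<rho>] c3 by simp

lemma disc_1: "disc 1 = 12" and disc_2: "disc 2 = 147"
proof -
  have "crit (Suc 0) = 3" "crit (Suc (Suc 0)) = 12" "crit (Suc (Suc (Suc 0))) = 147"
    by (simp_all add: crit_Suc_3)
  thus "disc 1 = 12" "disc 2 = 147" by (simp_all add: disc_def numeral_2_eq_2)
qed

lemma square_in_K_1:
  assumes y: "y \<in> K 1" "y ^ 2 = of_int u + of_int v * half 0"
  obtains a b :: rat where "a ^ 2 - 3 * b ^ 2 = of_int u" "2 * a * b = of_int v"
proof -
  let ?\<rho> = "half 0"
  have \<rho>2: "?\<rho> ^ 2 = - 3" by (simp add: half_square_3)
  have K1: "K 1 = adjoin (K 0) ?\<rho>" using K_Suc[of "[?\<rho>]" 0] by simp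
  obtain a b where ab: "y = to_ac a + to_ac b * ?\<rho>"
    using y(1) unfolding K1 adjoin_def K_0 by blast
  have notin: "?\<rho> \<notin> K 0"
    using maximal_step_0 half_square[of 0] by (auto simp: maximal_step_def disc_def)
  have "y ^ 2 = to_ac a ^ 2 + to_ac b ^ 2 * ?\<rho> ^ 2 + 2 * to_ac a * to_ac b * ?\<rho>"
    unfolding ab by (simp add: power2_eq_square algebra_simps)
  hence "y ^ 2 = to_ac (a ^ 2 - 3 * b ^ 2) + to_ac (2 * a * b) * ?\<rho>" unfolding \<rho>2 by simp
  hence "to_ac (a ^ 2 - 3 * b ^ 2) + to_ac (2 * a * b) * ?\<rho> = to_ac (of_int u) + to_ac (of_int v) * ?\<rho>"
    using y(2) by simp
  hence "to_ac (a ^ 2 - 3 * b ^ 2) = (to_ac (of_int u) :: rat alg_closure) \<and>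
      to_ac (2 * a * b) = (to_ac (of_int v) :: rat alg_closure)"
    by (intro adjoin_coords_unique[OF is_subfield_K notin] to_ac_in_K)
  thus ?thesis unfolding to_ac_eq_iff using that by blast
qed

text \<open>
  The norm of \<open>y = a + b \<rho>\<close> with \<open>\<rho>\<^sup>2 = -3\<close> is \<open>a\<^sup>2 + 3 b\<^sup>2\<close>; its square is the norm of \<open>u + v \<rho>\<close>, and
  \<open>4 a\<^sup>2\<close> is twice the sum of \<open>u\<close> and the norm.
\<close>

lemma square_in_K_1_norm:
  assumes y: "y \<in> K 1" "y ^ 2 = of_int u + of_int v * half 0"
  shows "\<exists>k\<ge>0::int. u ^ 2 + 3 * v ^ 2 = k ^ 2 \<and> (\<exists>l::int. 2 * (u + k) = l ^ 2)"
proof -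
  obtain a b :: rat where ab: "a ^ 2 - 3 * b ^ 2 = of_int u" "2 * a * b = of_int v"
    using square_in_K_1[OF y] by blast
  let ?N = "a ^ 2 + 3 * b ^ 2"
  have "?N ^ 2 = (a ^ 2 - 3 * b ^ 2) ^ 2 + 3 * (2 * a * b) ^ 2"
    by (simp add: power2_eq_square algebra_simps)
  hence N2: "?N ^ 2 = of_int (u ^ 2 + 3 * v ^ 2)" unfolding ab by simp
  then obtain k' where k': "u ^ 2 + 3 * v ^ 2 = k' ^ 2" using rat_square_eq_int by blast
  hence "?N ^ 2 = of_int k' ^ 2" using N2 by simp
  hence "?N = of_int k' \<or> ?N = - of_int k'" by (simp only: power2_eq_iff)
  then obtain k :: int where k: "?N = of_int k" "k ^ 2 = k' ^ 2"
    by (metis of_int_minus power2_minus)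
  have "(2 * a) ^ 2 = 2 * ((a ^ 2 - 3 * b ^ 2) + ?N)" by (simp add: power2_eq_square)
  also have "\<dots> = of_int (2 * (u + k))" unfolding ab k by simp
  finally have "\<exists>l. 2 * (u + k) = l ^ 2" by (rule rat_square_eq_int)
  moreover have "(of_int k :: rat) \<ge> 0" unfolding k(1)[symmetric] by simp
  ultimately show ?thesis using k' k(2) by (intro exI[of _ k]) simp
qed

lemma int_not_square_between:
  fixes m k :: int
  assumes "m ^ 2 < N" "N < (m + 1) ^ 2" "m \<ge> 0" shows "N \<noteq> k ^ 2"
proof
  assume "N = k ^ 2"
  hence "m < \<bar>k\<bar>" "\<bar>k\<bar> < m + 1"
    using assms power2_less_imp_less[of m "\<bar>k\<bar>"] power2_less_imp_less[of "\<bar>k\<bar>" "m + 1"] by simp_all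
  thus False by linarith
qed

text \<open>
  The first pair is \<open>disc 1\<close>; the others arise in \<open>pair_not_relation\<close>.
\<close>

lemma not_square_in_K_1:
  assumes y: "y \<in> K 1" "y ^ 2 = of_int u + of_int v * half 0"
    and uv: "(u, \<bar>v\<bar>) \<in> {(12, 0), (12, 1), (144, 12), (-33, 15), (-39, 9)}"
  shows False
proof -
  obtain k l :: int where k: "k \<ge> 0" "u ^ 2 + 3 * v ^ 2 = k ^ 2" and l: "2 * (u + k) = l ^ 2"
    using square_in_K_1_norm[OF y] by blast
  have k': "u ^ 2 + 3 * \<bar>v\<bar> ^ 2 = k ^ 2" using k(2) by simp
  have sq: "k = m" if "m ^ 2 = k ^ 2" "m \<ge> 0" for m using that k(1) by (simp add: power2_eq_iff_nonneg)
  consider "u = 12" "\<bar>v\<bar> = 0" | "u = 12" "\<bar>v\<bar> = 1" | "u = 144" "\<bar>v\<bar> = 12"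
    | "u = -33" "\<bar>v\<bar> = 15" | "u = -39" "\<bar>v\<bar> = 9" using uv by auto
  thus False
  proof cases
    case 1
    hence "k = 12" using k' sq[of 12] by simp
    thus False using int_not_square_between[of 6 48 l] l 1 by simp
  next
    case 2
    thus False using int_not_square_between[of 12 147 k] k' by simp
  next
    case 3
    thus False using int_not_square_between[of 145 21168 k] k' by simp
  next
    case 4
    hence "k = 42" using k' sq[of 42] by simp
    thus False using int_not_square_between[of 4 18 l] l 4 by simp
  next
    case 5
    hence "k = 42" using k' sq[of 42] by simp
    thus False using int_not_square_between[of 2 6 l] l 5 by simp
  qed
qed

lemma maximal_step_1: "maximal_step 1"
  unfolding maximal_step_def using not_square_in_K_1[of _ 12 0] disc_1 by auto

lemma level_1: "level 1 = {half 0, - half 0}"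
  using level_Suc[of 0] by (simp add: insert_commute)

text \<open>
  The relation would make \<open>12 - F w\<close> a square in \<open>K 2\<close>. By Kummer theory over \<open>K 1\<close>, the product of
  \<open>12 - F w\<close> with 1, \<open>\<rho> - 3\<close>, \<open>- \<rho> - 3\<close> or \<open>(\<rho> - 3)(- \<rho> - 3) = 12\<close> would then be a square in \<open>K 1\<close>.
\<close>

lemma pair_not_relation:
  assumes w: "w \<in> level 2" shows "{w, - w} \<notin> relations 2"
proof
  assume rel: "{w, - w} \<in> relations 2"
  let ?\<rho> = "half 0" let ?p = "half ?\<rho>" let ?q = "half (- ?\<rho>)"
  have \<rho>2: "?\<rho> * ?\<rho> = - 3" using half_square_3[of 0] by (simp add: power2_eq_square)
  have p2: "?p * ?p = ?\<rho> - 3" and q2: "?q * ?q = - ?\<rho> - 3"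
    using half_square_3[of ?\<rho>] half_square_3[of "- ?\<rho>"] by (simp_all add: power2_eq_square)
  have "w \<noteq> - w" using level_Suc_nz[of w 1] w by (simp add: numeral_2_eq_2)
  define y where "y = half w * half (- w)"
  have yK: "y \<in> K 2" using rel \<open>w \<noteq> - w\<close> by (simp add: relations_def y_def)
  have Fw: "F w = ?\<rho> \<or> F w = - ?\<rho>"
    using w level_1 mem_level_Suc[of w 1] by (simp add: numeral_2_eq_2)
  have "y ^ 2 = (w - 3) * (- w - 3)"
    by (simp add: y_def power_mult_distrib half_square_3)
  also have "\<dots> = 12 - F w" by (simp add: F_3 power2_eq_square algebra_simps)
  finally have y2: "y ^ 2 = 12 - F w" .
  have "?\<rho> \<noteq> - ?\<rho>" using half_neq_minus_half[of 0 0 0] by simp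
  hence pq: "?p \<noteq> ?q" using F_half by metis
  have bs: "set [?p, ?q] = half ` level 1" unfolding level_1 by simp
  have sq: "b ^ 2 \<in> K 1" if "b \<in> set [?p, ?q]" for b
    using that bs half_square_in_K by (metis imageE)
  have "y ^ 2 \<in> K 1" unfolding y2
    using Fw level_1 level_subset_K[of 1] is_subfield_K[of 1]
    by (intro is_subfield_diff is_subfield_numeral) auto
  then obtain T where T: "T \<subseteq> {?p, ?q}" "y * \<Prod>T \<in> K 1"
    using kummer_square_roots[OF is_subfield_K sq _ , of "[?p, ?q]" y] pq yK K_Suc[OF bs]
    by (auto simp: numeral_2_eq_2)
  let ?z = "y * \<Prod>T"
  have z2: "?z ^ 2 = (12 - F w) * (\<Prod>T * \<Prod>T)"
    using y2 by (simp add: power_mult_distrib power2_eq_square)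
  consider "T = {}" | "T = {?p}" | "T = {?q}" | "T = {?p, ?q}" using T(1) by blast
  hence "\<exists>u v. ?z ^ 2 = of_int u + of_int v * ?\<rho> \<and>
      (u, \<bar>v\<bar>) \<in> {(12, 0), (12, 1), (144, 12), (-33, 15), (-39, 9)}"
  proof cases
    case 1
    show ?thesis using Fw z2 unfolding 1
      by (elim disjE) (intro exI[of _ 12] exI[of _ "-1"], simp, intro exI[of _ 12] exI[of _ 1], simp)
  next
    case 2
    hence z: "?z ^ 2 = (12 - F w) * (?\<rho> - 3)" using z2 p2 by simp
    have "(12 - ?\<rho>) * (?\<rho> - 3) = - 33 + 15 * ?\<rho>" "(12 + ?\<rho>) * (?\<rho> - 3) = - 39 + 9 * ?\<rho>"
      using \<rho>2 by (simp_all add: algebra_simps)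
    thus ?thesis using Fw z
      by (elim disjE) (intro exI[of _ "-33"] exI[of _ 15], simp, intro exI[of _ "-39"] exI[of _ 9], simp)
  next
    case 3
    hence z: "?z ^ 2 = (12 - F w) * (- ?\<rho> - 3)" using z2 q2 by simp
    have "(12 - ?\<rho>) * (- ?\<rho> - 3) = - 39 - 9 * ?\<rho>" "(12 + ?\<rho>) * (- ?\<rho> - 3) = - 33 - 15 * ?\<rho>"
      using \<rho>2 by (simp_all add: algebra_simps)
    thus ?thesis using Fw z
      by (elim disjE) (intro exI[of _ "-39"] exI[of _ "-9"], simp, intro exI[of _ "-33"] exI[of _ "-15"], simp)
  next
    case 4
    have "(?p * ?q) * (?p * ?q) = (?\<rho> - 3) * (- ?\<rho> - 3)"
      by (metis p2 q2 mult.assoc mult.commute)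
    also have "\<dots> = 12" using \<rho>2 by (simp add: algebra_simps)
    finally have z: "?z ^ 2 = (12 - F w) * 12" using z2 pq unfolding 4 by simp
    thus ?thesis using Fw
      by (elim disjE) (intro exI[of _ 144] exI[of _ "-12"], simp, intro exI[of _ 144] exI[of _ 12], simp)
  qed
  thus False using not_square_in_K_1[OF T(2)] by blast
qed

text \<open>
  The Galois group of \<open>K 2\<close> contains the sign change of a single pair \<open>\<plusminus>w\<close>. Applied to a relation that
  contains just one of \<open>w\<close> and \<open>- w\<close> and added to it, this gives the relation \<open>{w, - w}\<close>. A negation-closed
  relation other than the two stated ones is itself such a pair, as level 2 has only two pairs.
\<close>

lemma relations_2:
  assumes S: "S \<in> relations 2" shows "S = {} \<or> S = level 2"
proof (rule ccontr)
  assume "\<not> ?thesis"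
  hence ne: "S \<noteq> {}" "S \<noteq> level 2" by auto
  have SL: "S \<subseteq> level 2" using S by (simp add: relations_def)
  have L2: "level 2 = level (Suc 1)" by (simp add: numeral_2_eq_2)
  have mem2: "z \<in> level 2 \<longleftrightarrow> F z \<in> level 1" for z unfolding L2 by (rule mem_level_Suc)
  show False
  proof (cases "negation_closed S")
    case True
    obtain w where w: "w \<in> S" using ne by blast
    obtain v where v: "v \<in> level 2" "v \<notin> S" using ne SL by blast
    have "z = w \<or> z = - w" if z: "z \<in> S" for z
    proof -
      have Fv: "F v \<notin> F ` S" using F_mem_image_iff[OF True, of v] v(2) by blast
      have "F z \<noteq> F v" using Fv z by (metis imageI)
      moreover have "F w \<noteq> F v" using Fv w by (metis imageI)
      moreover have "F z \<in> level 1" "F w \<in> level 1" "F v \<in> level 1"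
        using z w v SL mem2 by blast+
      ultimately have "F z = F w" unfolding level_1 by auto
      thus ?thesis by (simp only: F_eq_iff)
    qed
    hence "S = {w, - w}" using w True by (auto simp: negation_closed_def)
    thus False using pair_not_relation S w SL by blast
  next
    case False
    then obtain w where w: "w \<in> S" "- w \<notin> S" by (auto simp: negation_closed_def)
    have wL: "w \<in> level (Suc 1)" using w SL unfolding L2 by blast
    \<comment> \<open>By maximality of the previous step some automorphism changes the sign of \<open>w\<close> only.\<close>
    let ?\<phi> = "\<lambda>z. if z = w \<or> z = - w then - z else z"
    have low: "z \<noteq> w \<and> z \<noteq> - w" if z: "z \<in> level k" "k \<le> 1" for z k
      using level_disjoint[OF z(1), of "Suc 1"] wL uminus_level[OF wL] z(2) by auto
    have w0: "w \<noteq> 0" using level_Suc_nz[OF wL] .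
    have bij: "bij_betw ?\<phi> (level k) (level k)" if "k \<le> Suc 1" for k
    proof (rule bij_betw_byWitness[of _ ?\<phi>])
      show "?\<phi> ` level k \<subseteq> level k"
      proof (cases "k \<le> 1")
        case True thus ?thesis using low by auto
      next
        case False
        hence "k = Suc 1" using that by simp
        thus ?thesis using uminus_level[of _ 1] by (auto simp del: One_nat_def)
      qed
      thus "?\<phi> ` level k \<subseteq> level k" .
    qed auto
    have "F (?\<phi> z) = ?\<phi> (F z)" if z: "k < Suc 1" "z \<in> level (Suc k)" for k z
      using low[of "F z" k] z by (auto simp: mem_level_Suc)
    hence tm: "tree_map (Suc 1) ?\<phi>" unfolding tree_map_def using bij by blast
    obtain \<sigma> where \<sigma>: "field_hom (K (Suc 1)) \<sigma>" "\<forall>z\<in>level (Suc 1). \<sigma> z = ?\<phi> z"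
      using hom_extends_maximal[OF maximal_step_1 field_hom_id tm] low[of _ 1] by auto
    have "\<sigma> ` S = ?\<phi> ` S" using \<sigma>(2) SL unfolding L2 by (intro image_cong) auto
    also have "\<dots> = insert (- w) (S - {w})" using w by (auto simp: image_iff)
    finally have "\<sigma> ` S = insert (- w) (S - {w})" .
    hence "sym_diff S (\<sigma> ` S) = {w, - w}" using w w0 by auto
    moreover have "sym_diff S (\<sigma> ` S) \<in> relations 2"
      using relations_sym_diff[OF S] relations_hom[OF _ S, of \<sigma>] \<sigma>(1) by (simp add: numeral_2_eq_2)
    ultimately show False using pair_not_relation[of w] wL unfolding L2 by metis
  qed
qed

text \<open>
  The squares of the two products are 12 and 147, and \<open>2\<^sup>2 \<cdot> 147 = 7\<^sup>2 \<cdot> 12\<close>.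
\<close>

lemma prod_level_relation:
  obtains \<epsilon> :: int where "\<epsilon> = 1 \<or> \<epsilon> = -1"
    "2 * (\<Prod>\<rho>\<in>level 2. half \<rho>) = of_int (7 * \<epsilon>) * (\<Prod>\<rho>\<in>level 1. half \<rho>)"
proof -
  let ?P = "\<Prod>\<rho>\<in>level 1. half \<rho>" and ?Q = "\<Prod>\<rho>\<in>level 2. half \<rho>"
  have "?P ^ 2 = 12" "?Q ^ 2 = 147"
    unfolding prod_half_square prod_level_disc disc_1 disc_2 by simp_all
  hence "(2 * ?Q) ^ 2 = (7 * ?P) ^ 2" by (simp add: power_mult_distrib)
  hence "2 * ?Q = 7 * ?P \<or> 2 * ?Q = - (7 * ?P)" by (simp only: power2_eq_iff)
  thus ?thesis using that[of 1] that[of "-1"] by auto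
qed

lemma level_sign_1_2_hom:
  assumes \<sigma>: "field_hom (K (Suc 2)) \<sigma>" shows "level_sign 1 \<sigma> = level_sign 2 \<sigma>"
proof -
  obtain \<epsilon> :: int where \<epsilon>: "\<epsilon> = 1 \<or> \<epsilon> = -1"
    "2 * (\<Prod>\<rho>\<in>level 2. half \<rho>) = of_int (7 * \<epsilon>) * (\<Prod>\<rho>\<in>level 1. half \<rho>)" by (rule prod_level_relation)
  let ?P = "\<Prod>\<rho>\<in>level 1. half \<rho>" and ?Q = "\<Prod>\<rho>\<in>level 2. half \<rho>"
  have hK: "half \<rho> \<in> K (Suc 2)" if "\<rho> \<in> level k" "k \<le> 2" for \<rho> k
    using half_in_level[OF that(1)] lower_level_subset_K[of "Suc k" "Suc 2"] that(2) by auto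
  have PK: "?P \<in> K (Suc 2)" "?Q \<in> K (Suc 2)"
    using hK[of _ 1] hK[of _ 2] by (auto intro!: is_subfield_prod[OF is_subfield_K] simp del: One_nat_def)
  note tm = tree_map_hom[OF \<sigma>]
  have sP: "\<sigma> ?P = of_int (level_sign 1 \<sigma>) * ?P"
    using field_hom_prod[OF is_subfield_K \<sigma>, of "level 1" half] hK[of _ 1]
      prod_tree_map_half[OF tree_map_mono[OF tm], of 1] by simp
  have sQ: "\<sigma> ?Q = of_int (level_sign 2 \<sigma>) * ?Q"
    using field_hom_prod[OF is_subfield_K \<sigma>, of "level 2" half] hK[of _ 2] prod_tree_map_half[OF tm] by simp
  have "\<sigma> (of_int 2 * ?Q) = \<sigma> (of_int (7 * \<epsilon>) * ?P)" using \<epsilon>(2) by simp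
  hence "of_int 2 * \<sigma> ?Q = of_int (7 * \<epsilon>) * \<sigma> ?P"
    using field_hom_mult[OF \<sigma> is_subfield_of_int[OF is_subfield_K]] PK field_hom_of_int[OF is_subfield_K \<sigma>]
    by metis
  hence "of_int (level_sign 2 \<sigma>) * (2 * ?Q) = of_int (level_sign 1 \<sigma>) * (of_int (7 * \<epsilon>) * ?P)"
    unfolding sP sQ by (simp add: mult_ac)
  hence "of_int (level_sign 2 \<sigma>) * (2 * ?Q) = of_int (level_sign 1 \<sigma>) * (2 * ?Q)" unfolding \<epsilon>(2) .
  moreover have "?Q \<noteq> 0" using prod_half_nz[of "level 2" 2] by simp
  ultimately show ?thesis by simp
qed

lemma hom_extends_2:
  assumes \<sigma>: "field_hom (K 2) \<sigma>" and \<tau>: "tree_map (Suc 2) \<tau>"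
    and eq: "\<And>\<rho>. \<rho> \<in> level 2 \<Longrightarrow> \<sigma> \<rho> = \<tau> \<rho>" and sgn: "level_sign 1 \<tau> = level_sign 2 \<tau>"
  shows "\<exists>\<sigma>'. field_hom (K (Suc 2)) \<sigma>' \<and> (\<forall>x\<in>K 2. \<sigma>' x = \<sigma> x) \<and> (\<forall>z\<in>level (Suc 2). \<sigma>' z = \<tau> z)"
proof (rule hom_extends_to_tree_map[OF \<sigma> \<tau> eq])
  fix S assume "S \<in> relations 2"
  then consider "S = {}" | "S = level 2" using relations_2 by blast
  thus "\<sigma> (\<Prod>\<rho>\<in>S. half \<rho>) = (\<Prod>\<rho>\<in>S. \<tau> (half \<rho>))"
  proof cases
    case 1 thus ?thesis using field_hom_one[OF \<sigma>] by simp
  next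
    case 2
    obtain \<epsilon> :: int where \<epsilon>: "\<epsilon> = 1 \<or> \<epsilon> = -1"
      "2 * (\<Prod>\<rho>\<in>level 2. half \<rho>) = of_int (7 * \<epsilon>) * (\<Prod>\<rho>\<in>level 1. half \<rho>)" by (rule prod_level_relation)
    let ?P = "\<Prod>\<rho>\<in>level 1. half \<rho>" and ?Q = "\<Prod>\<rho>\<in>level 2. half \<rho>"
    have hK: "half \<rho> \<in> K 2" if "\<rho> \<in> level 1" for \<rho>
      using half_in_level[OF that] level_subset_K[of 2] by (auto simp: numeral_2_eq_2)
    have PK: "?P \<in> K 2" using hK by (auto intro!: is_subfield_prod[OF is_subfield_K] simp del: One_nat_def)
    have "?Q = of_int (7 * \<epsilon>) * ?P / of_int 2" using \<epsilon>(2) by (simp add: field_simps)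
    hence QK: "?Q \<in> K 2" using PK is_subfield_K by (metis is_subfield_divide is_subfield_mult is_subfield_of_int)
    have "\<sigma> ?P = (\<Prod>\<rho>\<in>level 1. \<sigma> (half \<rho>))" using hK by (intro field_hom_prod[OF is_subfield_K \<sigma>])
    also have "\<dots> = (\<Prod>\<rho>\<in>level 1. \<tau> (half \<rho>))"
      using half_in_level[of _ 1] eq by (intro prod.cong) (auto simp: numeral_2_eq_2)
    also have "\<dots> = of_int (level_sign 1 \<tau>) * ?P"
      using prod_tree_map_half[OF tree_map_mono[OF \<tau>], of 1] by simp
    finally have sP: "\<sigma> ?P = of_int (level_sign 1 \<tau>) * ?P" .
    have "\<sigma> (of_int 2 * ?Q) = \<sigma> (of_int (7 * \<epsilon>) * ?P)" using \<epsilon>(2) by simp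
    hence "of_int 2 * \<sigma> ?Q = of_int (7 * \<epsilon>) * \<sigma> ?P"
      using field_hom_mult[OF \<sigma> is_subfield_of_int[OF is_subfield_K]] PK QK field_hom_of_int[OF is_subfield_K \<sigma>]
      by metis
    hence "2 * \<sigma> ?Q = of_int (level_sign 1 \<tau>) * (of_int (7 * \<epsilon>) * ?P)" unfolding sP by (simp add: mult_ac)
    hence "2 * \<sigma> ?Q = of_int (level_sign 1 \<tau>) * (2 * ?Q)" unfolding \<epsilon>(2) .
    hence "\<sigma> ?Q = of_int (level_sign 2 \<tau>) * ?Q" using sgn by simp
    thus ?thesis using 2 prod_tree_map_half[OF \<tau>] by simp
  qed
qed

text \<open>
  The only constraint on an automorphism in the image of Galois is the equality of the level signs 1 and 2.
  It fails for the exchange of the two subtrees above a single vertex of level 2.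
\<close>

theorem card_cosets_if_later_steps_maximal:
  assumes max: "\<And>n. n \<ge> 3 \<Longrightarrow> maximal_step n"
  shows "card (G_inf_cosets f) = 2"
proof -
  interpret G: group "tree_aut f" by (rule group_tree_aut)
  have gal: "\<tau> \<in> galois_image \<longleftrightarrow> \<tau> \<in> carrier (tree_aut f) \<and> level_sign 1 \<tau> = level_sign 2 \<tau>" for \<tau>
  proof
    assume \<tau>: "\<tau> \<in> galois_image"
    then obtain \<sigma> where \<sigma>: "field_hom (K (Suc 2)) \<sigma>" "\<forall>z\<in>level (Suc 2). \<sigma> z = \<tau> z"
      unfolding galois_image_def by blast
    have tm: "tree_map (Suc 2) \<tau>" using \<tau> carrier_tree_aut by (auto simp: galois_image_def)
    have agree: "\<sigma> z = \<tau> z" if "z \<in> level m" "m \<le> Suc 2" for z m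
      using agree_lower_level[OF tree_map_hom[OF \<sigma>(1)] tm _ that(2,1)] \<sigma>(2) by blast
    have "level_sign k \<sigma> = level_sign k \<tau>" if "k \<le> 2" for k
      unfolding level_sign_def half_sign_def
      using agree[of _ k] agree[OF half_in_level[of _ k]] that by (intro prod.cong) auto
    thus "\<tau> \<in> carrier (tree_aut f) \<and> level_sign 1 \<tau> = level_sign 2 \<tau>"
      using level_sign_1_2_hom[OF \<sigma>(1)] \<tau> by (simp add: galois_image_def)
  next
    assume \<tau>: "\<tau> \<in> carrier (tree_aut f) \<and> level_sign 1 \<tau> = level_sign 2 \<tau>"
    have tm: "tree_map n \<tau>" for n using \<tau> carrier_tree_aut by blast
    show "\<tau> \<in> galois_image"
    proof (rule galois_image_from_level[OF max])
      fix n :: nat assume "n \<le> 3"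
      thus "\<exists>\<sigma>. field_hom (K n) \<sigma> \<and> (\<forall>z\<in>level n. \<sigma> z = \<tau> z)"
      proof (induction n)
        case 0
        have "\<tau> 0 = 0" using tree_map_image[OF tm[of 0], of 0] by simp
        thus ?case using field_hom_id[of "K 0"] by (intro exI[of _ "\<lambda>x. x"]) simp
      next
        case (Suc n)
        then obtain \<sigma> where \<sigma>: "field_hom (K n) \<sigma>" "\<And>z. z \<in> level n \<Longrightarrow> \<sigma> z = \<tau> z" by auto
        consider "n = 0" | "n = 1" | "n = 2" using Suc.prems by linarith
        hence "\<exists>\<sigma>'. field_hom (K (Suc n)) \<sigma>' \<and> (\<forall>x\<in>K n. \<sigma>' x = \<sigma> x) \<and> (\<forall>z\<in>level (Suc n). \<sigma>' z = \<tau> z)"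
        proof cases
          case 1 thus ?thesis using hom_extends_maximal[OF maximal_step_0 _ tm] \<sigma> by blast
        next
          case 2 thus ?thesis using hom_extends_maximal[OF maximal_step_1 _ tm] \<sigma> by blast
        next
          case 3 thus ?thesis using hom_extends_2[OF _ tm] \<sigma> \<tau> by blast
        qed
        thus ?case by blast
      qed
    qed (use \<tau> in auto)
  qed
  have mult: "level_sign k (\<sigma> \<otimes>\<^bsub>tree_aut f\<^esub> \<tau>) = level_sign k \<sigma> * level_sign k \<tau>"
    if st: "\<sigma> \<in> carrier (tree_aut f)" "\<tau> \<in> carrier (tree_aut f)" for \<sigma> \<tau> k
  proof -
    have "level_sign k (\<sigma> \<otimes>\<^bsub>tree_aut f\<^esub> \<tau>) = level_sign k (\<lambda>z. \<sigma> (\<tau> z))"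
      by (rule level_sign_cong) (simp add: tree_aut_mult[OF st] compose_eq)
    thus ?thesis using level_sign_mult st carrier_tree_aut by metis
  qed
  obtain r where r: "r \<in> level 2" using half_in_level[of "half 0" 1] level_1 by (auto simp: numeral_2_eq_2)
  obtain \<tau>0 where \<tau>0: "\<tau>0 \<in> carrier (tree_aut f)" "level_sign 2 \<tau>0 = -1" "level_sign 1 \<tau>0 = 1"
    using exists_single_swap[OF r] by (metis numeral_2_eq_2 n_not_Suc_n One_nat_def)
  have prod: "level_sign 1 \<tau> * level_sign 2 \<tau> = (if level_sign 1 \<tau> = level_sign 2 \<tau> then 1 else -1)" for \<tau>
    using level_sign_cases[of 1 \<tau>] level_sign_cases[of 2 \<tau>] by auto
  show ?thesis unfolding G_inf_cosets_eq
  proof (rule G.card_rcosets_eq_2[OF subgroup_galois_image \<tau>0(1)])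
    show "\<tau>0 \<notin> galois_image" using gal \<tau>0 by simp
    fix x y assume xy: "x \<in> carrier (tree_aut f)" "x \<notin> galois_image" "y \<in> carrier (tree_aut f)" "y \<notin> galois_image"
    define g where "g = x \<otimes>\<^bsub>tree_aut f\<^esub> inv\<^bsub>tree_aut f\<^esub> y"
    have g: "g \<in> carrier (tree_aut f)" using xy by (simp add: g_def)
    have gy: "g \<otimes>\<^bsub>tree_aut f\<^esub> y = x" using xy by (simp add: g_def G.m_assoc)
    have "level_sign k x = level_sign k g * level_sign k y" for k using mult[OF g xy(3)] gy by simp
    moreover have "level_sign 1 x \<noteq> level_sign 2 x" "level_sign 1 y \<noteq> level_sign 2 y" using xy gal by auto
    ultimately have "level_sign 1 g = level_sign 2 g"
      using level_sign_cases[of 1 g] level_sign_cases[of 2 g] level_sign_cases[of 1 y] level_sign_cases[of 2 y]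
      by auto
    thus "x \<otimes>\<^bsub>tree_aut f\<^esub> inv\<^bsub>tree_aut f\<^esub> y \<in> galois_image" using gal g by (simp add: g_def)
  qed
qed

end

end

section \<open>The later levels for \<open>c = 3\<close>\<close>

lemma prime_int_trial_division:
  fixes p :: int
  assumes "p > 1" "p < (b + 1) ^ 2" "b \<ge> 0" "\<forall>k\<in>set [2..b]. \<not> k dvd p"
  shows "prime p"
proof (rule ccontr)
  assume "\<not> prime p"
  then obtain m where m: "m \<ge> 0" "m dvd p" "m \<noteq> 1" "m \<noteq> p" using assms(1) by (auto simp: prime_int_iff)
  then obtain k where k: "p = m * k" by (elim dvdE)
  have m2: "m \<ge> 2" using m k assms(1) by (cases "m = 0") auto
  have "k > 0" using k m2 assms(1) by (metis mult_le_0_iff not_le not_less zero_le_one order.trans less_le_trans less_imp_le m(1))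
  hence k2: "k \<ge> 2" using m(4) k by (cases "k = 1") auto
  have "\<not> (m > b \<and> k > b)"
  proof
    assume "m > b \<and> k > b"
    hence "(b + 1) * (b + 1) \<le> m * k" using assms(3) by (intro mult_mono) auto
    thus False using assms(2) k by (simp add: power2_eq_square)
  qed
  moreover have "k dvd p" using k by simp
  ultimately show False using assms(4) m(2) m2 k2 by auto
qed

text \<open>
  Certifies a list of consecutive values of the orbit modulo \<open>M\<close>, starting after \<open>x\<close>, so that the large
  numbers \<open>crit n\<close> themselves need not be computed.
\<close>

primrec orbit_residues :: "int \<Rightarrow> int \<Rightarrow> int list \<Rightarrow> bool" where
  "orbit_residues M x [] \<longleftrightarrow> True"
| "orbit_residues M x (v # vs) \<longleftrightarrow> (x * x + 3) mod M = v \<and> orbit_residues M v vs"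

lemma prime_dvd_square_class:
  fixes p N d y :: int
  assumes "prime p" "N = d * y ^ 2" "p dvd N" "\<not> p ^ 2 dvd N"
  shows "p dvd d"
proof (rule ccontr)
  assume "\<not> p dvd d"
  hence "p dvd y ^ 2" using assms(1-3) prime_dvd_mult_iff by blast
  hence "p dvd y" using assms(1) prime_dvd_power by blast
  hence "p ^ 2 dvd N" using assms(2) by (simp add: dvd_power_same)
  thus False using assms(4) by simp
qed

context quadratic
begin

context
  assumes c3: "c = 3"
begin

lemma orbit_residues_nth:
  "orbit_residues M x vs \<Longrightarrow> crit k mod M = x mod M \<Longrightarrow> i < length vs \<Longrightarrow> crit (Suc (k + i)) mod M = (vs ! i) mod M"
proof (induction vs arbitrary: x k i)
  case (Cons v vs)
  have "crit (Suc k) mod M = ((crit k mod M) ^ 2 + 3) mod M"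
    unfolding crit_Suc_3[OF c3] by (metis mod_add_left_eq power_mod)
  also have "\<dots> = (x ^ 2 + 3) mod M" unfolding Cons.prems(2) by (metis mod_add_left_eq power_mod)
  finally have v: "crit (Suc k) mod M = v mod M" using Cons.prems(1) by (auto simp: power2_eq_square)
  show ?case
  proof (cases i)
    case 0 thus ?thesis using v by simp
  next
    case (Suc j)
    thus ?thesis using Cons.IH[of v "Suc k" j] Cons.prems v by simp
  qed
qed simp

lemma orbit_residues_dvd:
  assumes "orbit_residues M 0 vs" "p dvd M" "i < length vs"
  shows "p dvd crit (Suc i) \<longleftrightarrow> p dvd vs ! i"
  using orbit_residues_nth[OF assms(1), of 0 i] assms(2,3) by (metis add_0 crit_0 dvd_mod_iff)

lemma crit_ge_1: "n \<ge> 1 \<Longrightarrow> crit n \<ge> 3"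
  by (cases n) (simp_all add: crit_Suc_3[OF c3])

text \<open>
  A prime that divides \<open>crit (n + 1)\<close> exactly once divides its squarefree part, and for an imprimitive class
  it cannot be new at \<open>n + 1\<close>. Residues modulo \<open>q\<^sup>2\<close> decide this.
\<close>

lemma maximal_step_primitive_prime:
  assumes n: "n \<ge> 1" and q: "prime q" "odd q" and M: "M = q ^ 2"
    and vs: "orbit_residues M 0 vs" "length vs = Suc n"
    and prim: "q dvd last vs" "\<not> M dvd last vs" "\<forall>v\<in>set (butlast vs). \<not> q dvd v"
  shows "maximal_step n"
proof (rule ccontr)
  obtain p where p: "q = int p" using prime_ge_0_int[OF q(1)] nonneg_int_cases by blast
  have p': "prime p" "odd p" using q p by auto
  assume "\<not> maximal_step n"
  then obtain d where ic: "imprimitive_class (Suc n) d"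
    using not_maximal_step_imprimitive_class[OF n] by blast
  then obtain y where dy: "crit (Suc n) = d * y ^ 2" unfolding imprimitive_class_def by blast
  have qM: "q dvd M" by (simp add: M)
  have "vs \<noteq> []" using vs(2) by auto
  hence last: "last vs = vs ! n" using vs(2) by (simp add: last_conv_nth)
  have "q dvd d"
    using prime_dvd_square_class[OF q(1) dy] prim(1,2) M last vs(2)
      orbit_residues_dvd[OF vs(1) qM, of n] orbit_residues_dvd[OF vs(1), of M n] by simp
  then obtain m where m: "1 \<le> m" "m < Suc n" "q dvd crit m" 
    using imprimitive_class_prime[OF ic p'] p by blast
  then obtain k where k: "m = Suc k" "k < n" by (cases m) auto
  have "vs ! k \<in> set (butlast vs)" using k(2) vs(2) by (metis diff_Suc_1 length_butlast nth_butlast nth_mem)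
  thus False using prim(3) orbit_residues_dvd[OF vs(1) qM, of k] m(3) k vs(2) by simp
qed

lemma maximal_step_3: "maximal_step 3"
proof (rule maximal_step_primitive_prime)
  show "prime (1801::int)" by (rule prime_int_trial_division[of _ 42]) simp_all
  show "orbit_residues 3243601 0 [3, 12, 147, 21612]" by simp
qed simp_all

lemma maximal_step_4: "maximal_step 4"
proof (rule maximal_step_primitive_prime)
  show "prime (13::int)" by (rule prime_int_trial_division[of _ 3]) simp_all
  show "orbit_residues 169 0 [3, 12, 147, 149, 65]" by simp
qed simp_all

lemma maximal_step_5: "maximal_step 5"
proof (rule maximal_step_primitive_prime)
  show "prime (40867::int)" by (rule prime_int_trial_division[of _ 202]) simp_all
  show "orbit_residues 1670111689 0 [3, 12, 147, 21612, 467078547, 1382612344]" by simp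
qed simp_all

lemma maximal_step_6: "maximal_step 6"
proof (rule maximal_step_primitive_prime)
  show "prime (79::int)" by (rule prime_int_trial_division[of _ 8]) simp_all
  show "orbit_residues 6241 0 [3, 12, 147, 2889, 2107, 2101, 1817]" by simp
qed simp_all

lemma maximal_step_11: "maximal_step 11"
proof (rule maximal_step_primitive_prime)
  show "prime (601::int)" by (rule prime_int_trial_division[of _ 24]) simp_all
  show "orbit_residues 361201 0 [3, 12, 147, 21612, 45654, 157949, 94735, 320182, 84106, 58855, 354639, 76928]" by simp
qed simp_all

lemma crit_values:
  "crit 1 = 3" "crit 2 = 12" "crit 4 = 21612" "crit 5 = 467078547"
  by (simp_all add: numeral_eq_Suc crit_Suc_3[OF c3])

lemma not_square_class_mod:
  fixes N b y q r :: int
  assumes "N mod q = r" "q > 0" "list_all (\<lambda>x. (b * (x * x)) mod q \<noteq> r) [0..q - 1]"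
  shows "N \<noteq> b * y ^ 2"
proof
  assume "N = b * y ^ 2"
  hence "(b * ((y mod q) * (y mod q))) mod q = r"
    using assms(1) by (metis mod_mult_eq mod_mult_right_eq power2_eq_square)
  moreover have "y mod q \<in> set [0..q - 1]" using assms(2) by simp
  ultimately show False using assms(3) unfolding list_all_iff by blast
qed

lemma imprimitive_class_dvd:
  fixes B :: int
  assumes d: "imprimitive_class N d" and B: "B > 0"
    and div: "\<And>m. 1 \<le> m \<Longrightarrow> m < N \<Longrightarrow> m dvd N \<Longrightarrow> crit m dvd 4 * B"
  shows "d dvd 2 * B"
proof (rule squarefree_dvd_if_primes_dvd)
  show "squarefree d" using d by (simp add: imprimitive_class_def)
  show "2 * B \<noteq> 0" using B by simp
  fix q :: int assume q: "prime q" "q dvd d"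
  obtain p where p': "q = int p" using prime_ge_0_int[OF q(1)] nonneg_int_cases by blast
  show "q dvd 2 * B"
  proof (cases "odd p")
    case True
    then obtain m where m: "1 \<le> m" "m < N" "m dvd N" "q dvd crit m" 
      using imprimitive_class_prime[OF d, of p] p' q by auto
    have "q dvd 4 * B" using m(4) div[OF m(1-3)] by (rule dvd_trans)
    hence "q dvd 2 * (2 * B)" by simp
    moreover have "\<not> q dvd 2"
    proof
      assume "q dvd 2"
      hence "q = 2" using q(1) primes_dvd_imp_eq[of q 2] by simp
      thus False using True p' by simp
    qed
    ultimately show ?thesis using q(1) prime_dvd_mult_iff by blast
  next
    case False
    hence "2 dvd q" using p' by simp
    hence "q = 2" using q(1) primes_dvd_imp_eq[of 2 q] by simp
    thus ?thesis by simp
  qed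
qed

lemma square_class_pos:
  assumes "crit (Suc n) = d * y ^ 2" shows "d > 0"
proof (rule ccontr)
  assume "\<not> d > 0"
  hence "d * y ^ 2 \<le> 0" by (simp add: mult_nonpos_nonneg)
  thus False using assms crit_ge_1[of "Suc n"] by simp
qed

text \<open>
  Every odd prime of an imprimitive class divides \<open>B\<close>, so the class divides \<open>2 B\<close>; being a multiple of \<open>B\<close>, it
  is \<open>B\<close> or \<open>2 B\<close>.
\<close>

lemma maximal_step_from_divisors:
  assumes n: "n \<ge> 1" and div: "\<And>m. 1 \<le> m \<Longrightarrow> m < Suc n \<Longrightarrow> m dvd Suc n \<Longrightarrow> crit m dvd 4 * B"
    and B: "B > 0" "\<And>d y. crit (Suc n) = d * y ^ 2 \<Longrightarrow> B dvd d"
    and ns: "\<And>y. crit (Suc n) \<noteq> B * y ^ 2" "\<And>y. crit (Suc n) \<noteq> (B * 2) * y ^ 2"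
  shows "maximal_step n"
proof (rule ccontr)
  assume "\<not> maximal_step n"
  then obtain d where ic: "imprimitive_class (Suc n) d"
    using not_maximal_step_imprimitive_class[OF n] by blast
  then obtain y where dy: "crit (Suc n) = d * y ^ 2" unfolding imprimitive_class_def by blast
  have "d dvd 2 * B" by (rule imprimitive_class_dvd[OF ic B(1) div])
  moreover obtain e where e: "d = B * e" using B(2)[OF dy] by (elim dvdE)
  ultimately have "e dvd 2" using B(1) by (simp add: mult.commute)
  moreover have "e > 0" using square_class_pos[OF dy] e B(1) by (simp add: zero_less_mult_iff)
  ultimately have "e = 1 \<or> e = 2" using zdvd_imp_le[of e 2] by auto
  hence "d = B \<or> d = B * 2" using e by auto
  thus False using ns(1)[of y] ns(2)[of y] dy by blast
qed

lemma prime_dvd_of_residue: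
  fixes N d y M p r :: int
  assumes "N = d * y ^ 2" "prime p" "M = p ^ 2" "N mod M = r" "p dvd r" "\<not> M dvd r"
  shows "p dvd d"
proof (rule prime_dvd_square_class[OF assms(2,1)])
  show "p dvd N" using assms(3-5) by (metis dvd_mod_iff dvd_power_same dvd_refl dvd_triv_left power2_eq_square)
  show "\<not> p ^ 2 dvd N" using assms(3,4,6) by (metis dvd_mod_iff dvd_refl)
qed

lemma dvd_mult_prime:
  fixes p B d :: int
  assumes "prime p" "p dvd d" "B dvd d" "\<not> p dvd B" shows "B * p dvd d"
  using assms prime_imp_coprime[OF assms(1,4)] by (intro divides_mult) (simp_all add: coprime_commute)

text \<open>
  The primes of \<open>crit 4 = 4 \<cdot> 5403\<close>, with \<open>5403 = 3 \<cdot> 1801\<close>, divide \<open>crit 8\<close> exactly once; and \<open>crit 8\<close> is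
  neither in the class of 5403, by its residue modulo 11, nor in that of 10806, by its residue modulo 5.
\<close>

lemma maximal_step_7: "maximal_step 7"
proof (rule maximal_step_from_divisors[of _ 5403])
  fix m :: nat assume m: "1 \<le> m" "m < Suc 7" "m dvd Suc 7"
  have "m = 1 \<or> m = 2 \<or> m = 3 \<or> m = 4 \<or> m = 5 \<or> m = 6 \<or> m = 7"
    using m(1,2) by presburger
  hence "m = 1 \<or> m = 2 \<or> m = 4" using m(3) by auto
  thus "crit m dvd 4 * 5403" using crit_values by auto
next
  have p1801: "prime (1801::int)" by (rule prime_int_trial_division[of _ 42]) simp_all
  have "orbit_residues 9 0 [3, 3, 3, 3, 3, 3, 3, 3]" by simp
  from orbit_residues_nth[OF this, of 0 7]
  have m3: "crit 8 mod 9 = 3" by simp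
  have "orbit_residues 3243601 0 [3, 12, 147, 21612, 3, 12, 147, 21612]" by simp
  from orbit_residues_nth[OF this, of 0 7]
  have m1801: "crit 8 mod 3243601 = 21612" by simp
  have "orbit_residues 11 0 [3, 1, 4, 8, 1, 4, 8, 1]" by simp
  from orbit_residues_nth[OF this, of 0 7]
  have m11: "crit 8 mod 11 = 1" by simp
  have "orbit_residues 5 0 [3, 2, 2, 2, 2, 2, 2, 2]" by simp
  from orbit_residues_nth[OF this, of 0 7]
  have m5: "crit 8 mod 5 = 2" by simp
  show "5403 dvd d" if d: "crit (Suc 7) = d * y ^ 2" for d y
  proof -
    have d8: "crit 8 = d * y ^ 2" using d by simp
    have "3 dvd d" by (rule prime_dvd_of_residue[OF d8 _ _ m3]) simp_all
    moreover have "1801 dvd d" by (rule prime_dvd_of_residue[OF d8 p1801 _ m1801]) simp_all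
    ultimately show ?thesis using dvd_mult_prime[OF p1801, of d 3] by simp
  qed
  show "crit (Suc 7) \<noteq> 5403 * y ^ 2" for y
    using not_square_class_mod[OF m11, of 5403 y] by (simp add: upto.simps)
  show "crit (Suc 7) \<noteq> (5403 * 2) * y ^ 2" for y
    using not_square_class_mod[OF m5, of 10806 y] by (simp add: upto.simps)
qed simp_all

text \<open>
  As for \<open>crit 8\<close>, with \<open>crit 5 = 3 \<cdot> 13 \<cdot> 3019 \<cdot> 3967\<close>.
\<close>

lemma maximal_step_9: "maximal_step 9"
proof (rule maximal_step_from_divisors[of _ 467078547])
  fix m :: nat assume m: "1 \<le> m" "m < Suc 9" "m dvd Suc 9"
  have "m = 1 \<or> m = 2 \<or> m = 3 \<or> m = 4 \<or> m = 5 \<or> m = 6 \<or> m = 7 \<or> m = 8 \<or> m = 9"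
    using m(1,2) by presburger
  hence "m = 1 \<or> m = 2 \<or> m = 5" using m(3) by auto
  thus "crit m dvd 4 * 467078547" using crit_values by auto
next
  have "prime (13::int)" by (rule prime_int_trial_division[of _ 3]) simp_all
  moreover have "prime (3019::int)" by (rule prime_int_trial_division[of _ 54]) simp_all
  moreover have "prime (3967::int)" by (rule prime_int_trial_division[of _ 62]) simp_all
  ultimately have primes: "prime (13::int)" "prime (3019::int)" "prime (3967::int)" by blast+
  have "orbit_residues 9 0 [3, 3, 3, 3, 3, 3, 3, 3, 3, 3]" by simp
  from orbit_residues_nth[OF this, of 0 9]
  have m3: "crit 10 mod 9 = 3" by simp
  have "orbit_residues 169 0 [3, 12, 147, 149, 65, 3, 12, 147, 149, 65]" by simp
  from orbit_residues_nth[OF this, of 0 9]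
  have m13: "crit 10 mod 169 = 65" by simp
  have "orbit_residues 9114361 0 [3, 12, 147, 21612, 2246136, 3, 12, 147, 21612, 2246136]" by simp
  from orbit_residues_nth[OF this, of 0 9]
  have m3019: "crit 10 mod 9114361 = 2246136" by simp
  have "orbit_residues 15737089 0 [3, 12, 147, 21612, 10702966, 3, 12, 147, 21612, 10702966]" by simp
  from orbit_residues_nth[OF this, of 0 9]
  have m3967: "crit 10 mod 15737089 = 10702966" by simp
  have "orbit_residues 11 0 [3, 1, 4, 8, 1, 4, 8, 1, 4, 8]" by simp
  from orbit_residues_nth[OF this, of 0 9]
  have m11: "crit 10 mod 11 = 8" by simp
  have "orbit_residues 5 0 [3, 2, 2, 2, 2, 2, 2, 2, 2, 2]" by simp
  from orbit_residues_nth[OF this, of 0 9]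
  have m5: "crit 10 mod 5 = 2" by simp
  show "467078547 dvd d" if d: "crit (Suc 9) = d * y ^ 2" for d y
  proof -
    have d10: "crit 10 = d * y ^ 2" using d by simp
    have "3 dvd d" by (rule prime_dvd_of_residue[OF d10 _ _ m3]) simp_all
    moreover have "13 dvd d" by (rule prime_dvd_of_residue[OF d10 primes(1) _ m13]) simp_all
    ultimately have "39 dvd d" using dvd_mult_prime[OF primes(1), of d 3] by simp
    moreover have "3019 dvd d" by (rule prime_dvd_of_residue[OF d10 primes(2) _ m3019]) simp_all
    ultimately have "117741 dvd d" using dvd_mult_prime[OF primes(2), of d 39] by simp
    moreover have "3967 dvd d" by (rule prime_dvd_of_residue[OF d10 primes(3) _ m3967]) simp_all
    ultimately show ?thesis using dvd_mult_prime[OF primes(3), of d 117741] by simp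
  qed
  show "crit (Suc 9) \<noteq> 467078547 * y ^ 2" for y
    using not_square_class_mod[OF m11, of 467078547 y] by (simp add: upto.simps)
  show "crit (Suc 9) \<noteq> (467078547 * 2) * y ^ 2" for y
    using not_square_class_mod[OF m5, of 934157094 y] by (simp add: upto.simps)
qed simp_all

section \<open>Consequences of the weak Hall conjecture\<close>

text \<open>
  The identity \<open>d y\<^sup>2 a\<^sup>2 = (u\<^sup>2 + 3)(u - 3) = (u - 1)\<^sup>3 - 8\<close> times \<open>d\<^sup>3\<close>.
\<close>

lemma mordell_point:
  fixes d y a :: int
  defines "u \<equiv> a ^ 2 + 3"
  assumes "u ^ 2 + 3 = d * y ^ 2"
  shows "(d ^ 2 * y * a) ^ 2 = (d * (u - 1)) ^ 3 + (- 8 * d ^ 3)"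
proof -
  have "(d ^ 2 * y * a) ^ 2 = d ^ 3 * (d * y ^ 2) * (u - 3)"
    by (simp add: u_def power2_eq_square power3_eq_cube)
  also have "\<dots> = d ^ 3 * (u ^ 2 + 3) * (u - 3)" using assms by simp
  also have "\<dots> = (d * (u - 1)) ^ 3 + (- 8 * d ^ 3)"
    by (simp add: power2_eq_square power3_eq_cube algebra_simps)
  finally show ?thesis .
qed

text \<open>
  Here \<open>26214400 = 100 \<cdot> 8\<^sup>6\<close>.
\<close>

lemma weak_hall_orbit_bound:
  assumes hall: "weak_hall_conjecture 100 4" and eq: "crit (Suc (Suc n)) = d * y ^ 2"
  shows "crit (Suc n) \<le> 26214400 * d ^ 18 + 1"
proof -
  let ?u = "crit (Suc n)"
  have d: "d > 0" by (rule square_class_pos[OF eq])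
  have u: "?u \<ge> 3" by (rule crit_ge_1) simp
  have "(d ^ 2 * y * crit n) ^ 2 = (d * (?u - 1)) ^ 3 + (- 8 * d ^ 3)"
    using mordell_point[of "crit n" d y] eq by (simp add: crit_Suc_3[OF c3])
  moreover have "- 8 * d ^ 3 \<noteq> 0" using d by simp
  ultimately have "real_of_int \<bar>d * (?u - 1)\<bar> \<le> 100 * real_of_int \<bar>- 8 * d ^ 3\<bar> powr (2 + 4)"
    using hall unfolding weak_hall_conjecture_def by blast
  also have "real_of_int \<bar>- 8 * d ^ 3\<bar> = real_of_int (8 * d ^ 3)" using d by (simp add: abs_mult)
  also have "real_of_int (8 * d ^ 3) powr (2 + 4) = real_of_int (8 * d ^ 3) ^ 6"
    using d powr_realpow[of "real_of_int (8 * d ^ 3)" 6] by simp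
  finally have "real_of_int \<bar>d * (?u - 1)\<bar> \<le> real_of_int (100 * (8 * d ^ 3) ^ 6)" by simp
  hence "\<bar>d * (?u - 1)\<bar> \<le> 100 * (8 * d ^ 3) ^ 6" by (simp only: of_int_le_iff)
  also have "\<dots> = 26214400 * d ^ 18" by (simp add: power_mult_distrib power_mult[symmetric])
  finally have "d * (?u - 1) \<le> 26214400 * d ^ 18" using d u by (simp add: abs_mult)
  moreover have "1 * (?u - 1) \<le> d * (?u - 1)" using d u by (intro mult_right_mono) auto
  ultimately show ?thesis by simp
qed

lemma crit_power_le: "k \<ge> 1 \<Longrightarrow> crit k ^ 2 ^ j \<le> crit (k + j)"
proof (induction j)
  case (Suc j)
  have "(crit k ^ 2 ^ j) ^ 2 \<le> crit (k + j) ^ 2"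
    using Suc crit_ge_1[OF Suc.prems] by (intro power_mono) auto
  also have "\<dots> \<le> crit (k + Suc j)" by (simp add: crit_Suc_3[OF c3])
  finally show ?case by (simp only: power_mult[symmetric] power_Suc mult.commute)
qed simp

lemma prod_crit_le: "k \<ge> 1 \<Longrightarrow> 2 * (\<Prod>m=1..k. crit m) \<le> crit (Suc k)"
proof (induction k rule: nat_induct_at_least)
  case base show ?case using crit_values by (simp add: numeral_2_eq_2)
next
  case (Suc k)
  have "2 * (\<Prod>m=1..Suc k. crit m) = (2 * (\<Prod>m=1..k. crit m)) * crit (Suc k)" by simp
  also have "\<dots> \<le> crit (Suc k) * crit (Suc k)"
    using Suc crit_ge_1[of "Suc k"] by (intro mult_right_mono) auto
  also have "\<dots> \<le> crit (Suc (Suc k))" by (simp add: crit_Suc_3[OF c3, of "Suc k"] power2_eq_square)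
  finally show ?case .
qed

lemma maximal_step_if_bounded:
  assumes hall: "weak_hall_conjecture 100 4" and n: "n \<ge> 1" and D: "26214400 * D ^ 18 + 1 < crit n"
    and bound: "\<And>d. imprimitive_class (Suc n) d \<Longrightarrow> d \<le> D"
  shows "maximal_step n"
proof (rule ccontr)
  assume "\<not> maximal_step n"
  then obtain d where ic: "imprimitive_class (Suc n) d"
    using not_maximal_step_imprimitive_class[OF n] by blast
  then obtain y where dy: "crit (Suc n) = d * y ^ 2" unfolding imprimitive_class_def by blast
  obtain k where k: "n = Suc k" using n by (cases n) auto
  have "crit n \<le> 26214400 * d ^ 18 + 1" using weak_hall_orbit_bound[OF hall] dy unfolding k by blast
  also have "\<dots> \<le> 26214400 * D ^ 18 + 1"
    using power_mono[OF bound[OF ic], of 18] square_class_pos[OF dy] by simp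
  finally show False using D by simp
qed

text \<open>
  An imprimitive class at 9 divides \<open>2 crit 3 = 294\<close>, while \<open>crit 8\<close> has 70 digits.
\<close>

lemma maximal_step_8:
  assumes "weak_hall_conjecture 100 4" shows "maximal_step 8"
proof (rule maximal_step_if_bounded[OF assms, where D = 294])
  have "crit 5 ^ 2 ^ 3 \<le> crit 8" using crit_power_le[of 5 3] by simp
  thus "26214400 * 294 ^ 18 + 1 < crit 8" unfolding crit_values by simp
  fix d assume d: "imprimitive_class (Suc 8) d"
  have c3v: "crit 3 = 147" by (simp add: numeral_eq_Suc crit_Suc_3[OF c3])
  have "crit m dvd 4 * 147" if m: "1 \<le> m" "m < Suc 8" "m dvd Suc 8" for m
  proof -
    have "m = 1 \<or> m = 2 \<or> m = 3 \<or> m = 4 \<or> m = 5 \<or> m = 6 \<or> m = 7 \<or> m = 8"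
      using m(1,2) by presburger
    hence "m = 1 \<or> m = 3" using m(3) by auto
    thus ?thesis using crit_values c3v by auto
  qed
  hence "d dvd 2 * 147" by (intro imprimitive_class_dvd[OF d]) auto
  thus "d \<le> 294" using zdvd_imp_le[of d 294] by simp
qed simp

text \<open>
  An imprimitive class at 11 divides \<open>2 crit 1 = 6\<close>.
\<close>

lemma maximal_step_10:
  assumes "weak_hall_conjecture 100 4" shows "maximal_step 10"
proof (rule maximal_step_if_bounded[OF assms, where D = 6])
  have "crit 5 ^ 2 ^ 5 \<le> crit 10" using crit_power_le[of 5 5] by simp
  thus "26214400 * 6 ^ 18 + 1 < crit 10" unfolding crit_values by simp
  fix d assume d: "imprimitive_class (Suc 10) d"
  have "crit m dvd 4 * 3" if m: "1 \<le> m" "m < Suc 10" "m dvd Suc 10" for m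
  proof -
    have "m = 1 \<or> m = 2 \<or> m = 3 \<or> m = 4 \<or> m = 5 \<or> m = 6 \<or> m = 7 \<or> m = 8 \<or> m = 9 \<or> m = 10"
      using m(1,2) by presburger
    hence "m = 1" using m(3) by auto
    thus ?thesis using crit_values by auto
  qed
  hence "d dvd 2 * 3" by (intro imprimitive_class_dvd[OF d]) auto
  thus "d \<le> 6" using zdvd_imp_le[of d 6] by simp
qed simp

text \<open>
  With \<open>k = (n + 1) div 2\<close> and \<open>e = crit (k + 1)\<close>, an imprimitive class is at most \<open>e\<close>. There are at least
  5 further steps from \<open>e\<close> to \<open>crit n\<close>, so \<open>crit n\<close> is at least the 32nd power of \<open>e\<close>, which exceeds the 18th power times
  \<open>12\<close> to the power 14.
\<close>

lemma maximal_step_ge_12: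
  assumes hall: "weak_hall_conjecture 100 4" and n: "n \<ge> 12" shows "maximal_step n"
proof -
  define k where "k = Suc n div 2"
  define j where "j = n - Suc k"
  have k: "k \<ge> 6" and j: "j \<ge> 5" "n = Suc k + j" using n by (auto simp: k_def j_def)
  let ?e = "crit (Suc k)"
  show ?thesis
  proof (rule maximal_step_if_bounded[OF hall, where D = ?e])
    have "crit k * crit k \<ge> 3 * 3" using crit_ge_1[of k] k by (intro mult_mono) auto
    hence e: "?e \<ge> 12" by (simp add: crit_Suc_3[OF c3] power2_eq_square)
    have "(2::nat) ^ 5 \<le> 2 ^ j" using j(1) by (intro power_increasing) auto
    hence "?e ^ (14 + 18) \<le> ?e ^ 2 ^ j" using e by (intro power_increasing) auto
    also have "\<dots> \<le> crit n" unfolding j(2) by (rule crit_power_le) simp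
    finally have "?e ^ 14 * ?e ^ 18 \<le> crit n" by (simp only: power_add)
    moreover have "(12::int) ^ 14 * ?e ^ 18 \<le> ?e ^ 14 * ?e ^ 18"
      using e by (intro mult_right_mono power_mono) auto
    moreover have "?e ^ 18 \<ge> 1" using e by simp
    ultimately show "26214400 * ?e ^ 18 + 1 < crit n" by simp
    fix d assume d: "imprimitive_class (Suc n) d"
    have "d \<le> 2 * (\<Prod>m=1..k. \<bar>crit m\<bar>)" using imprimitive_class_bound[OF d] by (simp add: k_def)
    also have "(\<Prod>m=1..k. \<bar>crit m\<bar>) = (\<Prod>m=1..k. crit m)"
    proof (rule prod.cong)
      show "\<bar>crit m\<bar> = crit m" if "m \<in> {1..k}" for m using crit_ge_1[of m] that by simp
    qed simp
    finally show "d \<le> ?e" using prod_crit_le[of k] k by simp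
  qed (use n in simp)
qed

theorem card_cosets_eq_2:
  assumes hall: "weak_hall_conjecture 100 4"
  shows "card (G_inf_cosets f) = 2"
proof (rule card_cosets_if_later_steps_maximal[OF c3])
  fix n :: nat assume "n \<ge> 3"
  hence "n \<in> {3, 4, 5, 6, 7, 8, 9, 10, 11} \<or> n \<ge> 12" by auto
  thus "maximal_step n"
    using maximal_step_3 maximal_step_4 maximal_step_5 maximal_step_6 maximal_step_7 maximal_step_8[OF hall]
      maximal_step_9 maximal_step_10[OF hall] maximal_step_11 maximal_step_ge_12[OF hall] by auto
qed

end

end

section \<open>The index of the Galois image\<close>

theorem theorem1p2:
  fixes c :: int and f :: "rat poly"
  assumes "f = [:of_int c, 0, 1:]"
    and "c \<noteq> -2"
    and "\<not> (\<exists>k::int. -c = k ^ 2)"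
  shows "(hall_lang_conjecture \<longrightarrow> finite (G_inf_cosets f)) \<and>
         (weak_hall_conjecture 100 4 \<longrightarrow> f = [:3, 0, 1:] \<longrightarrow> card (G_inf_cosets f) = 2)"
proof -
  interpret Q: quadratic c by unfold_locales (rule assms(3))
  have f: "f = Q.f" using assms(1) by (simp add: Q.f_def)
  show ?thesis
  proof (intro conjI impI)
    assume "hall_lang_conjecture"
    then obtain N where "\<forall>n\<ge>N. Q.maximal_step n"
      using Q.hall_lang_eventually_maximal assms(2) by blast
    thus "finite (G_inf_cosets f)"
      unfolding f using Q.finite_cosets_if_eventually_maximal[of N] by blast
  next
    assume hall: "weak_hall_conjecture 100 4" and "f = [:3, 0, 1:]"
    hence "(of_int c :: rat) = of_int 3" using assms(1) by simp
    hence "c = 3" by (simp only: of_int_eq_iff)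
    thus "card (G_inf_cosets f) = 2" unfolding f by (rule Q.card_cosets_eq_2[OF _ hall])
  qed
qed

end
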